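(* Let $n\ge 2$ and let $\Omega\subset\mathbb{R}^n$ be a bounded, connected, open set with Lipschitz boundary. Let $F\colon\mathbb{R}^n\to[0,+\infty[$ be a convex, positively 1-homogeneous function of class $C^2(\mathbb{R}^n\setminus\{0\})$ such that, for some constants $a,b>0$, $a|\xi|\le F(\xi)\le b|\xi|$ for all $\xi\in\mathbb{R}^n$, and such that the Hessian matrix $[F^2]_{\xi\xi}(\xi)$ is positive definite for every $\xi\in\mathbb{R}^n\setminus\{0\}$. For a constant $\beta>0$ let $\lambda_F(\beta,\Omega)$ be the first Robin eigenvalue of the Finsler Laplacian with constant boundary parameter $\beta$. Then $$\lim_{\beta\to 0^+}\frac{\lambda_F(\beta,\Omega)}{\beta}=\frac{P_F(\Omega)}{|\Omega|},$$ where $P_F(\Omega)=\int_{\partial\Omega}F(\nu)\,d\mathcal{H}^{n-1}$ is the anisotropic perimeter of $\Omega$.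
   Context: Positively 1-homogeneous means $F(t\xi)=tF(\xi)$ for $t>0$, $\xi\in\mathbb{R}^n$. $F_\xi$ denotes the gradient of $F$. $|\Omega|$ is the Lebesgue measure of $\Omega$, $\nu$ is the unit outer normal to $\partial\Omega$, $\mathcal{H}^{n-1}$ is the $(n-1)$-dimensional Hausdorff measure, and boundary values of functions in $H^1(\Omega)$ are understood as traces. The Finsler Laplacian is $\Delta_F u=\mathrm{div}\,(F(\nabla u)F_\xi(\nabla u))$ for $u\in H^1(\Omega)$ (in the weak sense). For a constant $\beta>0$, the first Robin eigenvalue, i.e. the first eigenvalue of the problem $-\Delta_F u=\lambda u$ in $\Omega$, $F(\nabla u)F_\xi(\nabla u)\cdot\nu+\beta uF(\nu)=0$ on $\partial\Omega$, is characterized by $$\lambda_F(\beta,\Omega)=\min_{v\in H^1(\Omega)\setminus\{0\}}\frac{\int_\Omega F^2(\nabla v)\,dx+\beta\int_{\partial\Omega}v^2F(\nu)\,d\mathcal{H}^{n-1}}{\int_\Omega v^2\,dx}.$$ *)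

theory Defs
  imports "HOL-Analysis.Analysis"
begin

subsection \<open>Functions of class $C^1$ and $C^2$\<close>

definition grad :: "('a::real_inner \<Rightarrow> real) \<Rightarrow> 'a \<Rightarrow> 'a"
  where "grad f x = (THE D. GDERIV f x :> D)"

text \<open>The two notions below are meant for open sets \<open>S\<close>.\<close>

definition C1_on :: "'a::real_inner set \<Rightarrow> ('a \<Rightarrow> real) \<Rightarrow> bool"
  where "C1_on S f \<longleftrightarrow> (\<forall>x\<in>S. \<exists>D. GDERIV f x :> D) \<and> continuous_on S (grad f)"

definition C2_on :: "(real^'n) set \<Rightarrow> (real^'n \<Rightarrow> real) \<Rightarrow> bool"
  where "C2_on S f \<longleftrightarrow> C1_on S f \<and> (\<forall>i. C1_on S (\<lambda>x. grad f x $ i))"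

definition hessian :: "(real^'n \<Rightarrow> real) \<Rightarrow> real^'n \<Rightarrow> real^'n^'n"
  where "hessian f x = jacobian (grad f) (at x)"

definition positive_definite :: "real^'n^'n \<Rightarrow> bool"
  where "positive_definite A \<longleftrightarrow> (\<forall>w. w \<noteq> 0 \<longrightarrow> w \<bullet> (A *v w) > 0)"

subsection \<open>Hausdorff measure\<close>

text \<open>The normalisation makes the \<open>m\<close>-dimensional Hausdorff measure agree with Lebesgue
  measure on \<open>m\<close>-dimensional planes. Two conventions of HOL need care: the diameter of an
  unbounded set is unspecified, so boundedness of the covering sets is required; and \<open>0 ^ 0 = 1\<close>,
  so the empty set is treated separately (which matters for \<open>m = 0\<close> only).\<close>

definition hausdorff_size :: "nat \<Rightarrow> 'a::metric_space set \<Rightarrow> ennreal"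
  where "hausdorff_size m C =
    (if C = {} then 0 else ennreal (unit_ball_vol (real m) * (diameter C / 2) ^ m))"

definition hausdorff_pre :: "nat \<Rightarrow> real \<Rightarrow> 'a::metric_space set \<Rightarrow> ennreal"
  where "hausdorff_pre m \<delta> A =
    (INF C \<in> {C :: nat \<Rightarrow> 'a set. A \<subseteq> (\<Union>i. C i) \<and> (\<forall>i. bounded (C i) \<and> diameter (C i) \<le> \<delta>)}.
       \<Sum>i. hausdorff_size m (C i))"

definition hausdorff_outer :: "nat \<Rightarrow> 'a::metric_space set \<Rightarrow> ennreal"
  where "hausdorff_outer m A = (SUP \<delta>\<in>{0<..}. hausdorff_pre m \<delta> A)"

definition hausdorff_measure :: "nat \<Rightarrow> 'a::metric_space measure"
  where "hausdorff_measure m = measure_of UNIV (sets borel) (hausdorff_outer m)"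

subsection \<open>Lipschitz boundary, outer normal and boundary measure\<close>

text \<open>Near each boundary point, in the direction \<open>e\<close>, the set is the strict subgraph of a
  Lipschitz function \<open>\<gamma>\<close> on the hyperplane orthogonal to \<open>e\<close>; \<open>y - (y \<bullet> e) *\<^sub>R e\<close> is the
  orthogonal projection of \<open>y\<close> to that hyperplane.\<close>

definition lipschitz_boundary :: "'a::euclidean_space set \<Rightarrow> bool"
  where "lipschitz_boundary \<Omega> \<longleftrightarrow>
    (\<forall>x\<in>frontier \<Omega>. \<exists>r>0. \<exists>e L \<gamma>. norm e = 1 \<and> L-lipschitz_on {z. z \<bullet> e = 0} \<gamma> \<and>
       \<Omega> \<inter> ball x r = {y \<in> ball x r. y \<bullet> e < \<gamma> (y - (y \<bullet> e) *\<^sub>R e)})"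

text \<open>A unit vector \<open>\<nu>\<close> is the outer normal at a boundary point \<open>x\<close> if, to first order at \<open>x\<close>, the
  set coincides with the half-space \<open>{y. (y - x) \<bullet> \<nu> < 0}\<close>. There is at most one such \<open>\<nu>\<close>. For a
  Lipschitz boundary it exists at the points where the local graph function is differentiable,
  hence almost everywhere for the surface measure, and it is the usual normal of the graph there. On
  the remaining null set the function \<open>outer_normal\<close> is set to \<open>0\<close>.\<close>

definition is_outer_normal :: "'a::euclidean_space set \<Rightarrow> 'a \<Rightarrow> 'a \<Rightarrow> bool"
  where "is_outer_normal \<Omega> x \<nu> \<longleftrightarrow> norm \<nu> = 1 \<and>
    (\<forall>\<epsilon>>0. \<exists>\<delta>>0. \<forall>y\<in>ball x \<delta>.
       ((y - x) \<bullet> \<nu> < - \<epsilon> * norm (y - x) \<longrightarrow> y \<in> \<Omega>) \<and>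
       ((y - x) \<bullet> \<nu> > \<epsilon> * norm (y - x) \<longrightarrow> y \<notin> \<Omega>))"

definition outer_normal :: "'a::euclidean_space set \<Rightarrow> 'a \<Rightarrow> 'a"
  where "outer_normal \<Omega> x =
    (if \<exists>\<nu>. is_outer_normal \<Omega> x \<nu> then THE \<nu>. is_outer_normal \<Omega> x \<nu> else 0)"

definition boundary_measure :: "'a::euclidean_space set \<Rightarrow> 'a measure"
  where "boundary_measure \<Omega> = restrict_space (hausdorff_measure (DIM('a) - 1)) (frontier \<Omega>)"

definition anisotropic_perimeter :: "('a::euclidean_space \<Rightarrow> real) \<Rightarrow> 'a set \<Rightarrow> real"
  where "anisotropic_perimeter F \<Omega> = (LINT x|boundary_measure \<Omega>. F (outer_normal \<Omega> x))"

subsection \<open>The Sobolev space $H^1$ and traces\<close>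

definition sq_integrable :: "'a measure \<Rightarrow> ('a \<Rightarrow> 'b::euclidean_space) \<Rightarrow> bool"
  where "sq_integrable M f \<longleftrightarrow> f \<in> borel_measurable M \<and> integrable M (\<lambda>x. (norm (f x))\<^sup>2)"

definition test_function :: "'a::euclidean_space set \<Rightarrow> ('a \<Rightarrow> real) \<Rightarrow> bool"
  where "test_function \<Omega> \<phi> \<longleftrightarrow>
    C1_on UNIV \<phi> \<and> (\<exists>K. compact K \<and> K \<subseteq> \<Omega> \<and> (\<forall>x. x \<notin> K \<longrightarrow> \<phi> x = 0))"

definition has_weak_gradient ::
    "'a::euclidean_space set \<Rightarrow> ('a \<Rightarrow> real) \<Rightarrow> ('a \<Rightarrow> 'a) \<Rightarrow> bool"
  where "has_weak_gradient \<Omega> v G \<longleftrightarrow> sq_integrable (lebesgue_on \<Omega>) G \<and>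
    (\<forall>\<phi>. test_function \<Omega> \<phi> \<longrightarrow>
       (LINT x|lebesgue_on \<Omega>. v x *\<^sub>R grad \<phi> x) = - (LINT x|lebesgue_on \<Omega>. \<phi> x *\<^sub>R G x))"

definition H1 :: "'a::euclidean_space set \<Rightarrow> ('a \<Rightarrow> real) set"
  where "H1 \<Omega> = {v. sq_integrable (lebesgue_on \<Omega>) v \<and> (\<exists>G. has_weak_gradient \<Omega> v G)}"

text \<open>The weak gradient is unique up to null sets.\<close>

definition weak_grad :: "'a::euclidean_space set \<Rightarrow> ('a \<Rightarrow> real) \<Rightarrow> 'a \<Rightarrow> 'a"
  where "weak_grad \<Omega> v = (SOME G. has_weak_gradient \<Omega> v G)"

text \<open>The trace operator is the continuous extension to \<open>H1 \<Omega>\<close>, with values in the square-integrable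
  functions on the boundary, of the restriction to the boundary of functions that are $C^1$ up
  to the boundary. \<open>has_trace \<Omega> v g\<close> is its graph: some $C^1$ functions \<open>\<phi> k\<close> converge to \<open>v\<close> in
  $H^1$ while their boundary values converge to \<open>g\<close> in $L^2$ of the boundary. By the trace
  theorem for bounded Lipschitz domains, every \<open>v \<in> H1 \<Omega>\<close> has a trace, unique up to null sets.\<close>

definition has_trace :: "'a::euclidean_space set \<Rightarrow> ('a \<Rightarrow> real) \<Rightarrow> ('a \<Rightarrow> real) \<Rightarrow> bool"
  where "has_trace \<Omega> v g \<longleftrightarrow> v \<in> H1 \<Omega> \<and> sq_integrable (boundary_measure \<Omega>) g \<and>
    (\<exists>\<phi> :: nat \<Rightarrow> 'a \<Rightarrow> real. (\<forall>k. C1_on UNIV (\<phi> k)) \<and>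
       (\<lambda>k. LINT x|lebesgue_on \<Omega>. (\<phi> k x - v x)\<^sup>2) \<longlonglongrightarrow> 0 \<and>
       (\<lambda>k. LINT x|lebesgue_on \<Omega>. (norm (grad (\<phi> k) x - weak_grad \<Omega> v x))\<^sup>2) \<longlonglongrightarrow> 0 \<and>
       (\<lambda>k. LINT x|boundary_measure \<Omega>. (\<phi> k x - g x)\<^sup>2) \<longlonglongrightarrow> 0)"

subsection \<open>The first Robin eigenvalue of the Finsler Laplacian\<close>

definition robin_quotient ::
    "('a::euclidean_space \<Rightarrow> real) \<Rightarrow> real \<Rightarrow> 'a set \<Rightarrow> ('a \<Rightarrow> real) \<Rightarrow> ('a \<Rightarrow> real) \<Rightarrow> real"
  where "robin_quotient F \<beta> \<Omega> v g =
    ((LINT x|lebesgue_on \<Omega>. (F (weak_grad \<Omega> v x))\<^sup>2) +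
      \<beta> * (LINT x|boundary_measure \<Omega>. (g x)\<^sup>2 * F (outer_normal \<Omega> x))) /
    (LINT x|lebesgue_on \<Omega>. (v x)\<^sup>2)"

text \<open>Variational characterization; \<open>v\<close> runs through the functions in \<open>H1 \<Omega>\<close> that do not vanish
  almost everywhere, and \<open>g\<close> is the trace of \<open>v\<close>. The infimum is a minimum on bounded
  Lipschitz domains.\<close>

definition robin_eigenvalue :: "('a::euclidean_space \<Rightarrow> real) \<Rightarrow> real \<Rightarrow> 'a set \<Rightarrow> real"
  where "robin_eigenvalue F \<beta> \<Omega> =
    Inf {robin_quotient F \<beta> \<Omega> v g | v g.
      v \<in> H1 \<Omega> \<and> \<not> (AE x in lebesgue_on \<Omega>. v x = 0) \<and> has_trace \<Omega> v g}"

end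

theory Submission
  imports Defs
begin

text \<open>
  The constant function \<open>1\<close> has Robin quotient \<open>\<beta> P / |\<Omega>|\<close> (with \<open>P\<close> the anisotropic perimeter), which
  bounds the eigenvalue from above. For the lower bound, a Poincare inequality together with a trace
  inequality yields, for every \<open>v\<close> with trace \<open>g\<close>, a constant that is close to \<open>v\<close> in $L^2$ of the domain
  and to \<open>g\<close> in $L^2$ of the boundary, up to a multiple of the $L^2$ norm of the gradient. Hence, for every
  \<open>\<delta> > 0\<close>, \<open>P\<close> times the integral of \<open>v\<^sup>2\<close> is at most \<open>(1 + \<delta>)\<^sup>2 |\<Omega>|\<close> times the boundary term of the
  quotient plus a constant multiple of the Dirichlet term, and for small \<open>\<beta>\<close> the Dirichlet term of the
  quotient absorbs the latter. Both inequalities are needed only for $C^1$ functions on the whole space,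
  since traces are defined by approximation with such functions.

  Only upper bounds for the Hausdorff measure are used. They hold because the measure generated by an outer
  measure is either that outer measure or zero on Borel sets, so Caratheodory's theorem is not needed.
\<close>

subsection \<open>$C^1$ functions and one-dimensional estimates\<close>

text \<open>The Poincare inequality is put as a double integral of squared differences because in
  that form it passes through translations and through unions of overlapping open sets: a piece of
  the domain near the boundary is slid along the chart direction into a ball inside the domain, and
  connectedness glues the pieces. The trace inequality rests on a volume comparison. Boundary points
  that are 2h apart, moved into the domain by a multiple of h, are centres of disjoint balls of
  radius h in a strip of width of order h; so a covering sum is, up to a constant, at most the
  volume of the strip divided by h, and integration along segments bounds an integral over the strip
  by h times an integral over the domain. The factors h cancel before the covering scale tends to 0.
  The weak gradient in the quotient is an arbitrary choice among all weak gradients, so even the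
  quotient of the constant 1 requires uniqueness almost everywhere. The sharp constant in the limit
  comes from comparing squares with a factor close to 1; the large constant that this creates falls
  only on the Dirichlet term.\<close>

lemma grad_eqI: "GDERIV f x :> D \<Longrightarrow> grad f x = D"
  unfolding grad_def
proof (rule the_equality)
  fix D' assume "GDERIV f x :> D" "GDERIV f x :> D'"
  then have "(\<lambda>h. h \<bullet> D') = (\<lambda>h. h \<bullet> D)"
    unfolding gderiv_def by (rule has_derivative_unique[rotated])
  then have "(D' - D) \<bullet> D' = (D' - D) \<bullet> D" by meson
  then have "(D' - D) \<bullet> (D' - D) = 0" by (simp add: inner_diff_right)
  then show "D' = D" by simp
qed

lemma C1_on_UNIV_GDERIV: "C1_on UNIV f \<Longrightarrow> GDERIV f x :> grad f x"
  unfolding C1_on_def using grad_eqI by (metis UNIV_I)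

lemma C1_on_UNIV_continuous_grad: "C1_on UNIV f \<Longrightarrow> continuous_on UNIV (grad f)"
  unfolding C1_on_def by blast

lemma C1_on_UNIV_continuous: "C1_on UNIV f \<Longrightarrow> continuous_on UNIV f"
  by (meson C1_on_UNIV_GDERIV continuous_at_imp_continuous_on gderiv_def has_derivative_continuous)

lemma C1_on_UNIV_I:
  assumes "\<And>x. GDERIV f x :> D x" "continuous_on UNIV D"
  shows "C1_on UNIV f"
proof -
  have "grad f = D" using assms(1) grad_eqI by blast
  then show ?thesis unfolding C1_on_def using assms by blast
qed

lemma C1_on_UNIV_const: "C1_on UNIV (\<lambda>x. c)"
  by (rule C1_on_UNIV_I[OF GDERIV_const]) simp

lemma grad_const: "grad (\<lambda>x. c) = (\<lambda>x. 0)"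
  using grad_eqI[OF GDERIV_const] by blast

lemma C1_on_UNIV_mult:
  assumes "C1_on UNIV f" "C1_on UNIV g"
  shows "C1_on UNIV (\<lambda>x. f x * g x)"
  using assms C1_on_UNIV_continuous_grad C1_on_UNIV_continuous
  by (intro C1_on_UNIV_I[OF GDERIV_mult[OF C1_on_UNIV_GDERIV[OF assms(1)] C1_on_UNIV_GDERIV[OF assms(2)]]]
      continuous_intros) auto

lemma C1_on_UNIV_diff:
  assumes "C1_on UNIV f" "C1_on UNIV g"
  shows "C1_on UNIV (\<lambda>x. f x - g x)"
  using assms C1_on_UNIV_continuous_grad C1_on_UNIV_continuous
  by (intro C1_on_UNIV_I[OF GDERIV_diff[OF C1_on_UNIV_GDERIV[OF assms(1)] C1_on_UNIV_GDERIV[OF assms(2)]]]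
      continuous_intros) auto

lemma C1_on_UNIV_add:
  assumes "C1_on UNIV f" "C1_on UNIV g"
  shows "C1_on UNIV (\<lambda>x. f x + g x)"
  using assms C1_on_UNIV_continuous_grad C1_on_UNIV_continuous
  by (intro C1_on_UNIV_I[OF GDERIV_add[OF C1_on_UNIV_GDERIV[OF assms(1)] C1_on_UNIV_GDERIV[OF assms(2)]]]
      continuous_intros) auto

lemma C1_on_UNIV_sum:
  assumes "\<And>i. i \<in> I \<Longrightarrow> C1_on UNIV (f i)"
  shows "C1_on UNIV (\<lambda>x. \<Sum>i\<in>I. f i x)"
  using assms by (induction I rule: infinite_finite_induct) (auto intro: C1_on_UNIV_const C1_on_UNIV_add)

lemma C1_on_UNIV_inverse:
  assumes "C1_on UNIV f" "\<And>x. f x \<noteq> 0"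
  shows "C1_on UNIV (\<lambda>x. inverse (f x))"
  using assms C1_on_UNIV_continuous_grad C1_on_UNIV_continuous
  by (intro C1_on_UNIV_I[OF GDERIV_inverse[OF C1_on_UNIV_GDERIV[OF assms(1)] assms(2)]]
      continuous_intros) auto

lemma C1_on_UNIV_compose:
  assumes "C1_on UNIV f" "\<And>t. DERIV g t :> g' t" "continuous_on UNIV g'"
  shows "C1_on UNIV (\<lambda>x. g (f x))"
  using assms C1_on_UNIV_continuous_grad C1_on_UNIV_continuous
  by (intro C1_on_UNIV_I[OF GDERIV_DERIV_compose[OF C1_on_UNIV_GDERIV[OF assms(1)] assms(2)]]
      continuous_intros continuous_on_compose2[OF assms(3)]) auto

lemma grad_diff_const: "C1_on UNIV f \<Longrightarrow> grad (\<lambda>x. f x - c) x = grad f x"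
  using grad_eqI[OF GDERIV_diff[OF C1_on_UNIV_GDERIV GDERIV_const]] by simp

lemma C1_on_UNIV_DERIV_line:
  fixes f :: "'a::real_inner \<Rightarrow> real"
  assumes "C1_on UNIV f"
  shows "DERIV (\<lambda>s. f (x + s *\<^sub>R v)) s :> v \<bullet> grad f (x + s *\<^sub>R v)"
proof -
  have 1: "(f has_derivative (\<lambda>h. h \<bullet> grad f (x + s *\<^sub>R v))) (at (x + s *\<^sub>R v))"
    using C1_on_UNIV_GDERIV[OF assms] unfolding gderiv_def .
  have 2: "((\<lambda>s. x + s *\<^sub>R v) has_derivative (\<lambda>h. h *\<^sub>R v)) (at s)"
    by (auto intro!: derivative_eq_intros)
  have "((\<lambda>s. f (x + s *\<^sub>R v)) has_derivative (\<lambda>h. (h *\<^sub>R v) \<bullet> grad f (x + s *\<^sub>R v))) (at s)"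
    using has_derivative_compose[OF 2 1] .
  then show ?thesis
    unfolding has_field_derivative_def by (simp add: mult.commute[of _ "v \<bullet> _"])
qed

text \<open>This is Cauchy-Schwarz for the integral of \<open>f'\<close> over \<open>{a..b}\<close>.
  The right-hand side is a nonnegative integral so that Fubini and changes of variables later ask
  for measurability only.\<close>

lemma square_increment_le_nn_integral:
  fixes f f' :: "real \<Rightarrow> real"
  assumes ab: "a \<le> b" and der: "\<And>x. DERIV f x :> f' x" and cont: "continuous_on UNIV f'"
  shows "ennreal ((f b - f a)\<^sup>2) \<le> ennreal (b - a) * (\<integral>\<^sup>+x\<in>{a..b}. ennreal ((f' x)\<^sup>2) \<partial>lborel)"
proof (cases "a = b")
  case False
  with ab have ab: "a < b" by simp
  define I where "I = f b - f a"
  \<comment> \<open>The mean slope minimises the integral of \<open>(f' x - c)\<^sup>2\<close>; the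
    nonnegativity of that integral, once expanded, is the inequality
    \<open>I\<^sup>2 \<le> (b - a) * J\<close>.\<close>
  define c where "c = I / (b - a)"
  have I: "(f' has_integral I) {a..b}" unfolding I_def
    using ab der by (intro fundamental_theorem_of_calculus)
      (auto simp: has_real_derivative_iff_has_vector_derivative[symmetric] intro: has_field_derivative_at_within)
  have "(\<lambda>x. (f' x)\<^sup>2) integrable_on {a..b}"
    by (intro integrable_continuous_real continuous_intros continuous_on_subset[OF cont]) auto
  then obtain J where J: "((\<lambda>x. (f' x)\<^sup>2) has_integral J) {a..b}" by blast
  have "((\<lambda>x. ((f' x)\<^sup>2 - 2 * c * f' x) + c\<^sup>2) has_integral ((J - 2 * c * I) + c\<^sup>2 * (b - a))) {a..b}"
    using ab has_integral_const_real[of "c\<^sup>2" a b]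
    by (intro has_integral_add has_integral_diff has_integral_mult_right I J) (simp add: mult.commute)
  then have "0 \<le> (J - 2 * c * I) + c\<^sup>2 * (b - a)"
  proof (rule has_integral_nonneg)
    fix x show "0 \<le> (f' x)\<^sup>2 - 2 * c * f' x + c\<^sup>2"
      using zero_le_power2[of "f' x - c"] by (simp add: power2_eq_square algebra_simps)
  qed
  also have "\<dots> = J - I\<^sup>2 / (b - a)"
  proof -
    have "c * (b - a) = I" using ab by (simp add: c_def)
    then have "c\<^sup>2 * (b - a) = c * I" "I\<^sup>2 / (b - a) = c * I"
      by (simp_all add: power2_eq_square c_def)
    then show ?thesis by simp
  qed
  finally have IJ: "I\<^sup>2 \<le> (b - a) * J" using ab by (simp add: field_simps)
  have "J \<ge> 0" using J by (rule has_integral_nonneg) simp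
  have [measurable]: "f' \<in> borel_measurable borel"
    using cont by (rule borel_measurable_continuous_onI)
  have "(\<integral>\<^sup>+x. ennreal (indicator {a..b} x * (f' x)\<^sup>2) \<partial>lborel) = ennreal J"
    using J by (intro nn_integral_has_integral_lebesgue) auto
  moreover have "(\<integral>\<^sup>+x\<in>{a..b}. ennreal ((f' x)\<^sup>2) \<partial>lborel) =
      (\<integral>\<^sup>+x. ennreal (indicator {a..b} x * (f' x)\<^sup>2) \<partial>lborel)"
    by (intro nn_integral_cong) (auto split: split_indicator)
  ultimately show ?thesis
    using IJ ab \<open>J \<ge> 0\<close> by (simp add: I_def ennreal_mult[symmetric] ennreal_leI)
qed simp

lemma square_increment_line_le:
  fixes \<phi> :: "'a::euclidean_space \<Rightarrow> real"
  assumes \<phi>: "C1_on UNIV \<phi>" and "0 \<le> t"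
  shows "ennreal ((\<phi> (x + t *\<^sub>R v) - \<phi> x)\<^sup>2) \<le>
    ennreal (t * (norm v)\<^sup>2) * (\<integral>\<^sup>+s\<in>{0..t}. ennreal ((norm (grad \<phi> (x + s *\<^sub>R v)))\<^sup>2) \<partial>lborel)"
proof -
  note c = C1_on_UNIV_continuous_grad[OF \<phi>]
  have c': "continuous_on UNIV (\<lambda>s. grad \<phi> (x + s *\<^sub>R v))"
    by (intro continuous_on_compose2[OF c]) (auto intro!: continuous_intros)
  then have [measurable]: "(\<lambda>s. grad \<phi> (x + s *\<^sub>R v)) \<in> borel_measurable borel"
    by (rule borel_measurable_continuous_onI)
  have "ennreal ((\<phi> (x + t *\<^sub>R v) - \<phi> x)\<^sup>2) \<le>
      ennreal (t - 0) * (\<integral>\<^sup>+s\<in>{0..t}. ennreal ((v \<bullet> grad \<phi> (x + s *\<^sub>R v))\<^sup>2) \<partial>lborel)"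
    using square_increment_le_nn_integral[OF \<open>0 \<le> t\<close> C1_on_UNIV_DERIV_line[OF \<phi>, of x v]] c'
    by (simp add: continuous_intros)
  also have "\<dots> \<le> ennreal t * (\<integral>\<^sup>+s. ennreal ((norm v)\<^sup>2) *
      (ennreal ((norm (grad \<phi> (x + s *\<^sub>R v)))\<^sup>2) * indicator {0..t} s) \<partial>lborel)"
  proof -
    have "(v \<bullet> w)\<^sup>2 \<le> (norm v)\<^sup>2 * (norm w)\<^sup>2" for w
      using Cauchy_Schwarz_ineq[of v w] by (simp add: power2_norm_eq_inner)
    then show ?thesis
      unfolding diff_zero by (intro mult_left_mono nn_integral_mono)
        (auto split: split_indicator simp flip: ennreal_mult intro!: ennreal_leI)
  qed
  also have "\<dots> = ennreal (t * (norm v)\<^sup>2) * (\<integral>\<^sup>+s\<in>{0..t}. ennreal ((norm (grad \<phi> (x + s *\<^sub>R v)))\<^sup>2) \<partial>lborel)"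
    using \<open>0 \<le> t\<close> by (subst nn_integral_cmult) (auto simp: ennreal_mult mult.assoc)
  finally show ?thesis .
qed

section \<open>Changes of variables for Lebesgue integrals\<close>

lemma nn_integral_lborel_translate:
  fixes f :: "'a::euclidean_space \<Rightarrow> ennreal"
  assumes [measurable]: "f \<in> borel_measurable borel"
  shows "(\<integral>\<^sup>+x. f (x + v) \<partial>lborel) = (\<integral>\<^sup>+x. f x \<partial>lborel)"
  by (subst (2) lborel_distr_plus[of v, symmetric]) (simp add: nn_integral_distr add.commute)

lemma nn_integral_lborel_affine:
  fixes f :: "'a::euclidean_space \<Rightarrow> ennreal"
  assumes [measurable]: "f \<in> borel_measurable borel" and "c \<noteq> 0"
  shows "(\<integral>\<^sup>+x. f x \<partial>lborel) = ennreal (\<bar>c\<bar> ^ DIM('a)) * (\<integral>\<^sup>+x. f (v + c *\<^sub>R x) \<partial>lborel)"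
  by (subst lborel_affine[OF \<open>c \<noteq> 0\<close>, of v])
    (simp add: nn_integral_density nn_integral_distr nn_integral_cmult)

lemma C1_on_UNIV_measurable:
  fixes \<phi> :: "'a::euclidean_space \<Rightarrow> real"
  assumes "C1_on UNIV \<phi>"
  shows "\<phi> \<in> borel_measurable borel" "grad \<phi> \<in> borel_measurable borel"
  using assms by (auto intro!: borel_measurable_continuous_onI C1_on_UNIV_continuous
      C1_on_UNIV_continuous_grad)

subsection \<open>The Poincare inequality\<close>

text \<open>For bounded \<open>U\<close> the double integral is twice the measure of
  \<open>U\<close> times the squared distance from \<open>\<phi>\<close> to its mean, so the usual
  inequality is encoded without means. The gradient is integrated over \<open>\<Omega>\<close>, not
  over \<open>U\<close>, because the paths that join points of \<open>U\<close> may leave it;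
  \<open>U\<close> itself may be disconnected.\<close>

definition poincare_on :: "'a::euclidean_space set \<Rightarrow> 'a set \<Rightarrow> bool"
  where "poincare_on \<Omega> U \<longleftrightarrow> (\<exists>C<top. \<forall>\<phi>. C1_on UNIV \<phi> \<longrightarrow>
    (\<integral>\<^sup>+x\<in>U. (\<integral>\<^sup>+y\<in>U. ennreal ((\<phi> x - \<phi> y)\<^sup>2) \<partial>lborel) \<partial>lborel)
      \<le> C * (\<integral>\<^sup>+x\<in>\<Omega>. ennreal ((norm (grad \<phi> x))\<^sup>2) \<partial>lborel))"

lemma square_sum2_le: "(a + b)\<^sup>2 \<le> 2 * a\<^sup>2 + 2 * (b::real)\<^sup>2"
  using zero_le_power2[of "a - b"] by (simp add: power2_eq_square algebra_simps)

lemma square_sum3_le: "(a + b + c)\<^sup>2 \<le> 3 * a\<^sup>2 + 3 * b\<^sup>2 + 3 * (c::real)\<^sup>2"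
  using zero_le_power2[of "a - b"] zero_le_power2[of "b - c"] zero_le_power2[of "a - c"]
  by (simp add: power2_eq_square algebra_simps)

lemma ennreal_square_diff2_le:
  "ennreal ((a - b)\<^sup>2) \<le> 2 * ennreal ((a - c)\<^sup>2) + 2 * ennreal ((c - b)\<^sup>2)"
proof -
  have "ennreal ((a - b)\<^sup>2) \<le> ennreal (2 * (a - c)\<^sup>2 + 2 * (c - b)\<^sup>2)"
    using square_sum2_le[of "a - c" "c - b"] by (intro ennreal_leI) simp
  then show ?thesis by (simp add: ennreal_plus ennreal_mult)
qed

lemma ennreal_square_diff3_le:
  "ennreal ((a - b)\<^sup>2) \<le> 3 * ennreal ((a - c)\<^sup>2) + 3 * ennreal ((c - d)\<^sup>2) + 3 * ennreal ((d - b)\<^sup>2)"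
proof -
  have "ennreal ((a - b)\<^sup>2) \<le> ennreal (3 * (a - c)\<^sup>2 + 3 * (c - d)\<^sup>2 + 3 * (d - b)\<^sup>2)"
    using square_sum3_le[of "a - c" "c - d" "d - b"] by (intro ennreal_leI) simp
  then show ?thesis by (simp add: ennreal_plus ennreal_mult)
qed

text \<open>Points \<open>x\<close> and \<open>y\<close> are joined through their midpoint, and each
  half of the segment is parametrised from its own end. On a half only \<open>s \<le> 1/2\<close>
  occurs, so replacing \<open>x\<close> by \<open>(1 - s) *\<^sub>R x + s *\<^sub>R y\<close> has a
  Jacobian bounded away from 0; along the whole segment it would degenerate at
  \<open>s = 1\<close>.\<close>

lemma poincare_on_convex:
  fixes V \<Omega> :: "'a::euclidean_space set"
  assumes "open V" "bounded V" "convex V" "V \<subseteq> \<Omega>" "open \<Omega>"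
  shows "poincare_on \<Omega> V"
proof -
  obtain D where D: "\<And>x y. x \<in> V \<Longrightarrow> y \<in> V \<Longrightarrow> norm (y - x) \<le> D"
    using \<open>bounded V\<close> diameter_bounded_bound[of V] by (metis dist_norm)
  have [measurable]: "V \<in> sets borel" "\<Omega> \<in> sets borel"
    using assms by auto
  \<comment> \<open>The factors are half the squared diameter bound, from the estimate along half a
    segment; the measure of \<open>V\<close>, from the free endpoint; \<open>2 ^ DIM('a)\<close>,
    from the inverse Jacobian; and the length of the range of \<open>s\<close>.\<close>
  define K where "K = ennreal (D\<^sup>2 / 2) * (emeasure lborel V * (ennreal (2 ^ DIM('a)) * emeasure lborel {0..1/2::real}))"
  have "K < top"
    unfolding K_def using emeasure_bounded_finite[OF \<open>bounded V\<close>]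
      emeasure_bounded_finite[OF bounded_closed_interval, of 0 "1/2::real"]
    by (simp only: ennreal_mult_less_top ennreal_less_top infinity_ennreal_def simp_thms)
  have "(\<integral>\<^sup>+x\<in>V. (\<integral>\<^sup>+y\<in>V. ennreal ((\<phi> x - \<phi> y)\<^sup>2) \<partial>lborel) \<partial>lborel)
      \<le> (2 * K + 2 * K) * (\<integral>\<^sup>+x\<in>\<Omega>. ennreal ((norm (grad \<phi> x))\<^sup>2) \<partial>lborel)" (is "_ \<le> _ * ?A")
    if \<phi>: "C1_on UNIV \<phi>" for \<phi>
  proof -
    note [measurable] = C1_on_UNIV_measurable[OF \<phi>]
    define g where "g z = ennreal ((norm (grad \<phi> z))\<^sup>2) * indicator V z" for z
    have [measurable]: "g \<in> borel_measurable borel" unfolding g_def by measurable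
    have g: "(\<integral>\<^sup>+z. g z \<partial>lborel) \<le> ?A"
      unfolding g_def using \<open>V \<subseteq> \<Omega>\<close> by (intro nn_integral_mono) (auto split: split_indicator)
    define m where "m x y = x + (1/2) *\<^sub>R (y - x)" for x y :: 'a
    have [measurable (raw)]: "(\<lambda>z. m (f z) (h z)) \<in> M \<rightarrow>\<^sub>M borel"
      if "f \<in> M \<rightarrow>\<^sub>M borel" "h \<in> M \<rightarrow>\<^sub>M borel" for f h and M :: "'z measure"
      using that unfolding m_def by measurable
    let ?k = "\<lambda>x y s. g (x + s *\<^sub>R (y - x)) * indicator V x * indicator V y * indicator {0..1/2::real} s"
    let ?q = "\<lambda>x y. ennreal ((\<phi> (m x y) - \<phi> x)\<^sup>2) * indicator V x * indicator V y"
    have q: "?q x y \<le> ennreal (D\<^sup>2 / 2) * (\<integral>\<^sup>+s. ?k x y s \<partial>lborel)" for x y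
    proof (cases "x \<in> V \<and> y \<in> V")
      case True
      have "x + s *\<^sub>R (y - x) \<in> V" if "0 \<le> s" "s \<le> 1/2" for s
      proof -
        have "x + s *\<^sub>R (y - x) = (1 - s) *\<^sub>R x + s *\<^sub>R y" by (simp add: algebra_simps)
        then show ?thesis using convexD[OF \<open>convex V\<close>, of x y "1 - s" s] True that by simp
      qed
      then have "(\<integral>\<^sup>+s\<in>{0..1/2}. ennreal ((norm (grad \<phi> (x + s *\<^sub>R (y - x))))\<^sup>2) \<partial>lborel) = (\<integral>\<^sup>+s. ?k x y s \<partial>lborel)"
        using True by (intro nn_integral_cong) (auto simp: g_def split: split_indicator)
      moreover have "1/2 * (norm (y - x))\<^sup>2 \<le> D\<^sup>2 / 2"
        using D True by (simp add: power_mono)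
      ultimately show ?thesis
        using square_increment_line_le[OF \<phi>, of "1/2" x "y - x"] True
        by (auto simp: m_def elim!: order_trans intro!: mult_right_mono ennreal_leI)
    qed auto
    \<comment> \<open>For fixed \<open>y\<close> and \<open>s\<close> the substitution is affine in
      \<open>x\<close> with ratio \<open>1 - s \<ge> 1/2\<close>. Since \<open>g\<close> is cut off
      outside \<open>V\<close>, it can be carried out on the whole space.\<close>
    have kx: "(\<integral>\<^sup>+x. ?k x y s \<partial>lborel) \<le> ennreal (2 ^ DIM('a)) * (\<integral>\<^sup>+z. g z \<partial>lborel) *
        indicator V y * indicator {0..1/2::real} s" for y s
    proof (cases "s \<in> {0..1/2}")
      case True
      have "(\<integral>\<^sup>+x. g (s *\<^sub>R y + (1 - s) *\<^sub>R x) \<partial>lborel) \<le>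
          ennreal (2 ^ DIM('a)) * (ennreal (\<bar>1 - s\<bar> ^ DIM('a)) * (\<integral>\<^sup>+x. g (s *\<^sub>R y + (1 - s) *\<^sub>R x) \<partial>lborel))"
      proof -
        have "1 \<le> (2 * \<bar>1 - s\<bar>) ^ DIM('a)" using True by (intro one_le_power) auto
        then have "1 \<le> ennreal (2 ^ DIM('a)) * ennreal (\<bar>1 - s\<bar> ^ DIM('a))"
          by (simp add: power_mult_distrib flip: ennreal_mult)
        from mult_right_mono[OF this, of "\<integral>\<^sup>+x. g (s *\<^sub>R y + (1 - s) *\<^sub>R x) \<partial>lborel"]
        show ?thesis by (simp add: mult.assoc)
      qed
      also have "\<dots> = ennreal (2 ^ DIM('a)) * (\<integral>\<^sup>+z. g z \<partial>lborel)"
        using True nn_integral_lborel_affine[of g "1 - s" "s *\<^sub>R y"] by simp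
      finally have 1: "(\<integral>\<^sup>+x. g (s *\<^sub>R y + (1 - s) *\<^sub>R x) \<partial>lborel) \<le> ennreal (2 ^ DIM('a)) * (\<integral>\<^sup>+z. g z \<partial>lborel)" .
      have "(\<integral>\<^sup>+x. ?k x y s \<partial>lborel) \<le> (\<integral>\<^sup>+x. g (s *\<^sub>R y + (1 - s) *\<^sub>R x) \<partial>lborel) * indicator V y"
        using True by (subst nn_integral_multc[symmetric])
          (auto intro!: nn_integral_mono split: split_indicator simp: algebra_simps)
      also have "\<dots> \<le> ennreal (2 ^ DIM('a)) * (\<integral>\<^sup>+z. g z \<partial>lborel) * indicator V y"
        by (intro mult_right_mono 1) simp
      finally show ?thesis using True by simp
    qed simp
    have H: "(\<integral>\<^sup>+x. (\<integral>\<^sup>+y. ?q x y \<partial>lborel) \<partial>lborel) \<le> K * ?A"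
    proof -
      have "(\<integral>\<^sup>+x. (\<integral>\<^sup>+y. (\<integral>\<^sup>+s. ?k x y s \<partial>lborel) \<partial>lborel) \<partial>lborel) =
          (\<integral>\<^sup>+y. (\<integral>\<^sup>+x. (\<integral>\<^sup>+s. ?k x y s \<partial>lborel) \<partial>lborel) \<partial>lborel)"
        by (rule lborel_pair.Fubini') measurable
      also have "\<dots> = (\<integral>\<^sup>+y. (\<integral>\<^sup>+s. (\<integral>\<^sup>+x. ?k x y s \<partial>lborel) \<partial>lborel) \<partial>lborel)"
        by (intro nn_integral_cong lborel_pair.Fubini') measurable
      also have "\<dots> \<le> (\<integral>\<^sup>+y. (\<integral>\<^sup>+s. ennreal (2 ^ DIM('a)) * (\<integral>\<^sup>+z. g z \<partial>lborel) *
        indicator V y * indicator {0..1/2::real} s \<partial>lborel) \<partial>lborel)"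
        by (intro nn_integral_mono kx)
      also have "\<dots> = ennreal (2 ^ DIM('a)) * (\<integral>\<^sup>+z. g z \<partial>lborel) * emeasure lborel V * emeasure lborel {0..1/2::real}"
        by (simp add: nn_integral_cmult nn_integral_multc)
      finally have *: "(\<integral>\<^sup>+x. (\<integral>\<^sup>+y. (\<integral>\<^sup>+s. ?k x y s \<partial>lborel) \<partial>lborel) \<partial>lborel) \<le>
        ennreal (2 ^ DIM('a)) * (\<integral>\<^sup>+z. g z \<partial>lborel) * emeasure lborel V * emeasure lborel {0..1/2::real}" .
      have "(\<integral>\<^sup>+x. (\<integral>\<^sup>+y. ?q x y \<partial>lborel) \<partial>lborel) \<le>
          (\<integral>\<^sup>+x. (\<integral>\<^sup>+y. ennreal (D\<^sup>2 / 2) * (\<integral>\<^sup>+s. ?k x y s \<partial>lborel) \<partial>lborel) \<partial>lborel)"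
        by (intro nn_integral_mono q)
      also have "\<dots> = ennreal (D\<^sup>2 / 2) * (\<integral>\<^sup>+x. (\<integral>\<^sup>+y. (\<integral>\<^sup>+s. ?k x y s \<partial>lborel) \<partial>lborel) \<partial>lborel)"
        by (simp add: nn_integral_cmult)
      also have "\<dots> \<le> ennreal (D\<^sup>2 / 2) * (ennreal (2 ^ DIM('a)) * (\<integral>\<^sup>+z. g z \<partial>lborel) *
          emeasure lborel V * emeasure lborel {0..1/2::real})"
        using * by (rule mult_left_mono) simp
      also have "\<dots> = K * (\<integral>\<^sup>+z. g z \<partial>lborel)"
        unfolding K_def by (simp only: mult_ac)
      also have "\<dots> \<le> K * ?A" using g by (rule mult_left_mono) simp
      finally show ?thesis .
    qed
    have H': "(\<integral>\<^sup>+x. (\<integral>\<^sup>+y. ?q y x \<partial>lborel) \<partial>lborel) \<le> K * ?A"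
      using H by (subst lborel_pair.Fubini') measurable
    have "(\<integral>\<^sup>+x\<in>V. (\<integral>\<^sup>+y\<in>V. ennreal ((\<phi> x - \<phi> y)\<^sup>2) \<partial>lborel) \<partial>lborel) =
        (\<integral>\<^sup>+x. (\<integral>\<^sup>+y. ennreal ((\<phi> x - \<phi> y)\<^sup>2) * indicator V x * indicator V y \<partial>lborel) \<partial>lborel)"
      by (subst nn_integral_multc[symmetric]) (auto simp: mult_ac)
    also have "\<dots> \<le> (\<integral>\<^sup>+x. (\<integral>\<^sup>+y. 2 * ?q x y + 2 * ?q y x \<partial>lborel) \<partial>lborel)"
    proof (intro nn_integral_mono)
      fix x y
      \<comment> \<open>The midpoint is symmetric in \<open>x\<close> and \<open>y\<close>, so the
        second half of the segment is the first one with the roles exchanged.\<close>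
      have "m y x = m x y" unfolding m_def by (simp add: algebra_simps flip: scaleR_add_left)
      then show "ennreal ((\<phi> x - \<phi> y)\<^sup>2) * indicator V x * indicator V y \<le> 2 * ?q x y + 2 * ?q y x"
        using ennreal_square_diff2_le[of "\<phi> x" "\<phi> y" "\<phi> (m x y)"]
        by (auto split: split_indicator simp: power2_commute)
    qed
    also have "\<dots> = 2 * (\<integral>\<^sup>+x. (\<integral>\<^sup>+y. ?q x y \<partial>lborel) \<partial>lborel) + 2 * (\<integral>\<^sup>+x. (\<integral>\<^sup>+y. ?q y x \<partial>lborel) \<partial>lborel)"
      by (simp add: nn_integral_add nn_integral_cmult)
    also have "\<dots> \<le> 2 * (K * ?A) + 2 * (K * ?A)"
      by (intro add_mono mult_left_mono H H') auto
    finally show ?thesis by (simp add: algebra_simps)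
  qed
  moreover have "2 * K + 2 * K < top"
    using \<open>K < top\<close> by (simp add: ennreal_mult_less_top)
  ultimately show ?thesis unfolding poincare_on_def by blast
qed

text \<open>After exchanging the integrals and substituting \<open>z = x + s *\<^sub>R v\<close>, a
  point \<open>z\<close> is counted for as long as \<open>z - s *\<^sub>R v\<close> stays in
  \<open>U\<close>. The trivial bound \<open>t\<close> for this length serves the Poincare
  inequality; for a thin \<open>U\<close> crossed by \<open>v\<close> the length is of the order of
  the thickness, which drives the trace inequality.\<close>

lemma nn_integral_shift_segment:
  fixes g :: "'a::euclidean_space \<Rightarrow> ennreal"
  assumes [measurable]: "g \<in> borel_measurable borel" "U \<in> sets borel" "\<Omega> \<in> sets borel"
    and seg: "\<And>x s. x \<in> U \<Longrightarrow> 0 \<le> s \<Longrightarrow> s \<le> t \<Longrightarrow> x + s *\<^sub>R v \<in> \<Omega>"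
  shows "(\<integral>\<^sup>+x\<in>U. (\<integral>\<^sup>+s\<in>{0..t}. g (x + s *\<^sub>R v) \<partial>lborel) \<partial>lborel) =
    (\<integral>\<^sup>+z\<in>\<Omega>. g z * emeasure lborel {s\<in>{0..t}. z - s *\<^sub>R v \<in> U} \<partial>lborel)"
proof -
  have "(\<integral>\<^sup>+x\<in>U. (\<integral>\<^sup>+s\<in>{0..t}. g (x + s *\<^sub>R v) \<partial>lborel) \<partial>lborel) =
      (\<integral>\<^sup>+x. (\<integral>\<^sup>+s. g (x + s *\<^sub>R v) * indicator \<Omega> (x + s *\<^sub>R v) * indicator U x * indicator {0..t} s \<partial>lborel) \<partial>lborel)"
    using seg by (subst nn_integral_multc[symmetric])
      (auto intro!: nn_integral_cong split: split_indicator)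
  also have "\<dots> = (\<integral>\<^sup>+s. (\<integral>\<^sup>+x. g (x + s *\<^sub>R v) * indicator \<Omega> (x + s *\<^sub>R v) * indicator U x * indicator {0..t} s \<partial>lborel) \<partial>lborel)"
    by (rule lborel_pair.Fubini') measurable
  also have "\<dots> = (\<integral>\<^sup>+s. (\<integral>\<^sup>+z. g z * indicator \<Omega> z * indicator U (z - s *\<^sub>R v) * indicator {0..t} s \<partial>lborel) \<partial>lborel)"
  proof (rule nn_integral_cong)
    fix s
    show "(\<integral>\<^sup>+x. g (x + s *\<^sub>R v) * indicator \<Omega> (x + s *\<^sub>R v) * indicator U x * indicator {0..t} s \<partial>lborel) =
      (\<integral>\<^sup>+z. g z * indicator \<Omega> z * indicator U (z - s *\<^sub>R v) * indicator {0..t} s \<partial>lborel)"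
      by (subst nn_integral_lborel_translate[of "\<lambda>z. g z * indicator \<Omega> z * indicator U (z - s *\<^sub>R v) * indicator {0..t} s" "s *\<^sub>R v", symmetric])
        auto
  qed
  also have "\<dots> = (\<integral>\<^sup>+z. (\<integral>\<^sup>+s. g z * indicator \<Omega> z * indicator U (z - s *\<^sub>R v) * indicator {0..t} s \<partial>lborel) \<partial>lborel)"
    by (rule lborel_pair.Fubini') measurable
  also have "\<dots> = (\<integral>\<^sup>+z\<in>\<Omega>. g z * emeasure lborel {s\<in>{0..t}. z - s *\<^sub>R v \<in> U} \<partial>lborel)"
  proof (intro nn_integral_cong)
    fix z
    have "(\<lambda>s. z - s *\<^sub>R v) -` U \<inter> space borel \<in> sets borel"
      by (rule measurable_sets[of _ borel borel]) auto
    then have *: "{s\<in>{0..t}. z - s *\<^sub>R v \<in> U} \<in> sets borel"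
      using sets.Int[of "(\<lambda>s. z - s *\<^sub>R v) -` U" borel "{0..t}"] by (simp add: vimage_def Int_def conj_commute)
    have "(\<integral>\<^sup>+s. g z * indicator \<Omega> z * indicator U (z - s *\<^sub>R v) * indicator {0..t} s \<partial>lborel) =
        (\<integral>\<^sup>+s. (g z * indicator \<Omega> z) * indicator {s\<in>{0..t}. z - s *\<^sub>R v \<in> U} s \<partial>lborel)"
      by (intro nn_integral_cong) (auto split: split_indicator)
    also have "\<dots> = (g z * indicator \<Omega> z) * emeasure lborel {s\<in>{0..t}. z - s *\<^sub>R v \<in> U}"
      using * by (intro nn_integral_cmult_indicator) simp
    finally show "(\<integral>\<^sup>+s. g z * indicator \<Omega> z * indicator U (z - s *\<^sub>R v) * indicator {0..t} s \<partial>lborel) =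
        g z * emeasure lborel {s\<in>{0..t}. z - s *\<^sub>R v \<in> U} * indicator \<Omega> z"
      by (simp only: mult_ac)
  qed
  finally show ?thesis .
qed

text \<open>The difference \<open>\<phi> x - \<phi> y\<close> is split at the translates of
  \<open>x\<close> and \<open>y\<close> in \<open>V\<close>. The two outer differences are
  controlled along segments inside \<open>\<Omega>\<close>, the middle one by the inequality on
  \<open>V\<close>, since translation preserves Lebesgue measure.\<close>

lemma poincare_on_translate:
  fixes U V \<Omega> :: "'a::euclidean_space set"
  assumes "open U" "bounded U" "open V" "open \<Omega>" "poincare_on \<Omega> V" "0 \<le> t"
    and seg: "\<And>x s. x \<in> U \<Longrightarrow> 0 \<le> s \<Longrightarrow> s \<le> t \<Longrightarrow> x + s *\<^sub>R v \<in> \<Omega>"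
    and UV: "\<And>x. x \<in> U \<Longrightarrow> x + t *\<^sub>R v \<in> V"
  shows "poincare_on \<Omega> U"
proof -
  have [measurable]: "U \<in> sets borel" "V \<in> sets borel" "\<Omega> \<in> sets borel"
    using assms by auto
  obtain C where C: "C < top" and PC: "\<And>\<phi>. C1_on UNIV \<phi> \<Longrightarrow>
    (\<integral>\<^sup>+x\<in>V. (\<integral>\<^sup>+y\<in>V. ennreal ((\<phi> x - \<phi> y)\<^sup>2) \<partial>lborel) \<partial>lborel)
      \<le> C * (\<integral>\<^sup>+x\<in>\<Omega>. ennreal ((norm (grad \<phi> x))\<^sup>2) \<partial>lborel)"
    using \<open>poincare_on \<Omega> V\<close> unfolding poincare_on_def by blast
  \<comment> \<open>\<open>t * (norm v)\<^sup>2\<close> comes from the estimate along a segment; the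
    further \<open>t\<close> bounds the length of the set of parameters in \<open>{0..t}\<close> for
    which a given point is reached from \<open>U\<close>.\<close>
  define L where "L = ennreal (t * (norm v)\<^sup>2) * ennreal t"
  define K where "K = 3 * (L * emeasure lborel U) + 3 * C + 3 * (L * emeasure lborel U)"
  have "K < top" unfolding K_def L_def using C emeasure_bounded_finite[OF \<open>bounded U\<close>]
    by (auto simp: ennreal_mult_less_top)
  moreover have "(\<integral>\<^sup>+x\<in>U. (\<integral>\<^sup>+y\<in>U. ennreal ((\<phi> x - \<phi> y)\<^sup>2) \<partial>lborel) \<partial>lborel)
      \<le> K * (\<integral>\<^sup>+x\<in>\<Omega>. ennreal ((norm (grad \<phi> x))\<^sup>2) \<partial>lborel)" (is "_ \<le> _ * ?A")
    if \<phi>: "C1_on UNIV \<phi>" for \<phi>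
  proof -
    note [measurable] = C1_on_UNIV_measurable[OF \<phi>]
    let ?g = "\<lambda>z. ennreal ((norm (grad \<phi> z))\<^sup>2)"
    let ?I = "\<lambda>x y. indicator U x * indicator U y :: ennreal"
    let ?p = "\<lambda>x. ennreal ((\<phi> x - \<phi> (x + t *\<^sub>R v))\<^sup>2)"
    let ?q = "\<lambda>x y. ennreal ((\<phi> (x + t *\<^sub>R v) - \<phi> (y + t *\<^sub>R v))\<^sup>2)"
    have p: "(\<integral>\<^sup>+x\<in>U. ?p x \<partial>lborel) \<le> L * ?A"
    proof -
      have "(\<integral>\<^sup>+x\<in>U. ?p x \<partial>lborel) \<le>
          (\<integral>\<^sup>+x. ennreal (t * (norm v)\<^sup>2) * ((\<integral>\<^sup>+s\<in>{0..t}. ?g (x + s *\<^sub>R v) \<partial>lborel) * indicator U x) \<partial>lborel)"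
        using square_increment_line_le[OF \<phi> \<open>0 \<le> t\<close>, of _ v]
        by (intro nn_integral_mono) (auto split: split_indicator simp: power2_commute)
      also have "\<dots> = ennreal (t * (norm v)\<^sup>2) * (\<integral>\<^sup>+x\<in>U. (\<integral>\<^sup>+s\<in>{0..t}. ?g (x + s *\<^sub>R v) \<partial>lborel) \<partial>lborel)"
        by (simp add: nn_integral_cmult)
      also have "(\<integral>\<^sup>+x\<in>U. (\<integral>\<^sup>+s\<in>{0..t}. ?g (x + s *\<^sub>R v) \<partial>lborel) \<partial>lborel) =
          (\<integral>\<^sup>+z\<in>\<Omega>. ?g z * emeasure lborel {s\<in>{0..t}. z - s *\<^sub>R v \<in> U} \<partial>lborel)"
        by (rule nn_integral_shift_segment) (use seg in auto)
      also have "\<dots> \<le> (\<integral>\<^sup>+z. ennreal t * (?g z * indicator \<Omega> z) \<partial>lborel)"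
      proof (rule nn_integral_mono)
        fix z
        have "emeasure lborel {s\<in>{0..t}. z - s *\<^sub>R v \<in> U} \<le> emeasure lborel {0..t}"
          by (rule emeasure_mono) auto
        then have "emeasure lborel {s\<in>{0..t}. z - s *\<^sub>R v \<in> U} \<le> ennreal t"
          using \<open>0 \<le> t\<close> by simp
        then show "?g z * emeasure lborel {s\<in>{0..t}. z - s *\<^sub>R v \<in> U} * indicator \<Omega> z
            \<le> ennreal t * (?g z * indicator \<Omega> z)"
          by (auto split: split_indicator simp: mult.commute[of "ennreal t"] intro: mult_left_mono)
      qed
      also have "\<dots> = ennreal t * ?A" by (simp add: nn_integral_cmult)
      finally show ?thesis by (simp add: L_def mult.assoc mult_left_mono)
    qed
    have q: "(\<integral>\<^sup>+x. (\<integral>\<^sup>+y. ?q x y * ?I x y \<partial>lborel) \<partial>lborel) \<le> C * ?A"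
    proof -
      let ?r = "\<lambda>x y. ennreal ((\<phi> x - \<phi> y)\<^sup>2) * indicator V y * indicator V x"
      have "(\<integral>\<^sup>+x. (\<integral>\<^sup>+y. ?q x y * ?I x y \<partial>lborel) \<partial>lborel) \<le>
          (\<integral>\<^sup>+x. (\<integral>\<^sup>+y. ?r (x + t *\<^sub>R v) (y + t *\<^sub>R v) \<partial>lborel) \<partial>lborel)"
        using UV by (intro nn_integral_mono) (auto split: split_indicator)
      also have "\<dots> = (\<integral>\<^sup>+x. (\<integral>\<^sup>+y. ?r (x + t *\<^sub>R v) y \<partial>lborel) \<partial>lborel)"
        by (subst nn_integral_lborel_translate[of "?r (_ + t *\<^sub>R v)" "t *\<^sub>R v"]) auto
      also have "\<dots> = (\<integral>\<^sup>+x. (\<integral>\<^sup>+y. ?r x y \<partial>lborel) \<partial>lborel)"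
        by (subst nn_integral_lborel_translate[of "\<lambda>x. \<integral>\<^sup>+y. ?r x y \<partial>lborel" "t *\<^sub>R v"]) auto
      also have "\<dots> \<le> C * ?A"
        using PC[OF \<phi>] by (simp add: nn_integral_multc)
      finally show ?thesis .
    qed
    have "(\<integral>\<^sup>+x\<in>U. (\<integral>\<^sup>+y\<in>U. ennreal ((\<phi> x - \<phi> y)\<^sup>2) \<partial>lborel) \<partial>lborel) =
        (\<integral>\<^sup>+x. (\<integral>\<^sup>+y. ennreal ((\<phi> x - \<phi> y)\<^sup>2) * ?I x y \<partial>lborel) \<partial>lborel)"
      by (subst nn_integral_multc[symmetric]) (auto simp: mult_ac)
    also have "\<dots> \<le> (\<integral>\<^sup>+x. (\<integral>\<^sup>+y. 3 * (?p x * indicator U x * indicator U y) + 3 * (?q x y * ?I x y) +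
        3 * (?p y * indicator U y * indicator U x) \<partial>lborel) \<partial>lborel)"
    proof (intro nn_integral_mono)
      fix x y
      show "ennreal ((\<phi> x - \<phi> y)\<^sup>2) * ?I x y \<le> 3 * (?p x * indicator U x * indicator U y) +
          3 * (?q x y * ?I x y) + 3 * (?p y * indicator U y * indicator U x)"
        using ennreal_square_diff3_le[of "\<phi> x" "\<phi> y" "\<phi> (x + t *\<^sub>R v)" "\<phi> (y + t *\<^sub>R v)"]
        by (auto split: split_indicator simp: power2_commute[of "\<phi> (y + t *\<^sub>R v)" "\<phi> y"])
    qed
    also have "\<dots> = 3 * ((\<integral>\<^sup>+x\<in>U. ?p x \<partial>lborel) * emeasure lborel U) +
        3 * (\<integral>\<^sup>+x. (\<integral>\<^sup>+y. ?q x y * ?I x y \<partial>lborel) \<partial>lborel) +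
        3 * ((\<integral>\<^sup>+x\<in>U. ?p x \<partial>lborel) * emeasure lborel U)"
      by (simp add: nn_integral_add nn_integral_cmult nn_integral_multc)
    also have "\<dots> \<le> 3 * ((L * ?A) * emeasure lborel U) + 3 * (C * ?A) + 3 * ((L * ?A) * emeasure lborel U)"
      by (intro add_mono mult_left_mono mult_right_mono p q) auto
    also have "\<dots> = K * ?A" unfolding K_def by (simp add: algebra_simps)
    finally show ?thesis .
  qed
  ultimately show ?thesis unfolding poincare_on_def by blast
qed

text \<open>A third point \<open>z\<close> in the overlap links \<open>x\<close> in \<open>U\<close>
  to \<open>y\<close> in \<open>V\<close>. Integrating over \<open>z\<close> as well multiplies the
  mixed term by the measure of the overlap, which is positive and finite because the overlap is a
  nonempty bounded open set.\<close>

lemma poincare_on_Un: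
  fixes U V \<Omega> :: "'a::euclidean_space set"
  assumes "open U" "bounded U" "open V" "bounded V" "U \<inter> V \<noteq> {}" "poincare_on \<Omega> U" "poincare_on \<Omega> V"
  shows "poincare_on \<Omega> (U \<union> V)"
proof -
  define W where "W = U \<inter> V"
  have [measurable]: "U \<in> sets borel" "V \<in> sets borel" "W \<in> sets borel"
    using assms by (auto simp: W_def)
  have "open W" "bounded W" using assms by (auto simp: W_def)
  have W0: "emeasure lborel W \<noteq> 0"
    using \<open>open W\<close> assms(5) open_not_negligible[of W]
    by (auto simp: W_def negligible_iff_emeasure0)
  have Wf: "emeasure lborel W < top" "emeasure lborel U < top" "emeasure lborel V < top"
    using emeasure_bounded_finite[OF \<open>bounded W\<close>] emeasure_bounded_finite[OF \<open>bounded U\<close>]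
      emeasure_bounded_finite[OF \<open>bounded V\<close>] by simp_all
  obtain B where B: "B < top" and PB: "\<And>\<phi>. C1_on UNIV \<phi> \<Longrightarrow>
    (\<integral>\<^sup>+x\<in>U. (\<integral>\<^sup>+y\<in>U. ennreal ((\<phi> x - \<phi> y)\<^sup>2) \<partial>lborel) \<partial>lborel)
      \<le> B * (\<integral>\<^sup>+x\<in>\<Omega>. ennreal ((norm (grad \<phi> x))\<^sup>2) \<partial>lborel)"
    using \<open>poincare_on \<Omega> U\<close> unfolding poincare_on_def by blast
  obtain C where C: "C < top" and PC: "\<And>\<phi>. C1_on UNIV \<phi> \<Longrightarrow>
    (\<integral>\<^sup>+x\<in>V. (\<integral>\<^sup>+y\<in>V. ennreal ((\<phi> x - \<phi> y)\<^sup>2) \<partial>lborel) \<partial>lborel)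
      \<le> C * (\<integral>\<^sup>+x\<in>\<Omega>. ennreal ((norm (grad \<phi> x))\<^sup>2) \<partial>lborel)"
    using \<open>poincare_on \<Omega> V\<close> unfolding poincare_on_def by blast
  \<comment> \<open>Constant for the mixed term: each of the two comparisons with \<open>z\<close>
    leaves one variable free, which contributes the measure of \<open>V\<close> or of
    \<open>U\<close>.\<close>
  define X where "X = inverse (emeasure lborel W) * (2 * (emeasure lborel V * B) + 2 * (emeasure lborel U * C))"
  have "inverse (emeasure lborel W) < top" using W0 by (simp add: less_top[symmetric])
  moreover have "2 * (emeasure lborel V * B) + 2 * (emeasure lborel U * C) < top"
    using Wf B C by (simp add: ennreal_mult_less_top)
  ultimately have "X < top" unfolding X_def by (simp only: ennreal_mult_less_top simp_thms)
  then have "B + C + X + X < top" using B C by simp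
  moreover have "(\<integral>\<^sup>+x\<in>U\<union>V. (\<integral>\<^sup>+y\<in>U\<union>V. ennreal ((\<phi> x - \<phi> y)\<^sup>2) \<partial>lborel) \<partial>lborel)
      \<le> (B + C + X + X) * (\<integral>\<^sup>+x\<in>\<Omega>. ennreal ((norm (grad \<phi> x))\<^sup>2) \<partial>lborel)" (is "_ \<le> _ * ?A")
    if \<phi>: "C1_on UNIV \<phi>" for \<phi>
  proof -
    note [measurable] = C1_on_UNIV_measurable[OF \<phi>]
    define q where "q x y = ennreal ((\<phi> x - \<phi> y)\<^sup>2)" for x y
    have [measurable (raw)]: "(\<lambda>x. q (f x) (g x)) \<in> borel_measurable M"
      if "f \<in> M \<rightarrow>\<^sub>M borel" "g \<in> M \<rightarrow>\<^sub>M borel" for f g and M :: "'z measure"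
      using that unfolding q_def by measurable
    define J where "J S T = (\<integral>\<^sup>+x. (\<integral>\<^sup>+y. q x y * (indicator S x * indicator T y) \<partial>lborel) \<partial>lborel)" for S T
    have J: "(\<integral>\<^sup>+x\<in>S. (\<integral>\<^sup>+y\<in>T. ennreal ((\<phi> x - \<phi> y)\<^sup>2) \<partial>lborel) \<partial>lborel) = J S T"
      if [measurable]: "S \<in> sets borel" "T \<in> sets borel" for S T
      unfolding J_def q_def by (subst nn_integral_multc[symmetric]) (auto simp: mult_ac)
    have UU: "J U U \<le> B * ?A" and VV: "J V V \<le> C * ?A"
      using PB[OF \<phi>] PC[OF \<phi>] by (simp_all add: J)
    have JVU: "J V U = J U V"
      unfolding J_def by (subst lborel_pair.Fubini') (auto simp: q_def power2_commute mult_ac)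
    have WI: "emeasure lborel W * J U V \<le> 2 * (emeasure lborel V * J U U) + 2 * (emeasure lborel U * J V V)"
    proof -
      have "emeasure lborel W * J U V = (\<integral>\<^sup>+x. (\<integral>\<^sup>+y. (\<integral>\<^sup>+z. q x y * (indicator U x * indicator V y) *
          indicator W z \<partial>lborel) \<partial>lborel) \<partial>lborel)"
        unfolding J_def by (simp add: nn_integral_cmult nn_integral_multc mult.commute)
      also have "\<dots> \<le> (\<integral>\<^sup>+x. (\<integral>\<^sup>+y. (\<integral>\<^sup>+z. 2 * (q x z * (indicator U x * indicator U z) * indicator V y) +
          2 * (q z y * (indicator V z * indicator V y) * indicator U x) \<partial>lborel) \<partial>lborel) \<partial>lborel)"
      proof (intro nn_integral_mono)
        fix x y z
        show "q x y * (indicator U x * indicator V y) * indicator W z \<le>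
          2 * (q x z * (indicator U x * indicator U z) * indicator V y) +
          2 * (q z y * (indicator V z * indicator V y) * indicator U x)"
          using ennreal_square_diff2_le[of "\<phi> x" "\<phi> y" "\<phi> z"]
          by (auto split: split_indicator simp: W_def q_def)
      qed
      also have "\<dots> = 2 * (\<integral>\<^sup>+x. (\<integral>\<^sup>+y. (\<integral>\<^sup>+z. q x z * (indicator U x * indicator U z) \<partial>lborel) * indicator V y \<partial>lborel) \<partial>lborel) +
          2 * (\<integral>\<^sup>+x. (\<integral>\<^sup>+y. (\<integral>\<^sup>+z. q z y * (indicator V z * indicator V y) \<partial>lborel) \<partial>lborel) * indicator U x \<partial>lborel)"
        by (simp add: nn_integral_add nn_integral_cmult nn_integral_multc)
      also have "(\<integral>\<^sup>+x. (\<integral>\<^sup>+y. (\<integral>\<^sup>+z. q z y * (indicator V z * indicator V y) \<partial>lborel) \<partial>lborel) * indicator U x \<partial>lborel)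
          = J V V * emeasure lborel U"
        unfolding J_def by (subst lborel_pair.Fubini') (simp_all add: nn_integral_cmult)
      also have "(\<integral>\<^sup>+x. (\<integral>\<^sup>+y. (\<integral>\<^sup>+z. q x z * (indicator U x * indicator U z) \<partial>lborel) * indicator V y \<partial>lborel) \<partial>lborel)
          = J U U * emeasure lborel V"
        unfolding J_def by (simp add: nn_integral_cmult nn_integral_multc)
      finally show ?thesis by (simp add: mult.commute)
    qed
    have UV: "J U V \<le> X * ?A"
    proof -
      have "J U V = inverse (emeasure lborel W) * (emeasure lborel W * J U V)"
        using W0 Wf ennreal_divide_self[of "emeasure lborel W"]
        by (simp add: mult.assoc[symmetric] divide_ennreal_def mult.commute[of "inverse _"])
      also have "\<dots> \<le> inverse (emeasure lborel W) *
          (2 * (emeasure lborel V * J U U) + 2 * (emeasure lborel U * J V V))"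
        by (intro mult_left_mono WI) simp
      also have "\<dots> \<le> inverse (emeasure lborel W) *
          (2 * (emeasure lborel V * (B * ?A)) + 2 * (emeasure lborel U * (C * ?A)))"
        by (intro mult_left_mono add_mono UU VV) auto
      finally show ?thesis by (simp add: X_def algebra_simps)
    qed
    have "J (U \<union> V) (U \<union> V) \<le> (\<integral>\<^sup>+x. (\<integral>\<^sup>+y. q x y * (indicator U x * indicator U y) +
        q x y * (indicator V x * indicator V y) + q x y * (indicator U x * indicator V y) +
        q x y * (indicator V x * indicator U y) \<partial>lborel) \<partial>lborel)"
      unfolding J_def by (intro nn_integral_mono) (auto split: split_indicator)
    also have "\<dots> = J U U + J V V + J U V + J V U"
      unfolding J_def by (simp add: nn_integral_add)
    also have "\<dots> \<le> B * ?A + C * ?A + X * ?A + X * ?A"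
      unfolding JVU by (intro add_mono UU VV UV)
    finally show ?thesis by (subst J) (simp_all only: distrib_right sets.Un \<open>U \<in> sets borel\<close> \<open>V \<in> sets borel\<close>)
  qed
  ultimately show ?thesis unfolding poincare_on_def by blast
qed

section \<open>Boundary charts and propagation of the Poincare inequality\<close>

lemma lipschitz_boundary_patch:
  fixes \<Omega> :: "'a::euclidean_space set"
  assumes lip: "lipschitz_boundary \<Omega>" and "open \<Omega>" and x0: "x0 \<in> frontier \<Omega>"
  obtains r M v u where "r > 0" "M \<ge> 1" "norm v = 1" "M-lipschitz_on UNIV u"
    "\<And>y t. u (y + t *\<^sub>R v) = u y + (t::real)"
    "\<And>y. y \<in> ball x0 r \<Longrightarrow> y \<in> \<Omega> \<longleftrightarrow> u y > 0"
    "\<And>y. y \<in> ball x0 r \<Longrightarrow> y \<in> frontier \<Omega> \<Longrightarrow> u y = 0"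
proof -
  obtain r e L \<gamma> where r: "r > 0" and e: "norm e = 1" and \<gamma>: "L-lipschitz_on {z. z \<bullet> e = 0} \<gamma>"
    and eq: "\<Omega> \<inter> ball x0 r = {y \<in> ball x0 r. y \<bullet> e < \<gamma> (y - (y \<bullet> e) *\<^sub>R e)}"
    using lip[unfolded lipschitz_boundary_def, rule_format, OF x0] by blast
  have ee: "e \<bullet> e = 1" using e by (simp add: dot_square_norm)
  define p where "p y = y - (y \<bullet> e) *\<^sub>R e" for y
  have p0: "p y \<bullet> e = 0" for y by (simp add: p_def inner_diff_left ee)
  have p_norm: "norm (p w) \<le> norm w" for w
  proof -
    have "(norm (p w))\<^sup>2 = (norm w)\<^sup>2 - (w \<bullet> e)\<^sup>2"
      unfolding power2_norm_eq_inner p_def inner_diff_left inner_diff_right inner_scaleR_left inner_scaleR_right ee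
        inner_commute[of e w]
      by (simp add: power2_eq_square)
    then have "(norm (p w))\<^sup>2 \<le> (norm w)\<^sup>2"
      using zero_le_power2[of "w \<bullet> e"] by linarith
    then show ?thesis by (rule power2_le_imp_le) simp
  qed
  \<comment> \<open>\<open>u\<close> is the vertical depth of \<open>y\<close> below the graph, and
    \<open>v = - e\<close> points into the domain. A single Lipschitz function that grows at unit
    speed along \<open>v\<close> and vanishes on the boundary near \<open>x0\<close> stands for the
    whole chart in what follows.\<close>
  define u where "u y = \<gamma> (p y) - y \<bullet> e" for y
  have L: "L \<ge> 0" using \<gamma> lipschitz_on_nonneg by blast
  have u_lip: "(L + 1)-lipschitz_on UNIV u"
  proof (rule lipschitz_onI)
    fix y z
    have pd: "p y - p z = p (y - z)" by (simp add: p_def inner_diff_left scaleR_diff_left)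
    have "dist (\<gamma> (p y)) (\<gamma> (p z)) \<le> L * dist (p y) (p z)"
      using \<gamma> p0 by (intro lipschitz_onD[of L "{z. z \<bullet> e = 0}"]) auto
    also have "\<dots> \<le> L * dist y z"
      using L p_norm[of "y - z"] pd by (intro mult_left_mono) (auto simp: dist_norm)
    finally have 1: "\<bar>\<gamma> (p y) - \<gamma> (p z)\<bar> \<le> L * dist y z" by (simp add: dist_real_def)
    have "\<bar>(y - z) \<bullet> e\<bar> \<le> dist y z"
      using Cauchy_Schwarz_ineq2[of "y - z" e] e by (simp add: dist_norm)
    then have 2: "\<bar>y \<bullet> e - z \<bullet> e\<bar> \<le> dist y z" by (simp add: inner_diff_left)
    show "dist (u y) (u z) \<le> (L + 1) * dist y z"
      using 1 2 unfolding u_def dist_real_def by (simp add: distrib_right)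
  qed (use L in simp)
  have u_shift: "u (y + t *\<^sub>R (- e)) = u y + t" for y t
  proof -
    have i: "(y + t *\<^sub>R (- e)) \<bullet> e = y \<bullet> e - t" by (simp add: inner_diff_left ee)
    have "p (y + t *\<^sub>R (- e)) = p y" unfolding p_def i by (simp add: scaleR_diff_left)
    then show ?thesis unfolding u_def i by (simp only:)
  qed
  have in\<Omega>: "y \<in> \<Omega> \<longleftrightarrow> u y > 0" if "y \<in> ball x0 r" for y
  proof -
    have "y \<in> \<Omega> \<inter> ball x0 r \<longleftrightarrow> y \<in> {y \<in> ball x0 r. y \<bullet> e < \<gamma> (y - (y \<bullet> e) *\<^sub>R e)}"
      by (simp only: eq)
    then show ?thesis using that by (simp add: u_def p_def)
  qed
  have u0: "u y = 0" if y: "y \<in> ball x0 r" "y \<in> frontier \<Omega>" for y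
  proof -
    have "y \<notin> \<Omega>" using y \<open>open \<Omega>\<close> by (simp add: frontier_def interior_open)
    then have "u y \<le> 0" using in\<Omega> y by force
    \<comment> \<open>A negative value would persist on a neighbourhood of \<open>y\<close> disjoint
      from \<open>\<Omega>\<close>, whereas \<open>y\<close> lies in the closure of
      \<open>\<Omega>\<close>.\<close>
    moreover have "\<not> u y < 0"
    proof
      assume "u y < 0"
      have "continuous_on UNIV u" using u_lip by (rule lipschitz_on_continuous_on)
      then have "open {z. u z < 0}" by (intro open_Collect_less) (auto intro: continuous_intros)
      then have "open (ball x0 r \<inter> {z. u z < 0})" by auto
      moreover have "(ball x0 r \<inter> {z. u z < 0}) \<inter> \<Omega> = {}" using in\<Omega> by force
      ultimately have "(ball x0 r \<inter> {z. u z < 0}) \<inter> closure \<Omega> = {}"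
        by (simp add: open_Int_closure_eq_empty)
      then show False using y \<open>u y < 0\<close> by (auto simp: frontier_def)
    qed
    ultimately show ?thesis by simp
  qed
  show ?thesis
  proof (rule that)
    show "1 \<le> L + 1" using L by simp
    show "norm (- e) = 1" using e by simp
  qed (fact r u_lip u_shift in\<Omega> u0)+
qed

text \<open>Near an interior point a ball does it. Near a boundary point the piece of
  \<open>\<Omega>\<close> is slid along \<open>v\<close> into a ball inside \<open>\<Omega>\<close>;
  the paths remain in \<open>\<Omega>\<close> because \<open>u\<close> grows along them.\<close>

lemma poincare_on_local:
  fixes \<Omega> :: "'a::euclidean_space set"
  assumes "open \<Omega>" "lipschitz_boundary \<Omega>" "x0 \<in> closure \<Omega>"
  shows "\<exists>\<rho>>0. poincare_on \<Omega> (\<Omega> \<inter> ball x0 \<rho>)"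
proof (cases "x0 \<in> \<Omega>")
  case True
  then obtain \<rho> where \<rho>: "\<rho> > 0" "ball x0 \<rho> \<subseteq> \<Omega>"
    using \<open>open \<Omega>\<close> open_contains_ball by blast
  then have "poincare_on \<Omega> (ball x0 \<rho>)"
    using \<open>open \<Omega>\<close> by (intro poincare_on_convex) auto
  then show ?thesis using \<rho> by (metis inf.absorb_iff2)
next
  case False
  then have x0: "x0 \<in> frontier \<Omega>"
    using assms by (simp add: frontier_def interior_open)
  obtain r M v u where r: "r > 0" and M: "M \<ge> 1" and v: "norm v = 1"
    and lip: "M-lipschitz_on UNIV u" and shift: "\<And>y t. u (y + t *\<^sub>R v) = u y + (t::real)"
    and in\<Omega>: "\<And>y. y \<in> ball x0 r \<Longrightarrow> y \<in> \<Omega> \<longleftrightarrow> u y > 0"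
    and u0: "\<And>y. y \<in> ball x0 r \<Longrightarrow> y \<in> frontier \<Omega> \<Longrightarrow> u y = 0"
    using lipschitz_boundary_patch[OF assms(2,1) x0] by blast
  \<comment> \<open>On the ball of radius \<open>\<rho>\<close> the modulus of \<open>u\<close>
    stays below \<open>M * \<rho> = r / 4\<close>, so the shift by \<open>t = r / 2\<close> makes
    \<open>u\<close> positive everywhere; and \<open>\<rho> + t < r\<close> keeps the paths inside
    the chart.\<close>
  define \<rho> where "\<rho> = r / (4 * M)"
  define t where "t = r / 2"
  have \<rho>: "\<rho> > 0" "M * \<rho> = r / 4" "\<rho> \<le> r / 4"
    using r M by (auto simp: \<rho>_def divide_simps)
  have near: "x + s *\<^sub>R v \<in> ball x0 r" if "x \<in> ball x0 \<rho>" "0 \<le> s" "s \<le> t" for x s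
  proof -
    have "dist x0 (x + s *\<^sub>R v) \<le> dist x0 x + s"
      using dist_triangle[of x0 "x + s *\<^sub>R v" x] v that by (simp add: dist_norm)
    then show ?thesis using that \<rho> r by (simp add: t_def)
  qed
  have "poincare_on \<Omega> (ball (x0 + t *\<^sub>R v) \<rho>)"
  proof (rule poincare_on_convex)
    show "ball (x0 + t *\<^sub>R v) \<rho> \<subseteq> \<Omega>"
    proof
      fix y assume "y \<in> ball (x0 + t *\<^sub>R v) \<rho>"
      then have w: "y - t *\<^sub>R v \<in> ball x0 \<rho>" by (simp add: dist_norm algebra_simps)
      have "dist (u (y - t *\<^sub>R v)) (u x0) \<le> M * dist (y - t *\<^sub>R v) x0"
        using lip by (rule lipschitz_onD) auto
      also have "\<dots> < M * \<rho>" using w M by (intro mult_strict_left_mono) (auto simp: dist_commute)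
      finally have "\<bar>u (y - t *\<^sub>R v)\<bar> < r / 4"
        using u0[of x0] x0 r \<rho> by (simp add: dist_real_def)
      moreover have "u y = u (y - t *\<^sub>R v) + t" using shift[of "y - t *\<^sub>R v" t] by simp
      ultimately have "u y > 0" using r by (simp add: t_def)
      moreover have "y \<in> ball x0 r"
        using near[OF w, of t] r by (simp add: t_def)
      ultimately show "y \<in> \<Omega>" using in\<Omega> by simp
    qed
  qed (use \<open>open \<Omega>\<close> in auto)
  then have "poincare_on \<Omega> (\<Omega> \<inter> ball x0 \<rho>)"
  proof (rule poincare_on_translate[where t = t and v = v, rotated 4])
    show "0 \<le> t" using r by (simp add: t_def)
    fix x assume x: "x \<in> \<Omega> \<inter> ball x0 \<rho>"
    then show "x + t *\<^sub>R v \<in> ball (x0 + t *\<^sub>R v) \<rho>" by simp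
    fix s assume s: "0 \<le> s" "s \<le> t"
    have "x \<in> ball x0 r" using x \<rho> r by simp
    then have "u x > 0" using in\<Omega> x by simp
    then show "x + s *\<^sub>R v \<in> \<Omega>" using near[of x s] x s in\<Omega> shift by simp
  qed (use \<open>open \<Omega>\<close> in auto)
  then show ?thesis using \<rho> by blast
qed

text \<open>Among the unions of patches of a finite cover for which the inequality holds, a maximal
  one is taken. A remaining patch that met it could be glued to it, so the maximal union and the
  union of the remaining patches are disjoint open sets, and connectedness leaves nothing
  outside.\<close>

lemma poincare_on_lipschitz_domain:
  fixes \<Omega> :: "'a::euclidean_space set"
  assumes "open \<Omega>" "connected \<Omega>" "bounded \<Omega>" "\<Omega> \<noteq> {}" "lipschitz_boundary \<Omega>"
  shows "poincare_on \<Omega> \<Omega>"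
proof -
  have "\<forall>x\<in>closure \<Omega>. \<exists>\<rho>. \<rho> > 0 \<and> poincare_on \<Omega> (\<Omega> \<inter> ball x \<rho>)"
    using poincare_on_local[OF assms(1,5)] by simp
  from bchoice[OF this] obtain \<rho>
    where \<rho>: "\<And>x. x \<in> closure \<Omega> \<Longrightarrow> \<rho> x > 0 \<and> poincare_on \<Omega> (\<Omega> \<inter> ball x (\<rho> x))"
    by blast
  define U where "U x = \<Omega> \<inter> ball x (\<rho> x)" for x
  have oU: "open (U x)" "bounded (U x)" for x using assms by (auto simp: U_def)
  have "compact (closure \<Omega>)" using \<open>bounded \<Omega>\<close> by simp
  moreover have "closure \<Omega> \<subseteq> (\<Union>x\<in>closure \<Omega>. ball x (\<rho> x))" using \<rho> by force
  ultimately obtain D where D: "D \<subseteq> closure \<Omega>" "finite D" "closure \<Omega> \<subseteq> (\<Union>x\<in>D. ball x (\<rho> x))"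
    by (rule compactE_image[OF _ open_ball])
  then have cover: "\<Omega> \<subseteq> (\<Union>x\<in>D. U x)" using closure_subset[of \<Omega>] by (force simp: U_def)
  have Une: "U x \<noteq> {}" if "x \<in> D" for x
  proof -
    have "x \<in> closure \<Omega>" "\<rho> x > 0" using that D \<rho> by auto
    then obtain y where "y \<in> \<Omega>" "dist y x < \<rho> x" using closure_approachable by blast
    then show ?thesis by (auto simp: U_def dist_commute)
  qed
  \<comment> \<open>Nonempty subfamilies only, so that the maximal union meets
    \<open>\<Omega>\<close>, as the connectedness argument requires.\<close>
  define \<J> where "\<J> = {J. J \<subseteq> D \<and> J \<noteq> {} \<and> poincare_on \<Omega> (\<Union>x\<in>J. U x)}"
  have "finite \<J>" unfolding \<J>_def using \<open>finite D\<close> by simp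
  moreover obtain x1 where "x1 \<in> D" using cover \<open>\<Omega> \<noteq> {}\<close> by blast
  then have "{x1} \<in> \<J>" unfolding \<J>_def using \<rho> D by (auto simp: U_def)
  ultimately obtain J where J: "J \<in> \<J>" and max: "\<And>K. K \<in> \<J> \<Longrightarrow> J \<subseteq> K \<Longrightarrow> K = J"
    using finite_has_maximal[of \<J>] by (metis empty_iff)
  define A where "A = (\<Union>x\<in>J. U x)"
  define B where "B = (\<Union>x\<in>D - J. U x)"
  have JD: "J \<subseteq> D" "J \<noteq> {}" "poincare_on \<Omega> A" using J by (auto simp: \<J>_def A_def)
  have "bounded A" "A \<subseteq> \<Omega>" using \<open>bounded \<Omega>\<close> bounded_subset[of \<Omega> A] by (auto simp: A_def U_def)
  have "open A" "open B" using oU by (auto simp: A_def B_def)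
  have "A \<inter> B = {}"
  proof (rule ccontr)
    assume "A \<inter> B \<noteq> {}"
    then obtain x where x: "x \<in> D - J" "A \<inter> U x \<noteq> {}" by (auto simp: B_def)
    have "poincare_on \<Omega> (U x)" using \<rho> D x by (auto simp: U_def)
    then have "poincare_on \<Omega> (A \<union> U x)"
      using x JD oU \<open>open A\<close> \<open>bounded A\<close> by (intro poincare_on_Un) auto
    moreover have "A \<union> U x = (\<Union>x\<in>insert x J. U x)" by (auto simp: A_def)
    ultimately have "insert x J \<in> \<J>" using JD x by (simp add: \<J>_def)
    then show False using max[of "insert x J"] x by blast
  qed
  moreover have "\<Omega> \<subseteq> A \<union> B" using cover by (auto simp: A_def B_def)
  moreover have "A \<inter> \<Omega> \<noteq> {}" using JD Une \<open>A \<subseteq> \<Omega>\<close> by (force simp: A_def)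
  ultimately have "B \<inter> \<Omega> = {}"
    using connectedD[OF \<open>connected \<Omega>\<close> \<open>open A\<close> \<open>open B\<close>] by blast
  then have "A = \<Omega>" using \<open>\<Omega> \<subseteq> A \<union> B\<close> \<open>A \<subseteq> \<Omega>\<close> by blast
  then show ?thesis using JD by simp
qed

subsection \<open>Covering estimates for the Hausdorff measure and the boundary strip\<close>

lemma hausdorff_pre_antimono:
  assumes "\<delta> \<le> \<delta>'"
  shows "hausdorff_pre m \<delta>' E \<le> hausdorff_pre m \<delta> E"
  unfolding hausdorff_pre_def using assms by (intro INF_superset_mono) (auto intro: order_trans)

text \<open>The supremum is a limit because a smaller \<open>\<delta>\<close> admits fewer
  coverings. In the form of a limit, a finite sum of outer measures can be bounded by estimating all
  its terms at one common scale.\<close>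

lemma hausdorff_pre_tendsto_outer:
  "((\<lambda>\<delta>. hausdorff_pre m \<delta> E) \<longlongrightarrow> hausdorff_outer m E) (at_right 0)"
proof (rule order_tendstoI)
  fix a assume "a < hausdorff_outer m E"
  then obtain \<delta> where \<delta>: "\<delta> > 0" "a < hausdorff_pre m \<delta> E"
    unfolding hausdorff_outer_def by (auto simp: less_SUP_iff)
  then have "eventually (\<lambda>\<eta>. \<eta> < \<delta>) (at_right 0)"
    by (intro eventually_at_right_less order_tendstoD) (auto intro: tendsto_ident_at)
  then show "eventually (\<lambda>\<eta>. a < hausdorff_pre m \<eta> E) (at_right 0)"
    by eventually_elim (use \<delta>(2) hausdorff_pre_antimono in \<open>meson less_imp_le order_less_le_trans\<close>)
next
  fix a assume a: "hausdorff_outer m E < a"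
  show "eventually (\<lambda>\<eta>. hausdorff_pre m \<eta> E < a) (at_right 0)"
    using eventually_at_right_less[of 0]
  proof eventually_elim
    case (elim \<eta>)
    then have "hausdorff_pre m \<eta> E \<le> hausdorff_outer m E"
      unfolding hausdorff_outer_def by (intro SUP_upper) auto
    with a show ?case by simp
  qed
qed

lemma emeasure_hausdorff_measure_le:
  "emeasure (hausdorff_measure m) E \<le> hausdorff_outer m E"
  unfolding hausdorff_measure_def by (simp add: emeasure_measure_of_conv)

lemma hausdorff_measure_sets [simp, measurable_cong]: "sets (hausdorff_measure m) = sets borel"
  unfolding hausdorff_measure_def
  using sets.sigma_sets_eq[of borel] by (simp add: sets_measure_of_conv)

text \<open>A \<open>2 * h\<close>-separated subset of \<open>E\<close> of largest size does two
  things: by maximality the balls of radius \<open>2 * h\<close> about its points cover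
  \<open>E\<close>, and by separation the translated balls of radius \<open>h\<close> are disjoint
  inside \<open>T\<close>, so the volume of \<open>T\<close> bounds their number.\<close>

lemma hausdorff_pre_le_packing:
  fixes E T :: "'a::euclidean_space set"
  assumes h: "h > 0" and [measurable]: "T \<in> sets borel"
    and T: "\<And>x. x \<in> E \<Longrightarrow> ball (x + w) h \<subseteq> T"
  shows "hausdorff_pre m (4 * h) E \<le>
    ennreal (unit_ball_vol (real m) * (2 * h) ^ m / (unit_ball_vol (real DIM('a)) * h ^ DIM('a))) *
      emeasure lborel T"
proof (cases "emeasure lborel T = top")
  case True
  define c where "c = unit_ball_vol (real m) * (2 * h) ^ m / (unit_ball_vol (real DIM('a)) * h ^ DIM('a))"
  have "c > 0" using h by (simp add: c_def)
  then have "ennreal c * emeasure lborel T = top" using True by (simp add: ennreal_mult_top)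
  then show ?thesis by (simp add: c_def)
next
  case False
  define \<kappa> where "\<kappa> = unit_ball_vol (real DIM('a)) * h ^ DIM('a)"
  have \<kappa>: "\<kappa> > 0" using h by (simp add: \<kappa>_def)
  define sep where "sep X \<longleftrightarrow> X \<subseteq> E \<and> finite X \<and> (\<forall>x\<in>X. \<forall>y\<in>X. x \<noteq> y \<longrightarrow> 2 * h \<le> dist x y)" for X
  have vol: "ennreal (real (card X) * \<kappa>) \<le> emeasure lborel T" if X: "sep X" for X
  proof -
    have disj: "disjoint_family_on (\<lambda>x. ball (x + w) h) X"
      unfolding disjoint_family_on_def
    proof (intro ballI impI)
      fix x y assume "x \<in> X" "y \<in> X" "x \<noteq> y"
      then have "2 * h \<le> dist (x + w) (y + w)" using X by (auto simp: sep_def)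
      then show "ball (x + w) h \<inter> ball (y + w) h = {}"
        by (intro disjoint_ballI) simp
    qed
    have "ennreal (real (card X) * \<kappa>) = (\<Sum>x\<in>X. emeasure lborel (ball (x + w) h))"
      using h \<kappa> by (simp add: emeasure_ball \<kappa>_def[symmetric] ennreal_mult ennreal_of_nat_eq_real_of_nat)
    also have "\<dots> = emeasure lborel (\<Union>x\<in>X. ball (x + w) h)"
      using disj X by (intro sum_emeasure) (auto simp: sep_def)
    also have "\<dots> \<le> emeasure lborel T"
      using T X by (intro emeasure_mono) (auto simp: sep_def)
    finally show ?thesis .
  qed
  obtain \<mu> where \<mu>: "emeasure lborel T = ennreal \<mu>" "\<mu> \<ge> 0"
    using False by (metis ennreal_cases)
  \<comment> \<open>This uniform bound on the cardinalities, obtained from the finite volume of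
    \<open>T\<close>, guarantees that a largest separated set exists.\<close>
  have "card X < nat \<lceil>\<mu> / \<kappa>\<rceil> + 1" if "sep X" for X
  proof -
    have "real (card X) \<le> \<mu> / \<kappa>" using vol[OF that] \<mu> \<kappa> by (simp add: field_simps)
    then show ?thesis by linarith
  qed
  moreover have "sep {}" by (simp add: sep_def)
  ultimately obtain X where X: "sep X" and max: "\<And>Y. sep Y \<Longrightarrow> card Y \<le> card X"
    using Lattices_Big.ex_has_greatest_nat[of sep "{}" card] by blast
  have cover: "E \<subseteq> (\<Union>x\<in>X. ball x (2 * h))"
  proof
    fix y assume "y \<in> E"
    show "y \<in> (\<Union>x\<in>X. ball x (2 * h))"
    proof (rule ccontr)
      assume y: "y \<notin> (\<Union>x\<in>X. ball x (2 * h))"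
      then have "sep (insert y X)"
        using X \<open>y \<in> E\<close> unfolding sep_def by (auto simp: not_less dist_commute)
      moreover have "y \<notin> X" using y h by auto
      ultimately show False using max[of "insert y X"] X by (simp add: sep_def)
    qed
  qed
  have "finite X" using X by (simp add: sep_def)
  then obtain f where f: "bij_betw f {0..<card X} X" using ex_bij_betw_nat_finite by blast
  \<comment> \<open>Coverings are infinite sequences; the finite one is padded with empty sets,
    whose size is 0 even for \<open>m = 0\<close>.\<close>
  define C where "C i = (if i < card X then ball (f i) (2 * h) else {})" for i
  have "E \<subseteq> (\<Union>i. C i)"
  proof
    fix y assume "y \<in> E"
    then obtain x where x: "x \<in> X" "y \<in> ball x (2 * h)" using cover by blast
    then have "x \<in> f ` {0..<card X}" using f by (simp add: bij_betw_def)
    then obtain i where "i < card X" "f i = x" by auto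
    then show "y \<in> (\<Union>i. C i)" using x by (auto simp: C_def intro!: exI[of _ i])
  qed
  moreover have "bounded (C i) \<and> diameter (C i) \<le> 4 * h" for i
    using h by (auto simp: C_def diameter_ball diameter_empty)
  ultimately have "hausdorff_pre m (4 * h) E \<le> (\<Sum>i. hausdorff_size m (C i))"
    unfolding hausdorff_pre_def by (intro INF_lower) auto
  also have "\<dots> = (\<Sum>i<card X. hausdorff_size m (C i))"
    by (intro suminf_finite) (auto simp: C_def hausdorff_size_def)
  also have "\<dots> = (\<Sum>i<card X. ennreal (unit_ball_vol (real m) * (2 * h) ^ m))"
    using h by (intro sum.cong) (auto simp: C_def hausdorff_size_def diameter_ball)
  also have "\<dots> = ennreal (real (card X)) * ennreal (unit_ball_vol (real m) * (2 * h) ^ m)"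
    by (simp add: ennreal_of_nat_eq_real_of_nat)
  also have "\<dots> = ennreal (unit_ball_vol (real m) * (2 * h) ^ m / \<kappa>) * ennreal (real (card X) * \<kappa>)"
    using h \<kappa> by (simp flip: ennreal_mult)
  also have "\<dots> \<le> ennreal (unit_ball_vol (real m) * (2 * h) ^ m / \<kappa>) * emeasure lborel T"
    by (intro mult_left_mono vol X) simp
  finally show ?thesis by (simp add: \<kappa>_def)
qed

section \<open>Integration along segments that enter the domain\<close>

lemma square_le_nn_integral_segment:
  fixes \<phi> :: "'a::euclidean_space \<Rightarrow> real"
  assumes \<phi>: "C1_on UNIV \<phi>" and \<tau>: "\<tau> > 0" and v: "norm v = 1"
  shows "ennreal ((\<phi> x)\<^sup>2) \<le>
    (\<integral>\<^sup>+s\<in>{0..\<tau>}. ennreal (2 / \<tau> * (\<phi> (x + s *\<^sub>R v))\<^sup>2 + 2 * \<tau> * (norm (grad \<phi> (x + s *\<^sub>R v)))\<^sup>2) \<partial>lborel)"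
proof -
  note [measurable] = C1_on_UNIV_measurable[OF \<phi>]
  define q where "q s = ennreal ((\<phi> (x + s *\<^sub>R v))\<^sup>2) * indicator {0..\<tau>} s" for s
  define g where "g s = ennreal ((norm (grad \<phi> (x + s *\<^sub>R v)))\<^sup>2) * indicator {0..\<tau>} s" for s
  have [measurable]: "q \<in> borel_measurable borel" "g \<in> borel_measurable borel"
    unfolding q_def g_def by measurable
  define I where "I = (\<integral>\<^sup>+s. g s \<partial>lborel)"
  \<comment> \<open>The value at \<open>x\<close> is compared with the value at every
    \<open>x + t *\<^sub>R v\<close>, the difference being controlled by the gradient along the
    segment. Averaging over \<open>t\<close> in \<open>{0..\<tau>}\<close> then produces the factors
    \<open>2 / \<tau>\<close> and \<open>2 * \<tau>\<close>.\<close>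
  have pt: "ennreal ((\<phi> x)\<^sup>2) * indicator {0..\<tau>} t \<le> 2 * q t + ennreal (2 * \<tau>) * I * indicator {0..\<tau>} t" for t
  proof (cases "t \<in> {0..\<tau>}")
    case True
    have "ennreal ((\<phi> x - \<phi> (x + t *\<^sub>R v))\<^sup>2) \<le> ennreal \<tau> * I"
    proof -
      have "ennreal ((\<phi> (x + t *\<^sub>R v) - \<phi> x)\<^sup>2) \<le>
          ennreal (t * (norm v)\<^sup>2) * (\<integral>\<^sup>+s\<in>{0..t}. ennreal ((norm (grad \<phi> (x + s *\<^sub>R v)))\<^sup>2) \<partial>lborel)"
        using True by (intro square_increment_line_le[OF \<phi>]) auto
      also have "\<dots> \<le> ennreal \<tau> * I"
        unfolding I_def g_def using True v
        by (intro mult_mono nn_integral_mono ennreal_leI) (auto split: split_indicator)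
      finally show ?thesis by (simp add: power2_commute)
    qed
    then have "2 * ennreal ((\<phi> x - \<phi> (x + t *\<^sub>R v))\<^sup>2) \<le> 2 * (ennreal \<tau> * I)"
      by (rule mult_left_mono) simp
    moreover have "2 * (ennreal \<tau> * I) = ennreal (2 * \<tau>) * I"
      using \<tau> by (simp add: ennreal_mult mult.assoc)
    ultimately have "2 * ennreal ((\<phi> x - \<phi> (x + t *\<^sub>R v))\<^sup>2) + 2 * ennreal ((\<phi> (x + t *\<^sub>R v) - 0)\<^sup>2) \<le>
        2 * q t + ennreal (2 * \<tau>) * I"
      using True by (simp add: q_def add.commute add_mono)
    then show ?thesis
      using True ennreal_square_diff2_le[of "\<phi> x" 0 "\<phi> (x + t *\<^sub>R v)"] by (simp add: order_trans)
  qed (simp add: q_def)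
  have "ennreal \<tau> * ennreal ((\<phi> x)\<^sup>2) = (\<integral>\<^sup>+t. ennreal ((\<phi> x)\<^sup>2) * indicator {0..\<tau>} t \<partial>lborel)"
    using \<tau> by (subst nn_integral_cmult_indicator) (auto simp: mult.commute)
  also have "\<dots> \<le> (\<integral>\<^sup>+t. 2 * q t + ennreal (2 * \<tau>) * I * indicator {0..\<tau>} t \<partial>lborel)"
    by (intro nn_integral_mono pt)
  also have "\<dots> = 2 * (\<integral>\<^sup>+t. q t \<partial>lborel) + ennreal (2 * \<tau>) * I * ennreal \<tau>"
    using \<tau> by (simp add: nn_integral_add nn_integral_cmult nn_integral_cmult_indicator)
  finally have "ennreal (1 / \<tau>) * (ennreal \<tau> * ennreal ((\<phi> x)\<^sup>2)) \<le>
      ennreal (1 / \<tau>) * (2 * (\<integral>\<^sup>+t. q t \<partial>lborel) + ennreal (2 * \<tau>) * I * ennreal \<tau>)"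
    by (rule mult_left_mono) simp
  also have "ennreal (1 / \<tau>) * (ennreal \<tau> * ennreal ((\<phi> x)\<^sup>2)) = ennreal ((\<phi> x)\<^sup>2)"
    using \<tau> by (simp flip: ennreal_mult mult.assoc)
  also have "ennreal (1 / \<tau>) * (2 * (\<integral>\<^sup>+t. q t \<partial>lborel) + ennreal (2 * \<tau>) * I * ennreal \<tau>) =
      ennreal (2 / \<tau>) * (\<integral>\<^sup>+t. q t \<partial>lborel) + ennreal (2 * \<tau>) * I"
  proof -
    have 1: "ennreal (1 / \<tau>) * 2 = ennreal (2 / \<tau>)"
      using \<tau> ennreal_mult[of "1 / \<tau>" 2] by simp
    have 2: "ennreal (1 / \<tau>) * ennreal \<tau> = 1"
      using \<tau> by (simp flip: ennreal_mult)
    have "ennreal (1 / \<tau>) * (2 * (\<integral>\<^sup>+t. q t \<partial>lborel) + ennreal (2 * \<tau>) * I * ennreal \<tau>) =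
      (ennreal (1 / \<tau>) * 2) * (\<integral>\<^sup>+t. q t \<partial>lborel) + (ennreal (1 / \<tau>) * ennreal \<tau>) * (ennreal (2 * \<tau>) * I)"
      by (simp only: distrib_left mult_ac)
    then show ?thesis by (simp only: 1 2 mult_1)
  qed
  also have "\<dots> = (\<integral>\<^sup>+t. ennreal (2 / \<tau>) * q t + ennreal (2 * \<tau>) * g t \<partial>lborel)"
    unfolding I_def by (simp add: nn_integral_add nn_integral_cmult)
  also have "\<dots> = (\<integral>\<^sup>+s\<in>{0..\<tau>}. ennreal (2 / \<tau> * (\<phi> (x + s *\<^sub>R v))\<^sup>2 + 2 * \<tau> * (norm (grad \<phi> (x + s *\<^sub>R v)))\<^sup>2) \<partial>lborel)"
  proof (rule nn_integral_cong)
    fix s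
    have *: "ennreal (2 / \<tau> * a + 2 * \<tau> * b) = ennreal (2 / \<tau>) * ennreal a + ennreal (2 * \<tau>) * ennreal b"
      if "a \<ge> 0" "b \<ge> 0" for a b
    proof -
      have "ennreal (2 / \<tau> * a + 2 * \<tau> * b) = ennreal (2 / \<tau> * a) + ennreal (2 * \<tau> * b)"
        using \<tau> that by (intro ennreal_plus) auto
      also have "\<dots> = ennreal (2 / \<tau>) * ennreal a + ennreal (2 * \<tau>) * ennreal b"
        using \<tau> that by (intro arg_cong2[where f = "(+)"] ennreal_mult) auto
      finally show ?thesis .
    qed
    show "ennreal (2 / \<tau>) * q s + ennreal (2 * \<tau>) * g s =
        ennreal (2 / \<tau> * (\<phi> (x + s *\<^sub>R v))\<^sup>2 + 2 * \<tau> * (norm (grad \<phi> (x + s *\<^sub>R v)))\<^sup>2) * indicator {0..\<tau>} s"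
      unfolding q_def g_def *[OF zero_le_power2 zero_le_power2] by (simp only: distrib_right mult.assoc)
  qed
  finally show ?thesis .
qed

text \<open>When a segment of length \<open>\<tau>\<close> starts at every point of
  \<open>S\<close>, a fixed \<open>z\<close> is reached only for parameters in a set of length at
  most \<open>w\<close>. Hence a thin \<open>S\<close> yields an integral proportional to its width,
  with a factor that does not depend on \<open>S\<close>.\<close>

lemma nn_integral_strip_le:
  fixes \<phi> :: "'a::euclidean_space \<Rightarrow> real"
  assumes \<phi>: "C1_on UNIV \<phi>" and \<tau>: "\<tau> > 0" and v: "norm v = 1"
    and S[measurable]: "S \<in> sets borel" and \<Omega>[measurable]: "\<Omega> \<in> sets borel"
    and seg: "\<And>x s. x \<in> S \<Longrightarrow> 0 \<le> s \<Longrightarrow> s \<le> \<tau> \<Longrightarrow> x + s *\<^sub>R v \<in> \<Omega>"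
    and width: "\<And>z. emeasure lborel {s \<in> {0..\<tau>}. z - s *\<^sub>R v \<in> S} \<le> w"
  shows "(\<integral>\<^sup>+x\<in>S. ennreal ((\<phi> x)\<^sup>2) \<partial>lborel) \<le>
    w * (\<integral>\<^sup>+x\<in>\<Omega>. ennreal (2 / \<tau> * (\<phi> x)\<^sup>2 + 2 * \<tau> * (norm (grad \<phi> x))\<^sup>2) \<partial>lborel)"
proof -
  note [measurable] = C1_on_UNIV_measurable[OF \<phi>]
  define G where "G z = ennreal (2 / \<tau> * (\<phi> z)\<^sup>2 + 2 * \<tau> * (norm (grad \<phi> z))\<^sup>2)" for z
  have [measurable]: "G \<in> borel_measurable borel" unfolding G_def by measurable
  have "(\<integral>\<^sup>+x\<in>S. ennreal ((\<phi> x)\<^sup>2) \<partial>lborel) \<le> (\<integral>\<^sup>+x\<in>S. (\<integral>\<^sup>+s\<in>{0..\<tau>}. G (x + s *\<^sub>R v) \<partial>lborel) \<partial>lborel)"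
    using square_le_nn_integral_segment[OF \<phi> \<tau> v] unfolding G_def
    by (intro nn_integral_mono mult_right_mono) auto
  also have "\<dots> = (\<integral>\<^sup>+z\<in>\<Omega>. G z * emeasure lborel {s \<in> {0..\<tau>}. z - s *\<^sub>R v \<in> S} \<partial>lborel)"
    by (rule nn_integral_shift_segment) (use seg in auto)
  also have "\<dots> \<le> (\<integral>\<^sup>+z. w * (G z * indicator \<Omega> z) \<partial>lborel)"
    using width by (intro nn_integral_mono) (auto split: split_indicator simp: mult.commute[of w] intro: mult_left_mono)
  also have "\<dots> = w * (\<integral>\<^sup>+z\<in>\<Omega>. G z \<partial>lborel)" by (simp add: nn_integral_cmult)
  finally show ?thesis by (simp add: G_def)
qed

text \<open>The levels \<open>j * \<epsilon>\<close> not exceeding \<open>y\<close>, counted from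
  \<open>j = 0\<close>, number \<open>\<lfloor>y / \<epsilon>\<rfloor> + 1\<close>. The level at 0
  makes the sum reach \<open>y\<close> from above, at the price of an error of at most
  \<open>\<epsilon>\<close>; cutting at \<open>N\<close> can only lower the sum.\<close>

lemma level_count_bounds:
  fixes y \<epsilon> :: real
  assumes "\<epsilon> > 0" "0 \<le> y"
  shows "(\<Sum>j\<le>N. \<epsilon> * of_bool (real j * \<epsilon> \<le> y)) \<le> y + \<epsilon>"
    and "y \<le> real N * \<epsilon> \<Longrightarrow> y \<le> (\<Sum>j\<le>N. \<epsilon> * of_bool (real j * \<epsilon> \<le> y))"
proof -
  define K where "K = nat \<lfloor>y / \<epsilon>\<rfloor>"
  have K: "real j * \<epsilon> \<le> y \<longleftrightarrow> j \<le> K" for j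
    using assms unfolding K_def by (simp add: pos_le_divide_eq[symmetric] le_nat_iff le_floor_iff)
  have "(\<Sum>j\<le>N. \<epsilon> * of_bool (real j * \<epsilon> \<le> y)) = (\<Sum>j\<le>N. if j \<in> {..K} then \<epsilon> else 0)"
    by (intro sum.cong) (auto simp: K)
  also have "\<dots> = (\<Sum>j\<in>{..N} \<inter> {..K}. \<epsilon>)"
    by (simp only: sum.inter_restrict finite_atMost)
  also have "{..N} \<inter> {..K} = {..min N K}" by auto
  finally have *: "(\<Sum>j\<le>N. \<epsilon> * of_bool (real j * \<epsilon> \<le> y)) = (1 + real (min N K)) * \<epsilon>" by simp
  have "real (min N K) * \<epsilon> \<le> real K * \<epsilon>" using assms by simp
  also have "\<dots> \<le> y" using K[of K] by simp
  finally show "(\<Sum>j\<le>N. \<epsilon> * of_bool (real j * \<epsilon> \<le> y)) \<le> y + \<epsilon>"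
    unfolding * by (simp add: distrib_right)
  assume y: "y \<le> real N * \<epsilon>"
  show "y \<le> (\<Sum>j\<le>N. \<epsilon> * of_bool (real j * \<epsilon> \<le> y))"
  proof (cases "N \<le> K")
    case True
    then show ?thesis unfolding * using y assms by (simp add: distrib_right)
  next
    case False
    have "\<not> real (Suc K) * \<epsilon> \<le> y" using K[of "Suc K"] by simp
    then show ?thesis unfolding * using False by (simp add: min_def)
  qed
qed

subsection \<open>The trace inequality\<close>

text \<open>A layer-cake sum reduces the integral to measures of level sets. The hypothesis bounds
  the whole sum at one scale \<open>\<delta>\<close>, because there the packing estimates of all
  levels add up to a single Lebesgue integral; letting \<open>\<delta>\<close> tend to 0 gives the
  outer measures.\<close>

lemma nn_integral_hausdorff_le_levels:
  fixes f :: "'a::euclidean_space \<Rightarrow> real"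
  assumes [measurable]: "f \<in> borel_measurable borel" "A \<in> sets borel"
    and \<epsilon>: "\<epsilon> > 0" and f: "\<And>x. 0 \<le> f x" "\<And>x. x \<in> A \<Longrightarrow> f x \<le> real N * \<epsilon>"
    and R: "eventually (\<lambda>\<delta>. (\<Sum>j\<le>N. ennreal \<epsilon> * hausdorff_pre m \<delta> {x \<in> A. real j * \<epsilon> \<le> f x}) \<le> R) (at_right 0)"
  shows "(\<integral>\<^sup>+x\<in>A. ennreal (f x) \<partial>hausdorff_measure m) \<le> R"
proof -
  let ?H = "hausdorff_measure m :: 'a measure"
  define K where "K j = {x \<in> A. real j * \<epsilon> \<le> f x}" for j
  have K[measurable]: "K j \<in> sets borel" for j
    unfolding K_def by measurable
  have "(\<integral>\<^sup>+x\<in>A. ennreal (f x) \<partial>?H) \<le> (\<integral>\<^sup>+x. (\<Sum>j\<le>N. ennreal \<epsilon> * indicator (K j) x) \<partial>?H)"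
  proof (intro nn_integral_mono)
    fix x
    show "ennreal (f x) * indicator A x \<le> (\<Sum>j\<le>N. ennreal \<epsilon> * indicator (K j) x)"
    proof (cases "x \<in> A")
      case True
      have "ennreal (f x) \<le> ennreal (\<Sum>j\<le>N. \<epsilon> * of_bool (real j * \<epsilon> \<le> f x))"
        using True f \<epsilon> by (intro ennreal_leI level_count_bounds(2)) auto
      also have "\<dots> = (\<Sum>j\<le>N. ennreal (\<epsilon> * of_bool (real j * \<epsilon> \<le> f x)))"
        using \<epsilon> by (intro sum_ennreal[symmetric]) simp
      also have "\<dots> = (\<Sum>j\<le>N. ennreal \<epsilon> * indicator (K j) x)"
        using True by (intro sum.cong) (auto simp: K_def)
      finally show ?thesis using True by simp
    qed simp
  qed
  also have "\<dots> = (\<Sum>j\<le>N. ennreal \<epsilon> * emeasure ?H (K j))"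
    by (subst nn_integral_sum) (auto simp: nn_integral_cmult_indicator)
  also have "\<dots> \<le> (\<Sum>j\<le>N. ennreal \<epsilon> * hausdorff_outer m (K j))"
    by (intro sum_mono mult_left_mono emeasure_hausdorff_measure_le) simp
  also have "\<dots> \<le> R"
  proof (rule tendsto_upperbound)
    show "((\<lambda>\<delta>. \<Sum>j\<le>N. ennreal \<epsilon> * hausdorff_pre m \<delta> (K j)) \<longlongrightarrow>
        (\<Sum>j\<le>N. ennreal \<epsilon> * hausdorff_outer m (K j))) (at_right 0)"
      by (intro tendsto_sum ennreal_tendsto_cmult hausdorff_pre_tendsto_outer) simp
    show "eventually (\<lambda>\<delta>. (\<Sum>j\<le>N. ennreal \<epsilon> * hausdorff_pre m \<delta> (K j)) \<le> R) (at_right 0)"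
      using R unfolding K_def .
  qed simp
  finally show ?thesis .
qed

text \<open>The level sets of \<open>f\<close> are covered at scale \<open>h\<close> by few balls, because the balls moved by
  \<open>w\<close> into the strip \<open>S\<close> are disjoint; \<open>f\<close> hardly varies at that scale.\<close>

lemma hausdorff_pre_levels_le:
  fixes f :: "'a::euclidean_space \<Rightarrow> real"
  assumes [measurable]: "f \<in> borel_measurable borel" "S \<in> sets borel"
    and \<epsilon>: "\<epsilon> > 0" and h: "h > 0" and f: "\<And>x. 0 \<le> f x"
    and S: "\<And>x. x \<in> A \<Longrightarrow> ball (x + w) h \<subseteq> S"
    and osc: "\<And>x y. x \<in> A \<Longrightarrow> y \<in> ball (x + w) h \<Longrightarrow> \<bar>f x - f y\<bar> \<le> \<epsilon>"
  shows "(\<Sum>j\<le>N. ennreal \<epsilon> * hausdorff_pre (DIM('a) - 1) (4 * h) {x \<in> A. real j * \<epsilon> \<le> f x}) \<le>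
    ennreal (unit_ball_vol (real (DIM('a) - 1)) * 2 ^ (DIM('a) - 1) / unit_ball_vol (real DIM('a)) / h) *
      (\<integral>\<^sup>+x\<in>S. ennreal (f x + 2 * \<epsilon>) \<partial>lborel)"
proof -
  let ?m = "DIM('a) - 1"
  \<comment> \<open>The packing estimate contains \<open>h ^ (DIM('a) - 1)\<close> over
    \<open>h ^ DIM('a)\<close>; the remaining \<open>1 / h\<close> will cancel against the width of
    the strip.\<close>
  define c where "c = unit_ball_vol (real ?m) * 2 ^ ?m / unit_ball_vol (real DIM('a)) / h"
  \<comment> \<open>The threshold is lowered by \<open>\<epsilon>\<close> because \<open>f\<close>
    may drop by that much between \<open>x\<close> and its moved ball. Together with the error of
    the level count this makes up the \<open>2 * \<epsilon>\<close>.\<close>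
  define T where "T j = {y \<in> S. real j * \<epsilon> \<le> f y + \<epsilon>}" for j
  have T[measurable]: "T j \<in> sets borel" for j unfolding T_def by measurable
  have c: "unit_ball_vol (real ?m) * (2 * h) ^ ?m / (unit_ball_vol (real DIM('a)) * h ^ DIM('a)) = c"
  proof -
    have "h ^ DIM('a) = h * h ^ ?m"
      using DIM_positive[where 'a = 'a] by (metis Suc_diff_1 power_Suc)
    then show ?thesis using h by (simp add: c_def power_mult_distrib)
  qed
  have pre: "hausdorff_pre ?m (4 * h) {x \<in> A. real j * \<epsilon> \<le> f x} \<le> ennreal c * emeasure lborel (T j)" for j
  proof -
    have "ball (x + w) h \<subseteq> T j" if "x \<in> {x \<in> A. real j * \<epsilon> \<le> f x}" for x
    proof
      fix y assume y: "y \<in> ball (x + w) h"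
      then have "\<bar>f x - f y\<bar> \<le> \<epsilon>" using that osc by simp
      then have "f x \<le> f y + \<epsilon>" by linarith
      moreover have "y \<in> S" using S y that by blast
      ultimately show "y \<in> T j" using that by (simp add: T_def)
    qed
    from hausdorff_pre_le_packing[where m = ?m and E = "{x \<in> A. real j * \<epsilon> \<le> f x}", OF h T this] show ?thesis unfolding c by simp
  qed
  have "(\<Sum>j\<le>N. ennreal \<epsilon> * hausdorff_pre ?m (4 * h) {x \<in> A. real j * \<epsilon> \<le> f x}) \<le>
      (\<Sum>j\<le>N. ennreal \<epsilon> * (ennreal c * emeasure lborel (T j)))"
    by (intro sum_mono mult_left_mono pre) simp
  also have "\<dots> = ennreal c * (\<Sum>j\<le>N. ennreal \<epsilon> * emeasure lborel (T j))"
    by (simp add: sum_distrib_left mult_ac)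
  also have "(\<Sum>j\<le>N. ennreal \<epsilon> * emeasure lborel (T j)) =
      (\<integral>\<^sup>+x. (\<Sum>j\<le>N. ennreal \<epsilon> * indicator (T j) x) \<partial>lborel)"
    by (subst nn_integral_sum) (auto simp: nn_integral_cmult_indicator)
  also have "ennreal c * \<dots> \<le> ennreal c * (\<integral>\<^sup>+x\<in>S. ennreal (f x + 2 * \<epsilon>) \<partial>lborel)"
  proof (intro mult_left_mono nn_integral_mono)
    fix x
    show "(\<Sum>j\<le>N. ennreal \<epsilon> * indicator (T j) x) \<le> ennreal (f x + 2 * \<epsilon>) * indicator S x"
    proof (cases "x \<in> S")
      case True
      have "(\<Sum>j\<le>N. ennreal \<epsilon> * indicator (T j) x) =
          (\<Sum>j\<le>N. ennreal (\<epsilon> * of_bool (real j * \<epsilon> \<le> f x + \<epsilon>)))"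
        using True by (intro sum.cong) (auto simp: T_def)
      also have "\<dots> = ennreal (\<Sum>j\<le>N. \<epsilon> * of_bool (real j * \<epsilon> \<le> f x + \<epsilon>))"
        using \<epsilon> by (intro sum_ennreal) simp
      also have "\<dots> \<le> ennreal ((f x + \<epsilon>) + \<epsilon>)"
        using f[of x] \<epsilon> by (intro ennreal_leI level_count_bounds(1)) auto
      also have "(f x + \<epsilon>) + \<epsilon> = f x + 2 * \<epsilon>" by simp
      finally show ?thesis using True by simp
    qed (simp add: T_def)
  qed simp
  finally show ?thesis by (simp add: c_def)
qed

lemma trace_inequality_local:
  fixes \<Omega> :: "'a::euclidean_space set"
  assumes "open \<Omega>" "bounded \<Omega>" "lipschitz_boundary \<Omega>" and x0: "x0 \<in> frontier \<Omega>"
  shows "\<exists>\<rho>>0. \<exists>C<top. \<forall>\<phi>. C1_on UNIV \<phi> \<longrightarrow>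
    (\<integral>\<^sup>+x\<in>frontier \<Omega> \<inter> ball x0 \<rho>. ennreal ((\<phi> x)\<^sup>2) \<partial>hausdorff_measure (DIM('a) - 1)) \<le>
      C * (\<integral>\<^sup>+x\<in>\<Omega>. ennreal ((\<phi> x)\<^sup>2 + (norm (grad \<phi> x))\<^sup>2) \<partial>lborel)"
proof -
  obtain r M v u where r: "r > 0" and M: "M \<ge> 1" and v: "norm v = 1"
    and lip: "M-lipschitz_on UNIV u" and shift: "\<And>y t. u (y + t *\<^sub>R v) = u y + (t::real)"
    and in\<Omega>: "\<And>y. y \<in> ball x0 r \<Longrightarrow> y \<in> \<Omega> \<longleftrightarrow> u y > 0"
    and u0: "\<And>y. y \<in> ball x0 r \<Longrightarrow> y \<in> frontier \<Omega> \<Longrightarrow> u y = 0"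
    using lipschitz_boundary_patch[OF assms(3,1) x0] by blast
  have [measurable]: "\<Omega> \<in> sets borel" using \<open>open \<Omega>\<close> by simp
  have cu: "continuous_on UNIV u" using lip by (rule lipschitz_on_continuous_on)
  then have [measurable]: "u \<in> borel_measurable borel" by (rule borel_measurable_continuous_onI)
  \<comment> \<open>Three nested radii: boundary points within \<open>r / 4\<close>, the strip
    within \<open>r / 2\<close>, and segments of length \<open>r / 4\<close> from the strip, which
    stay within \<open>r\<close>, where the chart is valid.\<close>
  define \<tau> where "\<tau> = r / 4"
  have \<tau>: "\<tau> > 0" using r by (simp add: \<tau>_def)
  define A where "A = frontier \<Omega> \<inter> ball x0 \<tau>"
  have [measurable]: "A \<in> sets borel" unfolding A_def by (intro sets.Int) auto
  define c where "c = unit_ball_vol (real (DIM('a) - 1)) * 2 ^ (DIM('a) - 1) / unit_ball_vol (real DIM('a))"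
  have c: "c \<ge> 0" by (simp add: c_def)
  define k where "k = 3 * M * c"
  have k: "k \<ge> 0" using c M by (simp add: k_def)
  \<comment> \<open>A boundary point moved by \<open>(2 * M * h) *\<^sub>R v\<close> has
    \<open>u = 2 * M * h\<close>, and on the ball of radius \<open>h\<close> about it
    \<open>u\<close> varies by less than \<open>M * h\<close>; so these balls lie where
    \<open>0 < u \<le> 3 * M * h\<close>.\<close>
  define S where "S h = {y \<in> ball x0 (r/2). 0 < u y \<and> u y \<le> 3 * M * h}" for h
  have S[measurable]: "S h \<in> sets borel" for h unfolding S_def by measurable
  define G where "G \<phi> x = ennreal (2 / \<tau> * (\<phi> x)\<^sup>2 + 2 * \<tau> * (norm (grad \<phi> x))\<^sup>2)" for \<phi> :: "'a \<Rightarrow> real" and x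
  have strip: "(\<integral>\<^sup>+x\<in>S h. ennreal ((\<phi> x)\<^sup>2) \<partial>lborel) \<le> ennreal (3 * M * h) * (\<integral>\<^sup>+x\<in>\<Omega>. G \<phi> x \<partial>lborel)"
    if "C1_on UNIV \<phi>" "h > 0" for \<phi> h
    unfolding G_def
  proof (rule nn_integral_strip_le[OF that(1) \<tau> v S])
    fix x s assume "x \<in> S h" "0 \<le> s" "s \<le> \<tau>"
    moreover have "dist x0 (x + s *\<^sub>R v) \<le> dist x0 x + s"
      using dist_triangle[of x0 "x + s *\<^sub>R v" x] v \<open>0 \<le> s\<close> by (simp add: dist_norm)
    ultimately have "x + s *\<^sub>R v \<in> ball x0 r" "u (x + s *\<^sub>R v) > 0"
      using r by (auto simp: S_def \<tau>_def shift)
    then show "x + s *\<^sub>R v \<in> \<Omega>" using in\<Omega> by blast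
  next
    fix z
    \<comment> \<open>Along \<open>v\<close> the function \<open>u\<close> changes at unit speed, so
      a line in this direction spends a time of at most \<open>3 * M * h\<close> in the
      strip.\<close>
    have "u (z - s *\<^sub>R v) = u z - s" for s
      using shift[of "z - s *\<^sub>R v" s] by simp
    then have "{s \<in> {0..\<tau>}. z - s *\<^sub>R v \<in> S h} \<subseteq> {u z - 3 * M * h..u z}"
      by (auto simp: S_def)
    then have "emeasure lborel {s \<in> {0..\<tau>}. z - s *\<^sub>R v \<in> S h} \<le> emeasure lborel {u z - 3 * M * h..u z}"
      by (rule emeasure_mono) simp
    then show "emeasure lborel {s \<in> {0..\<tau>}. z - s *\<^sub>R v \<in> S h} \<le> ennreal (3 * M * h)"
      using M \<open>h > 0\<close> by simp
  qed simp
  \<comment> \<open>The error \<open>2 * \<epsilon>\<close> is integrated over the strip, whose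
    measure is bounded by the strip estimate for the constant function 1. This is the last
    summand.\<close>
  have main: "(\<integral>\<^sup>+x\<in>A. ennreal ((\<phi> x)\<^sup>2) \<partial>hausdorff_measure (DIM('a) - 1)) \<le>
      ennreal k * (\<integral>\<^sup>+x\<in>\<Omega>. G \<phi> x \<partial>lborel) + ennreal k * (ennreal (2 * \<epsilon>) * (\<integral>\<^sup>+x\<in>\<Omega>. G (\<lambda>x. 1) x \<partial>lborel))"
    if \<phi>: "C1_on UNIV \<phi>" and \<epsilon>: "\<epsilon> > 0" for \<phi> and \<epsilon> :: real
  proof -
    note [measurable] = C1_on_UNIV_measurable[OF \<phi>]
    define f where "f x = (\<phi> x)\<^sup>2" for x
    have [measurable]: "f \<in> borel_measurable borel" unfolding f_def by measurable
    have f0: "0 \<le> f x" for x by (simp add: f_def)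
    have cf: "continuous_on UNIV f"
      unfolding f_def using C1_on_UNIV_continuous[OF \<phi>] by (intro continuous_intros)
    obtain B where B: "\<And>x. x \<in> cball x0 r \<Longrightarrow> f x \<le> B"
    proof -
      have "bounded (f ` cball x0 r)"
        using cf by (intro compact_imp_bounded compact_continuous_image) (auto intro: continuous_on_subset)
      then show ?thesis using that unfolding bounded_real by (metis abs_le_D1 imageI)
    qed
    obtain N where N: "B \<le> real N * \<epsilon>"
      using reals_Archimedean3[OF \<epsilon>] by (metis less_imp_le)
    have "uniformly_continuous_on (cball x0 r) f"
      using cf by (intro compact_uniformly_continuous) (auto intro: continuous_on_subset)
    then obtain \<delta> where \<delta>: "\<delta> > 0"
      "\<And>x y. x \<in> cball x0 r \<Longrightarrow> y \<in> cball x0 r \<Longrightarrow> dist y x < \<delta> \<Longrightarrow> dist (f y) (f x) < \<epsilon>"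
      unfolding uniformly_continuous_on_def using \<epsilon> by metis
    \<comment> \<open>\<open>3 * M * h\<close> bounds the distance from a boundary point to the
      points of its moved ball. Below \<open>\<tau>\<close> it keeps the ball within
      \<open>r / 2\<close>, below \<open>\<delta>\<close> it keeps the variation of \<open>f\<close>
      below \<open>\<epsilon>\<close>.\<close>
    define h0 where "h0 = min \<tau> \<delta> / (3 * M)"
    have "h0 > 0" using \<tau> \<delta> M by (simp add: h0_def)
    show ?thesis
      unfolding f_def[symmetric]
    proof (rule nn_integral_hausdorff_le_levels[where \<epsilon> = \<epsilon> and N = N])
      show "f x \<le> real N * \<epsilon>" if "x \<in> A" for x
      proof -
        have "x \<in> cball x0 r" using that r by (simp add: A_def \<tau>_def)
        then show ?thesis using B N by fastforce
      qed
      have "(\<Sum>j\<le>N. ennreal \<epsilon> * hausdorff_pre (DIM('a) - 1) \<eta> {x \<in> A. real j * \<epsilon> \<le> f x}) \<le>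
          ennreal k * (\<integral>\<^sup>+x\<in>\<Omega>. G \<phi> x \<partial>lborel) + ennreal k * (ennreal (2 * \<epsilon>) * (\<integral>\<^sup>+x\<in>\<Omega>. G (\<lambda>x. 1) x \<partial>lborel))"
        if \<eta>: "0 < \<eta>" "\<eta> < 4 * h0" for \<eta>
      proof -
        define h where "h = \<eta> / 4"
        have h: "h > 0" "h < h0" "\<eta> = 4 * h" using \<eta> by (auto simp: h_def)
        then have Mh: "3 * M * h < \<tau>" "3 * M * h < \<delta>"
          using M by (auto simp: h0_def field_simps)
        have near: "dist x y < 3 * M * h" if "y \<in> ball (x + (2 * M * h) *\<^sub>R v) h" for x y
        proof -
          have "dist x y \<le> dist x (x + (2 * M * h) *\<^sub>R v) + dist (x + (2 * M * h) *\<^sub>R v) y"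
            by (rule dist_triangle)
          also have "dist x (x + (2 * M * h) *\<^sub>R v) = 2 * M * h" using v M h by (simp add: dist_norm)
          also have "2 * M * h + dist (x + (2 * M * h) *\<^sub>R v) y < 2 * M * h + h" using that by simp
          also have "\<dots> \<le> 3 * M * h" using M h by simp
          finally show ?thesis .
        qed
        have "(\<Sum>j\<le>N. ennreal \<epsilon> * hausdorff_pre (DIM('a) - 1) (4 * h) {x \<in> A. real j * \<epsilon> \<le> f x}) \<le>
            ennreal (c / h) * (\<integral>\<^sup>+x\<in>S h. ennreal (f x + 2 * \<epsilon>) \<partial>lborel)"
          unfolding c_def
        proof (rule hausdorff_pre_levels_le[where w = "(2 * M * h) *\<^sub>R v"])
          fix x assume x: "x \<in> A"
          show "ball (x + (2 * M * h) *\<^sub>R v) h \<subseteq> S h"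
          proof
            fix y assume y: "y \<in> ball (x + (2 * M * h) *\<^sub>R v) h"
            have "dist x0 y \<le> dist x0 x + dist x y" by (rule dist_triangle)
            then have "dist x0 y < r / 2" using x near[OF y] Mh by (simp add: A_def \<tau>_def)
            have "dist (u y) (u (x + (2 * M * h) *\<^sub>R v)) \<le> M * dist y (x + (2 * M * h) *\<^sub>R v)"
              using lip by (rule lipschitz_onD) auto
            also have "\<dots> < M * h" using y M by (intro mult_strict_left_mono) (auto simp: dist_commute)
            finally have "\<bar>u y - 2 * M * h\<bar> < M * h"
              using u0[of x] x r by (simp add: dist_real_def shift A_def \<tau>_def)
            then have "0 < u y" "u y \<le> 3 * M * h"
              using mult_pos_pos[of M h] M h by linarith+
            then show "y \<in> S h" using \<open>dist x0 y < r / 2\<close> by (simp add: S_def)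
          qed
          fix y assume y: "y \<in> ball (x + (2 * M * h) *\<^sub>R v) h"
          have "dist x0 y \<le> dist x0 x + dist x y" by (rule dist_triangle)
          then have "y \<in> cball x0 r" using x near[OF y] Mh r by (simp add: A_def \<tau>_def)
          moreover have "x \<in> cball x0 r" using x r by (simp add: A_def \<tau>_def)
          moreover have "dist x y < \<delta>" using near[OF y] Mh by simp
          ultimately show "\<bar>f x - f y\<bar> \<le> \<epsilon>" using \<delta>(2)[of y x] by (simp add: dist_real_def)
        qed (use \<epsilon> h f0 in auto)
        also have "(\<integral>\<^sup>+x\<in>S h. ennreal (f x + 2 * \<epsilon>) \<partial>lborel) =
            (\<integral>\<^sup>+x. ennreal (f x) * indicator (S h) x + ennreal (2 * \<epsilon>) * (ennreal (1\<^sup>2) * indicator (S h) x) \<partial>lborel)"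
          using f0 \<epsilon> by (intro nn_integral_cong) (auto split: split_indicator)
        also have "\<dots> = (\<integral>\<^sup>+x\<in>S h. ennreal ((\<phi> x)\<^sup>2) \<partial>lborel) + ennreal (2 * \<epsilon>) * (\<integral>\<^sup>+x\<in>S h. ennreal (1\<^sup>2) \<partial>lborel)"
          by (simp add: nn_integral_add nn_integral_cmult f_def)
        also have "ennreal (c / h) * \<dots> \<le> ennreal (c / h) * (ennreal (3 * M * h) * (\<integral>\<^sup>+x\<in>\<Omega>. G \<phi> x \<partial>lborel) +
            ennreal (2 * \<epsilon>) * (ennreal (3 * M * h) * (\<integral>\<^sup>+x\<in>\<Omega>. G (\<lambda>x. 1) x \<partial>lborel)))"
          by (intro mult_left_mono add_mono strip \<phi> C1_on_UNIV_const h) auto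
        also have "\<dots> = (ennreal (c / h) * ennreal (3 * M * h)) * (\<integral>\<^sup>+x\<in>\<Omega>. G \<phi> x \<partial>lborel) +
            (ennreal (c / h) * ennreal (3 * M * h)) * (ennreal (2 * \<epsilon>) * (\<integral>\<^sup>+x\<in>\<Omega>. G (\<lambda>x. 1) x \<partial>lborel))"
          by (simp only: distrib_left mult_ac)
        also have "ennreal (c / h) * ennreal (3 * M * h) = ennreal k"
          using h c M by (simp add: k_def flip: ennreal_mult)
        finally show ?thesis unfolding h(3) .
      qed
      then show "eventually (\<lambda>\<eta>. (\<Sum>j\<le>N. ennreal \<epsilon> * hausdorff_pre (DIM('a) - 1) \<eta> {x \<in> A. real j * \<epsilon> \<le> f x}) \<le>
          ennreal k * (\<integral>\<^sup>+x\<in>\<Omega>. G \<phi> x \<partial>lborel) + ennreal k * (ennreal (2 * \<epsilon>) * (\<integral>\<^sup>+x\<in>\<Omega>. G (\<lambda>x. 1) x \<partial>lborel))) (at_right 0)"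
        unfolding eventually_at_right_field using \<open>h0 > 0\<close> by (intro exI[of _ "4 * h0"]) auto
    qed (use f0 \<epsilon> in auto)
  qed
  define g1 where "g1 = enn2real (\<integral>\<^sup>+x\<in>\<Omega>. G (\<lambda>x. 1) x \<partial>lborel)"
  have "(\<integral>\<^sup>+x\<in>\<Omega>. G (\<lambda>x. 1) x \<partial>lborel) = ennreal (2 / \<tau>) * emeasure lborel \<Omega>"
    unfolding G_def using \<tau> by (simp add: grad_const nn_integral_cmult_indicator)
  also have "\<dots> < top"
    using emeasure_bounded_finite[OF \<open>bounded \<Omega>\<close>] by (simp add: ennreal_mult_less_top)
  finally have g1: "(\<integral>\<^sup>+x\<in>\<Omega>. G (\<lambda>x. 1) x \<partial>lborel) = ennreal g1" "g1 \<ge> 0"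
    by (simp_all add: g1_def)
  have "(\<integral>\<^sup>+x\<in>A. ennreal ((\<phi> x)\<^sup>2) \<partial>hausdorff_measure (DIM('a) - 1)) \<le>
      ennreal (k * (2 / \<tau> + 2 * \<tau>)) * (\<integral>\<^sup>+x\<in>\<Omega>. ennreal ((\<phi> x)\<^sup>2 + (norm (grad \<phi> x))\<^sup>2) \<partial>lborel)" (is "?L \<le> _ * ?I")
    if \<phi>: "C1_on UNIV \<phi>" for \<phi>
  proof -
    note [measurable] = C1_on_UNIV_measurable[OF \<phi>]
    have "?L \<le> ennreal k * (\<integral>\<^sup>+x\<in>\<Omega>. G \<phi> x \<partial>lborel)"
    proof (rule ennreal_le_epsilon)
      fix e :: real assume "0 < e"
      \<comment> \<open>Since \<open>k\<close> and \<open>g1\<close> are independent of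
        \<open>\<epsilon>\<close>, this choice makes the error term at most \<open>e\<close>; the
        summand 1 keeps the divisor positive when \<open>k * g1 = 0\<close>.\<close>
      define d where "d = k * g1 + 1"
      define \<epsilon> where "\<epsilon> = e / (2 * d)"
      have d: "d > 0" using k g1 by (simp add: d_def add_nonneg_pos)
      then have \<epsilon>: "\<epsilon> > 0" using \<open>0 < e\<close> by (simp add: \<epsilon>_def)
      have "k * (2 * \<epsilon> * g1) = 2 * \<epsilon> * (k * g1)" by simp
      also have "\<dots> \<le> 2 * \<epsilon> * d" using \<epsilon> by (intro mult_left_mono) (auto simp: d_def)
      also have "\<dots> = e" using d by (simp add: \<epsilon>_def)
      finally have "ennreal k * (ennreal (2 * \<epsilon>) * ennreal g1) \<le> ennreal e"
        using k \<epsilon> g1(2) by (simp add: ennreal_leI flip: ennreal_mult)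
      then have "ennreal k * (\<integral>\<^sup>+x\<in>\<Omega>. G \<phi> x \<partial>lborel) + ennreal k * (ennreal (2 * \<epsilon>) * ennreal g1) \<le>
          ennreal k * (\<integral>\<^sup>+x\<in>\<Omega>. G \<phi> x \<partial>lborel) + ennreal e"
        by (rule add_left_mono)
      then show "?L \<le> ennreal k * (\<integral>\<^sup>+x\<in>\<Omega>. G \<phi> x \<partial>lborel) + ennreal e"
        using main[OF \<phi> \<epsilon>] unfolding g1(1) by (rule order_trans[rotated])
    qed
    also have "(\<integral>\<^sup>+x\<in>\<Omega>. G \<phi> x \<partial>lborel) \<le>
        (\<integral>\<^sup>+x. ennreal (2 / \<tau> + 2 * \<tau>) * (ennreal ((\<phi> x)\<^sup>2 + (norm (grad \<phi> x))\<^sup>2) * indicator \<Omega> x) \<partial>lborel)"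
    proof (intro nn_integral_mono)
      fix x
      have "2 / \<tau> * (\<phi> x)\<^sup>2 + 2 * \<tau> * (norm (grad \<phi> x))\<^sup>2 \<le>
          (2 / \<tau> + 2 * \<tau>) * ((\<phi> x)\<^sup>2 + (norm (grad \<phi> x))\<^sup>2)"
      proof -
        have "0 \<le> 2 / \<tau> * (norm (grad \<phi> x))\<^sup>2" "0 \<le> 2 * \<tau> * (\<phi> x)\<^sup>2" using \<tau> by simp_all
        then show ?thesis by (simp only: distrib_left distrib_right)
      qed
      then have "G \<phi> x \<le> ennreal ((2 / \<tau> + 2 * \<tau>) * ((\<phi> x)\<^sup>2 + (norm (grad \<phi> x))\<^sup>2))"
        unfolding G_def by (rule ennreal_leI)
      also have "\<dots> = ennreal (2 / \<tau> + 2 * \<tau>) * ennreal ((\<phi> x)\<^sup>2 + (norm (grad \<phi> x))\<^sup>2)"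
        using \<tau> by (intro ennreal_mult) auto
      finally show "G \<phi> x * indicator \<Omega> x \<le>
          ennreal (2 / \<tau> + 2 * \<tau>) * (ennreal ((\<phi> x)\<^sup>2 + (norm (grad \<phi> x))\<^sup>2) * indicator \<Omega> x)"
        by (auto split: split_indicator)
    qed
    also have "\<dots> = ennreal (2 / \<tau> + 2 * \<tau>) * ?I" by (simp add: nn_integral_cmult)
    also have "ennreal k * \<dots> = ennreal (k * (2 / \<tau> + 2 * \<tau>)) * ?I"
      using k \<tau> by (subst ennreal_mult) (auto simp: mult.assoc)
    finally show ?thesis by (simp add: mult_left_mono)
  qed
  then show ?thesis using \<tau> unfolding A_def by (meson ennreal_less_top)
qed

lemma trace_inequality:
  fixes \<Omega> :: "'a::euclidean_space set"
  assumes "open \<Omega>" "bounded \<Omega>" "lipschitz_boundary \<Omega>"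
  shows "\<exists>C<top. \<forall>\<phi>. C1_on UNIV \<phi> \<longrightarrow>
    (\<integral>\<^sup>+x. ennreal ((\<phi> x)\<^sup>2) \<partial>boundary_measure \<Omega>) \<le>
      C * (\<integral>\<^sup>+x\<in>\<Omega>. ennreal ((\<phi> x)\<^sup>2 + (norm (grad \<phi> x))\<^sup>2) \<partial>lborel)"
proof -
  let ?H = "hausdorff_measure (DIM('a) - 1) :: 'a measure"
  define P where "P x \<rho> C \<longleftrightarrow> \<rho> > 0 \<and> C < top \<and> (\<forall>\<phi>. C1_on UNIV \<phi> \<longrightarrow>
    (\<integral>\<^sup>+y\<in>frontier \<Omega> \<inter> ball x \<rho>. ennreal ((\<phi> y)\<^sup>2) \<partial>?H) \<le>
      C * (\<integral>\<^sup>+y\<in>\<Omega>. ennreal ((\<phi> y)\<^sup>2 + (norm (grad \<phi> y))\<^sup>2) \<partial>lborel))" for x \<rho> C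
  have "\<forall>x\<in>frontier \<Omega>. \<exists>p. P x (fst p) (snd p)"
    using trace_inequality_local[OF assms] unfolding P_def by fastforce
  from bchoice[OF this] obtain p where p: "\<And>x. x \<in> frontier \<Omega> \<Longrightarrow> P x (fst (p x)) (snd (p x))"
    by blast
  define \<rho> where "\<rho> x = fst (p x)" for x
  define C where "C x = snd (p x)" for x
  have "compact (frontier \<Omega>)" using \<open>bounded \<Omega>\<close> by (rule compact_frontier_bounded)
  moreover have "frontier \<Omega> \<subseteq> (\<Union>x\<in>frontier \<Omega>. ball x (\<rho> x))"
    using p by (force simp: P_def \<rho>_def)
  ultimately obtain D where D: "D \<subseteq> frontier \<Omega>" "finite D" "frontier \<Omega> \<subseteq> (\<Union>x\<in>D. ball x (\<rho> x))"
    by (rule compactE_image[OF _ open_ball])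
  have "(\<Sum>x\<in>D. C x) < top"
    using D p by (auto simp: P_def C_def)
  moreover have "(\<integral>\<^sup>+x. ennreal ((\<phi> x)\<^sup>2) \<partial>boundary_measure \<Omega>) \<le>
      (\<Sum>x\<in>D. C x) * (\<integral>\<^sup>+x\<in>\<Omega>. ennreal ((\<phi> x)\<^sup>2 + (norm (grad \<phi> x))\<^sup>2) \<partial>lborel)" (is "_ \<le> _ * ?I")
    if \<phi>: "C1_on UNIV \<phi>" for \<phi>
  proof -
    note [measurable] = C1_on_UNIV_measurable[OF \<phi>]
    have [measurable]: "frontier \<Omega> \<inter> ball x (\<rho> x) \<in> sets borel" for x by (intro sets.Int) auto
    have "(\<integral>\<^sup>+x. ennreal ((\<phi> x)\<^sup>2) \<partial>boundary_measure \<Omega>) = (\<integral>\<^sup>+x\<in>frontier \<Omega>. ennreal ((\<phi> x)\<^sup>2) \<partial>?H)"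
      unfolding boundary_measure_def by (rule nn_integral_restrict_space) simp
    also have "\<dots> \<le> (\<integral>\<^sup>+y. (\<Sum>x\<in>D. ennreal ((\<phi> y)\<^sup>2) * indicator (frontier \<Omega> \<inter> ball x (\<rho> x)) y) \<partial>?H)"
    proof (intro nn_integral_mono)
      fix y
      show "ennreal ((\<phi> y)\<^sup>2) * indicator (frontier \<Omega>) y \<le>
          (\<Sum>x\<in>D. ennreal ((\<phi> y)\<^sup>2) * indicator (frontier \<Omega> \<inter> ball x (\<rho> x)) y)"
      proof (cases "y \<in> frontier \<Omega>")
        case True
        then obtain x where x: "x \<in> D" "y \<in> ball x (\<rho> x)" using D by blast
        then have "ennreal ((\<phi> y)\<^sup>2) * indicator (frontier \<Omega>) y \<le>
            ennreal ((\<phi> y)\<^sup>2) * indicator (frontier \<Omega> \<inter> ball x (\<rho> x)) y" using True by simp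
        also have "\<dots> \<le> (\<Sum>x\<in>D. ennreal ((\<phi> y)\<^sup>2) * indicator (frontier \<Omega> \<inter> ball x (\<rho> x)) y)"
          using x D by (intro member_le_sum) auto
        finally show ?thesis .
      qed simp
    qed
    also have "\<dots> = (\<Sum>x\<in>D. \<integral>\<^sup>+y\<in>frontier \<Omega> \<inter> ball x (\<rho> x). ennreal ((\<phi> y)\<^sup>2) \<partial>?H)"
      by (rule nn_integral_sum) simp
    also have "\<dots> \<le> (\<Sum>x\<in>D. C x * ?I)"
      using p D \<phi> by (intro sum_mono) (auto simp: P_def C_def \<rho>_def)
    finally show ?thesis by (simp add: sum_distrib_right)
  qed
  ultimately show ?thesis by blast
qed

subsection \<open>Weak gradients of constants\<close>

text \<open>\<open>ennreal\<close> truncates at 0, so \<open>ennreal (g x)\<close> and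
  \<open>ennreal (- g x)\<close> are the positive and the negative part of \<open>g\<close>. The
  hypothesis makes the finite measures with these densities agree on open sets, hence on Borel sets,
  and densities are unique almost everywhere.\<close>

lemma AE_eq_0_if_integral_open_eq_0:
  fixes g :: "'a::euclidean_space \<Rightarrow> real"
  assumes g: "integrable lborel g"
    and zero: "\<And>U. open U \<Longrightarrow> (\<integral>x. indicator U x * g x \<partial>lborel) = 0"
  shows "AE x in lborel. g x = 0"
proof -
  have [measurable]: "g \<in> borel_measurable borel" using g by auto
  have "density lborel (\<lambda>x. ennreal (g x)) = density lborel (\<lambda>x. ennreal (- g x))"
  proof (rule measure_eqI_generator_eq[where E = "{U. open U}" and \<Omega> = UNIV and A = "\<lambda>_. UNIV"])
    show "Int_stable {U :: 'a set. open U}" by (auto simp: Int_stable_def)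
    show "emeasure (density lborel (\<lambda>x. ennreal (g x))) U = emeasure (density lborel (\<lambda>x. ennreal (- g x))) U"
      if "U \<in> {U. open U}" for U
    proof -
      have U: "open U" and [measurable]: "U \<in> sets borel" using that by auto
      let ?h = "\<lambda>x. indicator U x * g x"
      have h: "integrable lborel ?h"
        using integrable_real_mult_indicator[OF _ g, of U] by (simp add: mult.commute)
      then have fin: "(\<integral>\<^sup>+x. ennreal (?h x) \<partial>lborel) \<noteq> top" "(\<integral>\<^sup>+x. ennreal (- ?h x) \<partial>lborel) \<noteq> top"
        by (simp_all add: real_integrable_def)
      have e: "enn2real (\<integral>\<^sup>+x. ennreal (?h x) \<partial>lborel) = enn2real (\<integral>\<^sup>+x. ennreal (- ?h x) \<partial>lborel)"
        using real_lebesgue_integral_def[OF h] zero[OF U] by linarith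
      have "(\<integral>\<^sup>+x. ennreal (?h x) \<partial>lborel) = (\<integral>\<^sup>+x. ennreal (- ?h x) \<partial>lborel)"
        using arg_cong[OF e, of ennreal] fin by (simp only: ennreal_enn2real_if if_False)
      moreover have "(\<integral>\<^sup>+x. ennreal (?h x) \<partial>lborel) = (\<integral>\<^sup>+x. ennreal (g x) * indicator U x \<partial>lborel)"
        by (intro nn_integral_cong) (auto split: split_indicator)
      moreover have "(\<integral>\<^sup>+x. ennreal (- ?h x) \<partial>lborel) = (\<integral>\<^sup>+x. ennreal (- g x) * indicator U x \<partial>lborel)"
        by (intro nn_integral_cong) (auto split: split_indicator)
      ultimately show ?thesis by (simp add: emeasure_density)
    qed
    show "emeasure (density lborel (\<lambda>x. ennreal (g x))) UNIV \<noteq> \<infinity>"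
      using g by (simp add: emeasure_density real_integrable_def)
  qed (auto simp: borel_def)
  then have "AE x in lborel. ennreal (g x) = ennreal (- g x)"
    by (intro sigma_finite_measure.density_unique[OF sigma_finite_lborel]) auto
  then show ?thesis
  proof eventually_elim
    case (elim x)
    show ?case
    proof (cases "g x \<ge> 0")
      case True
      then have "ennreal (g x) = 0" using elim by (simp only: ennreal_neg neg_le_0_iff_le)
      then show ?thesis using True by (simp add: ennreal_eq_0_iff)
    next
      case False
      then have "ennreal (- g x) = 0" using elim ennreal_neg[of "g x"] by simp
      then show ?thesis using False by (simp add: ennreal_eq_0_iff)
    qed
  qed
qed

section \<open>Test functions that approximate indicators of open sets\<close>

lemma DERIV_square_max_0: "DERIV (\<lambda>t::real. (max 0 t)\<^sup>2) t :> 2 * max 0 t"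
proof -
  \<comment> \<open>In all four sign cases the remainder is quadratic in \<open>h\<close>: squaring
    smooths the kink of the positive part, so polynomial bumps are continuously
    differentiable.\<close>
  have bound: "\<bar>(max 0 (t + h))\<^sup>2 - (max 0 t)\<^sup>2 - 2 * max 0 t * h\<bar> \<le> h\<^sup>2" for h
  proof -
    consider "t \<ge> 0" "t + h \<ge> 0" | "t \<ge> 0" "t + h < 0" | "t < 0" "t + h \<ge> 0" | "t < 0" "t + h < 0"
      by linarith
    then show ?thesis
    proof cases
      case 1
      then show ?thesis by (simp add: max_def power2_eq_square algebra_simps)
    next
      case 2
      have "t * (t + 2 * h) \<le> 0" using 2 by (intro mult_nonneg_nonpos) auto
      moreover have "0 \<le> (t + h)\<^sup>2" by simp
      ultimately show ?thesis using 2 by (simp add: max_def power2_eq_square algebra_simps)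
    next
      case 3
      then have "(t + h)\<^sup>2 \<le> h\<^sup>2" by (intro power_mono) auto
      then show ?thesis using 3 by (simp add: max_def)
    next
      case 4
      then show ?thesis by (simp add: max_def)
    qed
  qed
  have "(\<lambda>h. ((max 0 (t + h))\<^sup>2 - (max 0 t)\<^sup>2) / h - 2 * max 0 t) \<midarrow>0\<rightarrow> 0"
  proof (rule Lim_null_comparison)
    show "eventually (\<lambda>h. norm (((max 0 (t + h))\<^sup>2 - (max 0 t)\<^sup>2) / h - 2 * max 0 t) \<le> \<bar>h\<bar>) (at 0)"
      unfolding eventually_at_filter
    proof (intro always_eventually allI impI)
      fix h :: real assume "h \<noteq> 0"
      then have "norm (((max 0 (t + h))\<^sup>2 - (max 0 t)\<^sup>2) / h - 2 * max 0 t) =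
          \<bar>(max 0 (t + h))\<^sup>2 - (max 0 t)\<^sup>2 - 2 * max 0 t * h\<bar> / \<bar>h\<bar>"
        by (simp add: diff_divide_distrib flip: abs_divide)
      also have "\<dots> \<le> h\<^sup>2 / \<bar>h\<bar>" by (intro divide_right_mono bound) simp
      also have "\<dots> = \<bar>h\<bar>" using \<open>h \<noteq> 0\<close> by (simp add: power2_eq_square abs_if)
      finally show "norm (((max 0 (t + h))\<^sup>2 - (max 0 t)\<^sup>2) / h - 2 * max 0 t) \<le> \<bar>h\<bar>" .
    qed
    show "(\<lambda>h::real. \<bar>h\<bar>) \<midarrow>0\<rightarrow> 0" by (rule tendsto_rabs_zero) simp
  qed
  then show ?thesis unfolding DERIV_def by (rule LIM_zero_cancel)
qed

lemma C1_on_UNIV_ball_bump: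
  fixes c :: "'a::real_inner"
  shows "C1_on UNIV (\<lambda>x. (max 0 (r\<^sup>2 - (x - c) \<bullet> (x - c)))\<^sup>2)"
proof (rule C1_on_UNIV_compose[where g = "\<lambda>t. (max 0 t)\<^sup>2", OF _ DERIV_square_max_0])
  have "GDERIV (\<lambda>x. r\<^sup>2 - (x - c) \<bullet> (x - c)) x :> (-2) *\<^sub>R (x - c)" for x
    unfolding gderiv_def
    by (auto intro!: derivative_eq_intros simp: inner_commute)
  then show "C1_on UNIV (\<lambda>x. r\<^sup>2 - (x - c) \<bullet> (x - c))"
    by (rule C1_on_UNIV_I) (intro continuous_intros)
qed (intro continuous_intros)

text \<open>Lindelof gives countably many balls that exhaust \<open>U\<close> and whose closed balls
  lie in \<open>U\<close>. A finite sum of their bumps has compact support in \<open>U\<close>.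
  Blowing the sum up and applying \<open>1 - inverse (1 + t)\<close> to it pushes the values to 1
  where some bump is positive and leaves 0 elsewhere.\<close>

lemma test_functions_tendsto_indicator:
  fixes U :: "'a::euclidean_space set"
  assumes "open U"
  obtains \<phi> :: "nat \<Rightarrow> 'a \<Rightarrow> real" where "\<And>k. test_function U (\<phi> k)" "\<And>k x. \<bar>\<phi> k x\<bar> \<le> 1"
    "\<And>x. (\<lambda>k. \<phi> k x) \<longlonglongrightarrow> indicator U x"
proof (cases "U = {}")
  case True
  have "test_function U (\<lambda>x. 0)"
    unfolding test_function_def using C1_on_UNIV_const by (auto intro!: exI[of _ "{}"])
  then show ?thesis using that[of "\<lambda>k x. 0"] True by simp
next
  case False
  obtain F where F: "F \<subseteq> {ball x r | x r. r > 0 \<and> cball x r \<subseteq> U}" "countable F"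
    "\<Union>F = \<Union>{ball x r | x r. r > 0 \<and> cball x r \<subseteq> U}"
    by (rule Lindelof[of "{ball x r | x r. r > 0 \<and> cball x r \<subseteq> U}"]) auto
  have FU: "\<Union>F = U"
    unfolding F(3)
  proof (intro equalityI subsetI)
    fix x assume "x \<in> \<Union>{ball x r | x r. r > 0 \<and> cball x r \<subseteq> U}"
    then obtain y r where "x \<in> ball y r" "cball y r \<subseteq> U" by blast
    then show "x \<in> U" using ball_subset_cball[of y r] by blast
  next
    fix x assume "x \<in> U"
    then obtain r where "r > 0" "cball x r \<subseteq> U" using \<open>open U\<close> open_contains_cball by blast
    then show "x \<in> \<Union>{ball x r | x r. r > 0 \<and> cball x r \<subseteq> U}" using centre_in_ball by blast
  qed
  then have "F \<noteq> {}" using False by blast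
  have "\<forall>n. \<exists>p. from_nat_into F n = ball (fst p) (snd p) \<and> snd p > 0 \<and> cball (fst p) (snd p) \<subseteq> U"
    using F(1) from_nat_into[OF \<open>F \<noteq> {}\<close>] by fastforce
  from choice[OF this] obtain p where p: "\<And>n. from_nat_into F n = ball (fst (p n)) (snd (p n))"
    "\<And>n. snd (p n) > 0" "\<And>n. cball (fst (p n)) (snd (p n)) \<subseteq> U" by blast
  define c where "c n = fst (p n)" for n
  define r where "r n = snd (p n)" for n
  define b where "b n x = (max 0 ((r n)\<^sup>2 - (x - c n) \<bullet> (x - c n)))\<^sup>2" for n x
  \<comment> \<open>The factor \<open>k\<close> makes the values diverge at every point of
    \<open>U\<close>, while stopping the sum at \<open>k\<close> keeps the support compact.\<close>
  define \<psi> where "\<psi> k x = real k * (\<Sum>n<k. b n x)" for k x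
  define \<phi> where "\<phi> k x = 1 - inverse (1 + \<psi> k x)" for k x
  have b0: "0 \<le> b n x" for n x by (simp add: b_def)
  have \<psi>0: "0 \<le> \<psi> k x" for k x by (auto simp: \<psi>_def b0 sum_nonneg)
  have b_pos: "b n x > 0" if "x \<in> ball (c n) (r n)" for n x
  proof -
    have "norm (x - c n) < r n" using that by (simp add: dist_norm norm_minus_commute)
    then have "(norm (x - c n))\<^sup>2 < (r n)\<^sup>2" by (intro power_strict_mono) auto
    then show ?thesis by (simp add: b_def power2_norm_eq_inner)
  qed
  have b_zero: "b n x = 0" if "x \<notin> cball (c n) (r n)" for n x
  proof -
    have "r n \<le> norm (x - c n)" using that by (simp add: dist_norm norm_minus_commute)
    then have "(r n)\<^sup>2 \<le> (norm (x - c n))\<^sup>2" using p(2)[of n] by (intro power_mono) (auto simp: r_def)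
    then show ?thesis by (simp add: b_def power2_norm_eq_inner)
  qed
  show ?thesis
  proof (rule that[of \<phi>])
    fix k
    have "C1_on UNIV (\<psi> k)"
      unfolding \<psi>_def b_def by (intro C1_on_UNIV_mult C1_on_UNIV_const C1_on_UNIV_sum C1_on_UNIV_ball_bump)
    moreover have "1 + \<psi> k x \<noteq> 0" for x using \<psi>0[of k x] by linarith
    ultimately have "C1_on UNIV (\<phi> k)"
      unfolding \<phi>_def by (intro C1_on_UNIV_diff C1_on_UNIV_const C1_on_UNIV_inverse C1_on_UNIV_add)
    moreover have "compact (\<Union>n<k. cball (c n) (r n))" by (intro compact_UN) auto
    moreover have "(\<Union>n<k. cball (c n) (r n)) \<subseteq> U" using p(3) by (auto simp: c_def r_def)
    moreover have "\<phi> k x = 0" if "x \<notin> (\<Union>n<k. cball (c n) (r n))" for x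
    proof -
      have "b n x = 0" if "n < k" for n
        using b_zero[of x n] that \<open>x \<notin> (\<Union>n<k. cball (c n) (r n))\<close> by blast
      then have "(\<Sum>n<k. b n x) = 0" by simp
      then show ?thesis by (simp add: \<phi>_def \<psi>_def)
    qed
    ultimately show "test_function U (\<phi> k)" unfolding test_function_def by blast
    show "\<bar>\<phi> k x\<bar> \<le> 1" for x
    proof -
      have "inverse (1 + \<psi> k x) \<le> 1" using le_imp_inverse_le[of 1 "1 + \<psi> k x"] \<psi>0[of k x] by simp
      moreover have "inverse (1 + \<psi> k x) \<ge> 0" using \<psi>0[of k x] by simp
      ultimately show ?thesis unfolding \<phi>_def by linarith
    qed
  next
    fix x
    show "(\<lambda>k. \<phi> k x) \<longlonglongrightarrow> indicator U x"
    proof (cases "x \<in> U")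
      case False
      then have "x \<notin> cball (c n) (r n)" for n unfolding c_def r_def using p(3)[of n] by blast
      then have "b n x = 0" for n by (rule b_zero)
      then show ?thesis using False by (simp add: \<phi>_def \<psi>_def)
    next
      case True
      then obtain B where "B \<in> F" "x \<in> B" using FU by blast
      then obtain n where "from_nat_into F n = B" using from_nat_into_surj[OF F(2)] by blast
      then have "x \<in> ball (c n) (r n)" using p(1)[of n] \<open>x \<in> B\<close> unfolding c_def r_def by metis
      then have pos: "b n x > 0" by (rule b_pos)
      have "filterlim (\<lambda>k. 1 + real k * b n x) at_top sequentially"
        by (intro filterlim_tendsto_add_at_top[OF tendsto_const]
            filterlim_at_top_mult_tendsto_pos[OF tendsto_const pos] filterlim_real_sequentially)
      moreover have "eventually (\<lambda>k. 1 + real k * b n x \<le> 1 + \<psi> k x) sequentially"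
        using eventually_gt_at_top[of n]
      proof eventually_elim
        case (elim k)
        have "b n x \<le> (\<Sum>n<k. b n x)" using elim b0 by (intro member_le_sum) auto
        then show ?case by (simp add: \<psi>_def mult_left_mono)
      qed
      ultimately have "filterlim (\<lambda>k. 1 + \<psi> k x) at_top sequentially"
        by (rule filterlim_at_top_mono)
      then have "(\<lambda>k. inverse (1 + \<psi> k x)) \<longlonglongrightarrow> 0"
        by (rule tendsto_inverse_0_at_top)
      then have "(\<lambda>k. 1 - inverse (1 + \<psi> k x)) \<longlonglongrightarrow> 1 - 0" by (intro tendsto_intros)
      then show ?thesis using True by (simp add: \<phi>_def)
    qed
  qed
qed

section \<open>Weak gradients of constants and their uniqueness\<close>

lemma grad_eq_0_outside_support:
  assumes "closed K" "\<And>x. x \<notin> K \<Longrightarrow> \<phi> x = 0" "x \<notin> K"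
  shows "grad \<phi> x = 0"
proof (rule grad_eqI)
  have "((\<lambda>x. 0::real) has_derivative (\<lambda>h. h \<bullet> 0)) (at x)" by simp
  then show "GDERIV \<phi> x :> 0"
    unfolding gderiv_def
    by (rule has_derivative_transform_within_open[where s = "- K"]) (use assms in auto)
qed

text \<open>The integral of a difference quotient of \<open>\<phi>\<close> vanishes because Lebesgue
  measure is translation invariant; dominated convergence carries this over to every directional
  derivative.\<close>

lemma integral_grad_eq_0:
  fixes \<phi> :: "'a::euclidean_space \<Rightarrow> real"
  assumes \<phi>: "C1_on UNIV \<phi>" and "compact K" and K: "\<And>x. x \<notin> K \<Longrightarrow> \<phi> x = 0"
  shows "integrable lborel (grad \<phi>)" "(\<integral>x. grad \<phi> x \<partial>lborel) = 0"
proof -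
  note [measurable] = C1_on_UNIV_measurable[OF \<phi>]
  have gK: "grad \<phi> x = 0" if "x \<notin> K" for x
    using grad_eq_0_outside_support[OF compact_imp_closed[OF \<open>compact K\<close>] K that] .
  have "integrable lborel (\<lambda>x. indicator K x *\<^sub>R grad \<phi> x)"
    by (intro borel_integrable_compact \<open>compact K\<close> continuous_on_subset[OF C1_on_UNIV_continuous_grad[OF \<phi>]]) simp
  moreover have "(\<lambda>x. indicator K x *\<^sub>R grad \<phi> x) = grad \<phi>" using gK by (auto split: split_indicator)
  ultimately show int_grad: "integrable lborel (grad \<phi>)" by simp
  have "integrable lborel (\<lambda>x. indicator K x *\<^sub>R \<phi> x)"
    by (intro borel_integrable_compact \<open>compact K\<close> continuous_on_subset[OF C1_on_UNIV_continuous[OF \<phi>]]) simp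
  moreover have "(\<lambda>x. indicator K x *\<^sub>R \<phi> x) = \<phi>" using K by (auto split: split_indicator)
  ultimately have int: "integrable lborel \<phi>" by simp
  obtain R where "\<And>x. x \<in> K \<Longrightarrow> norm x \<le> R"
    using compact_imp_bounded[OF \<open>compact K\<close>] by (auto simp: bounded_iff)
  then have R: "K \<subseteq> cball 0 R" by auto
  obtain B where B: "B \<ge> 0" "\<And>x. norm (grad \<phi> x) \<le> B"
  proof -
    have "bounded (grad \<phi> ` K)"
      by (intro compact_imp_bounded compact_continuous_image \<open>compact K\<close>
          continuous_on_subset[OF C1_on_UNIV_continuous_grad[OF \<phi>]]) simp
    then obtain B where "B > 0" "\<And>x. x \<in> K \<Longrightarrow> norm (grad \<phi> x) \<le> B"
      by (auto simp: bounded_pos)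
    then have "norm (grad \<phi> x) \<le> B" for x using gK[of x] by (cases "x \<in> K") auto
    then show ?thesis using that[of B] \<open>B > 0\<close> by simp
  qed
  have lip: "\<bar>\<phi> y - \<phi> x\<bar> \<le> B * norm (y - x)" for x y
  proof -
    have "norm (\<phi> y - \<phi> x) \<le> B * norm (y - x)"
    proof (rule differentiable_bound[where S = UNIV and f' = "\<lambda>x h. h \<bullet> grad \<phi> x"])
      show "(\<phi> has_derivative (\<lambda>h. h \<bullet> grad \<phi> x)) (at x within UNIV)" for x
        using C1_on_UNIV_GDERIV[OF \<phi>, of x] by (simp add: gderiv_def)
      show "onorm (\<lambda>h. h \<bullet> grad \<phi> x) \<le> B" for x
      proof (rule onorm_le)
        fix h
        have "norm (h \<bullet> grad \<phi> x) \<le> norm h * norm (grad \<phi> x)"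
          using Cauchy_Schwarz_ineq2[of h "grad \<phi> x"] by simp
        also have "\<dots> \<le> B * norm h"
          using mult_right_mono[OF B(2)[of x] norm_ge_zero[of h]]
          by (simp only: mult.commute[of "norm h" "norm (grad \<phi> x)"])
        finally show "norm (h \<bullet> grad \<phi> x) \<le> B * norm h" .
      qed
    qed auto
    then show ?thesis by simp
  qed
  have "(\<integral>x. v \<bullet> grad \<phi> x \<partial>lborel) = 0" for v
  proof -
    define t where "t i = inverse (real (Suc i))" for i
    have t: "0 < t i" "t i \<le> 1" for i by (auto simp: t_def inverse_le_1_iff)
    define s where "s i x = (\<phi> (x + t i *\<^sub>R v) - \<phi> x) / t i" for i x
    \<comment> \<open>The dominating function is \<open>B * norm v\<close> on a ball: all steps
      \<open>t i\<close> are at most 1, so the difference quotients vanish outside that ball, and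
      inside it they obey the Lipschitz bound.\<close>
    have "(\<lambda>i. \<integral>x. s i x \<partial>lborel) \<longlonglongrightarrow> (\<integral>x. v \<bullet> grad \<phi> x \<partial>lborel)"
    proof (rule integral_dominated_convergence[where w = "\<lambda>x. indicator (cball 0 (R + norm v)) x *\<^sub>R (B * norm v)"])
      show "integrable lborel (\<lambda>x::'a. indicator (cball 0 (R + norm v)) x *\<^sub>R (B * norm v))"
        by (intro borel_integrable_compact) auto
      show "AE x in lborel. (\<lambda>i. s i x) \<longlonglongrightarrow> v \<bullet> grad \<phi> x"
      proof (intro AE_I2)
        fix x
        have lim: "(\<lambda>h. (\<phi> (x + (0 + h) *\<^sub>R v) - \<phi> (x + 0 *\<^sub>R v)) / h) \<midarrow>0\<rightarrow> v \<bullet> grad \<phi> (x + 0 *\<^sub>R v)"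
          using C1_on_UNIV_DERIV_line[OF \<phi>, of x v 0] unfolding DERIV_def .
        have "filterlim t (at 0) sequentially"
          unfolding t_def
          by (intro filterlim_atI LIMSEQ_inverse_real_of_nat always_eventually) simp
        from filterlim_compose[OF lim this] show "(\<lambda>i. s i x) \<longlonglongrightarrow> v \<bullet> grad \<phi> x"
          by (simp add: s_def)
      qed
      show "AE x in lborel. norm (s i x) \<le> indicator (cball 0 (R + norm v)) x *\<^sub>R (B * norm v)" for i
      proof (intro AE_I2)
        fix x
        show "norm (s i x) \<le> indicator (cball 0 (R + norm v)) x *\<^sub>R (B * norm v)"
        proof (cases "x \<in> cball 0 (R + norm v)")
          case True
          have "\<bar>\<phi> (x + t i *\<^sub>R v) - \<phi> x\<bar> \<le> B * (t i * norm v)"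
            using lip[of "x + t i *\<^sub>R v" x] t[of i] by simp
          then have "\<bar>s i x\<bar> \<le> B * norm v"
            using t[of i] by (simp add: s_def field_simps)
          then show ?thesis using True by simp
        next
          case False
          have "norm x \<le> norm (x + t i *\<^sub>R v) + norm (t i *\<^sub>R v)"
            using norm_triangle_ineq4[of "x + t i *\<^sub>R v" "t i *\<^sub>R v"] by simp
          also have "norm (t i *\<^sub>R v) \<le> norm v" using t[of i] by (simp add: mult_left_le_one_le)
          finally have "norm x \<le> norm (x + t i *\<^sub>R v) + norm v" by simp
          moreover have "norm x > R + norm v" using False by simp
          ultimately have "norm (x + t i *\<^sub>R v) > R" "norm x > R" using norm_ge_zero[of v]
            by linarith+
          then have "x + t i *\<^sub>R v \<notin> K" "x \<notin> K" using R by auto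
          then show ?thesis using K False by (simp add: s_def)
        qed
      qed
    qed (auto simp: s_def)
    moreover have "(\<integral>x. s i x \<partial>lborel) = 0" for i
    proof -
      have eq: "lborel = distr lborel borel ((+) (t i *\<^sub>R v))" by (rule lborel_distr_plus[symmetric])
      have "integrable (distr lborel borel ((+) (t i *\<^sub>R v))) \<phi>" using int eq by simp
      then have i1: "integrable lborel (\<lambda>x. \<phi> (x + t i *\<^sub>R v))"
        by (subst (asm) integrable_distr_eq) (auto simp: add.commute)
      have "(\<integral>x. \<phi> x \<partial>distr lborel borel ((+) (t i *\<^sub>R v))) = (\<integral>x. \<phi> (x + t i *\<^sub>R v) \<partial>lborel)"
        by (subst integral_distr) (auto simp: add.commute)
      then have "(\<integral>x. \<phi> (x + t i *\<^sub>R v) \<partial>lborel) = (\<integral>x. \<phi> x \<partial>lborel)" using eq by simp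
      then show ?thesis unfolding s_def using i1 int by simp
    qed
    ultimately show ?thesis by (simp add: LIMSEQ_const_iff)
  qed
  then have "v \<bullet> (\<integral>x. grad \<phi> x \<partial>lborel) = 0" for v
    using int_grad by (simp flip: integral_inner_right)
  then show "(\<integral>x. grad \<phi> x \<partial>lborel) = 0"
    using inner_eq_zero_iff by blast
qed

lemma integral_lebesgue_on_borel:
  fixes f :: "'a::euclidean_space \<Rightarrow> 'b::{banach, second_countable_topology}"
  assumes [measurable]: "f \<in> borel_measurable borel" "\<Omega> \<in> sets borel"
  shows "(LINT x|lebesgue_on \<Omega>. f x) = (\<integral>x. indicator \<Omega> x *\<^sub>R f x \<partial>lborel)"
  by (subst integral_restrict_space) (auto intro!: integral_completion)

lemma test_functionE:
  assumes "test_function \<Omega> \<phi>"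
  obtains K where "C1_on UNIV \<phi>" "compact K" "K \<subseteq> \<Omega>" "\<And>x. x \<notin> K \<Longrightarrow> \<phi> x = 0"
  using assms unfolding test_function_def by blast

lemma has_weak_gradientD:
  assumes "has_weak_gradient \<Omega> v G" "test_function \<Omega> \<phi>"
  shows "(LINT x|lebesgue_on \<Omega>. v x *\<^sub>R grad \<phi> x) = - (LINT x|lebesgue_on \<Omega>. \<phi> x *\<^sub>R G x)"
  using assms unfolding has_weak_gradient_def by blast

lemma has_weak_gradient_const:
  fixes \<Omega> :: "'a::euclidean_space set"
  assumes "open \<Omega>"
  shows "has_weak_gradient \<Omega> (\<lambda>x. c) (\<lambda>x. 0)"
  unfolding has_weak_gradient_def
proof (intro conjI allI impI)
  show "sq_integrable (lebesgue_on \<Omega>) (\<lambda>x. 0 :: 'a)" by (simp add: sq_integrable_def)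
  fix \<phi> assume "test_function \<Omega> \<phi>"
  then obtain K where \<phi>: "C1_on UNIV \<phi>" and K: "compact K" "K \<subseteq> \<Omega>" "\<And>x. x \<notin> K \<Longrightarrow> \<phi> x = 0"
    using test_functionE by blast
  have [measurable]: "\<Omega> \<in> sets borel" using assms by simp
  note [measurable] = C1_on_UNIV_measurable[OF \<phi>]
  have "grad \<phi> x = 0" if "x \<notin> K" for x
    using grad_eq_0_outside_support[OF compact_imp_closed[OF K(1)] K(3) that] .
  then have "indicator \<Omega> x *\<^sub>R grad \<phi> x = grad \<phi> x" for x
    using K(2) by (cases "x \<in> K") (auto split: split_indicator)
  then have "(LINT x|lebesgue_on \<Omega>. grad \<phi> x) = 0"
    using integral_grad_eq_0(2)[OF \<phi> K(1,3)] by (simp add: integral_lebesgue_on_borel)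
  then show "(LINT x|lebesgue_on \<Omega>. c *\<^sub>R grad \<phi> x) = - (LINT x|lebesgue_on \<Omega>. \<phi> x *\<^sub>R 0)"
    by simp
qed

text \<open>\<open>weak_grad\<close> is a \<open>SOME\<close> choice, so the quotient of a constant
  function is known only once every weak gradient of a constant vanishes almost everywhere.
  Comparison with the weak gradient 0 shows that \<open>G\<close> is orthogonal to all test
  functions, and these approximate indicators of open sets.\<close>

lemma weak_gradient_const_eq_0:
  fixes \<Omega> :: "'a::euclidean_space set"
  assumes "open \<Omega>" "bounded \<Omega>" and G: "has_weak_gradient \<Omega> (\<lambda>x. c) G"
  shows "AE x in lebesgue_on \<Omega>. G x = 0"
proof -
  have \<Omega>[measurable]: "\<Omega> \<in> sets borel" using assms by simp
  then have \<Omega>_leb: "\<Omega> \<inter> space lebesgue \<in> sets lebesgue" by simp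
  interpret L: finite_measure "lebesgue_on \<Omega>"
    using emeasure_bounded_finite[OF \<open>bounded \<Omega>\<close>]
    by (intro finite_measureI) (simp add: emeasure_restrict_space)
  have sq: "sq_integrable (lebesgue_on \<Omega>) G" using G by (simp add: has_weak_gradient_def)
  then have [measurable]: "G \<in> borel_measurable (lebesgue_on \<Omega>)" by (simp add: sq_integrable_def)
  have int_G: "integrable (lebesgue_on \<Omega>) G"
  proof (rule Bochner_Integration.integrable_bound)
    show "integrable (lebesgue_on \<Omega>) (\<lambda>x. 1 + (norm (G x))\<^sup>2)"
      using sq by (simp add: sq_integrable_def)
    have "norm (G x) \<le> 1 + (norm (G x))\<^sup>2" for x
      using zero_le_power2[of "norm (G x) - 1/2"] by (simp add: power2_eq_square algebra_simps)
    then show "AE x in lebesgue_on \<Omega>. norm (G x) \<le> norm (1 + (norm (G x))\<^sup>2)" by simp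
  qed simp
  have "AE x in lebesgue_on \<Omega>. G x \<bullet> b = 0" for b
  proof -
    define g where "g x = indicator \<Omega> x * (G x \<bullet> b)" for x
    have "integrable (lebesgue_on \<Omega>) (\<lambda>x. G x \<bullet> b)" using int_G by simp
    then have int_g: "integrable lebesgue g"
      unfolding g_def using integrable_restrict_space[OF \<Omega>_leb, of "\<lambda>x. G x \<bullet> b"] by simp
    then have gm: "g \<in> borel_measurable lebesgue" by (rule borel_measurable_integrable)
    \<comment> \<open>\<open>g\<close> is only Lebesgue measurable, while the uniqueness argument
      compares densities of Borel measures; a Borel representative \<open>g'\<close> replaces it up
      to a null set.\<close>
    from completion_ex_borel_measurable_real[OF this]
    obtain g' where g'[measurable]: "g' \<in> borel_measurable lborel" and ae: "AE x in lborel. g x = g' x"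
      by blast
    have ae': "AE x in lebesgue. g x = g' x" using ae by (rule AE_completion)
    have "g' \<in> borel_measurable lebesgue" using g' by (rule measurable_completion)
    then have "integrable lebesgue g'" using ae' by (rule integrable_cong_AE_imp[OF int_g])
    then have int_g': "integrable lborel g'" using g' by (simp add: integrable_completion)
    have test: "(\<integral>x. \<phi> x * g x \<partial>lebesgue) = 0" if tf: "test_function \<Omega> \<phi>" for \<phi>
    proof -
      obtain K where \<phi>: "C1_on UNIV \<phi>" and K: "compact K" "K \<subseteq> \<Omega>" "\<And>x. x \<notin> K \<Longrightarrow> \<phi> x = 0"
        using test_functionE[OF tf] by blast
      note [measurable] = C1_on_UNIV_measurable[OF \<phi>]
      have "bounded (\<phi> ` K)"
        by (intro compact_imp_bounded compact_continuous_image K(1)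
            continuous_on_subset[OF C1_on_UNIV_continuous[OF \<phi>]]) simp
      then obtain B where B: "B > 0" "\<And>x. x \<in> K \<Longrightarrow> \<bar>\<phi> x\<bar> \<le> B" by (auto simp: bounded_pos)
      have B': "\<bar>\<phi> x\<bar> \<le> B" for x
      proof (cases "x \<in> K")
        case True
        then show ?thesis by (rule B(2))
      next
        case False
        then show ?thesis using K(3) B(1) by simp
      qed
      have m1[measurable]: "\<phi> \<in> borel_measurable (lebesgue_on \<Omega>)"
        by (intro measurable_restrict_space1 measurable_completion) simp
      have int_\<phi>G: "integrable (lebesgue_on \<Omega>) (\<lambda>x. \<phi> x *\<^sub>R G x)"
      proof (rule Bochner_Integration.integrable_bound)
        show "integrable (lebesgue_on \<Omega>) (\<lambda>x. B *\<^sub>R G x)" using int_G by simp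
        show "AE x in lebesgue_on \<Omega>. norm (\<phi> x *\<^sub>R G x) \<le> norm (B *\<^sub>R G x)"
          using B' B(1) by (intro AE_I2) (simp add: mult_right_mono)
      qed simp
      have "(LINT x|lebesgue_on \<Omega>. \<phi> x *\<^sub>R G x) = (LINT x|lebesgue_on \<Omega>. \<phi> x *\<^sub>R 0)"
        using has_weak_gradientD[OF G tf]
          has_weak_gradientD[OF has_weak_gradient_const[OF \<open>open \<Omega>\<close>, of c] tf]
        by (metis neg_equal_iff_equal)
      then have z: "(LINT x|lebesgue_on \<Omega>. \<phi> x *\<^sub>R G x) = 0" by simp
      have "(\<integral>x. \<phi> x * g x \<partial>lebesgue) = (LINT x|lebesgue_on \<Omega>. (\<phi> x *\<^sub>R G x) \<bullet> b)"
        by (subst integral_restrict_space[OF \<Omega>_leb]) (simp add: g_def mult_ac)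
      also have "\<dots> = (LINT x|lebesgue_on \<Omega>. \<phi> x *\<^sub>R G x) \<bullet> b"
        using int_\<phi>G by (rule integral_inner_left)
      finally show ?thesis using z by simp
    qed
    have "AE x in lborel. g' x = 0"
    proof (rule AE_eq_0_if_integral_open_eq_0[OF int_g'])
      fix U :: "'a set" assume "open U"
      \<comment> \<open>The test functions have to be supported in \<open>\<Omega>\<close>, hence
        the intersection; nothing is lost, since \<open>g\<close> vanishes outside
        \<open>\<Omega>\<close>.\<close>
      then have "open (U \<inter> \<Omega>)" using assms by auto
      then obtain \<phi> where \<phi>: "\<And>k. test_function (U \<inter> \<Omega>) (\<phi> k)" "\<And>k x. \<bar>\<phi> k x\<bar> \<le> 1"
        "\<And>x. (\<lambda>k. \<phi> k x) \<longlonglongrightarrow> (indicator (U \<inter> \<Omega>) x :: real)"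
        by (rule test_functions_tendsto_indicator) blast
      have [measurable]: "U \<in> sets borel" using \<open>open U\<close> by simp
      have \<phi>m[measurable]: "\<phi> k \<in> borel_measurable borel" for k
        using \<phi>(1)[of k] C1_on_UNIV_measurable by (auto simp: test_function_def)
      have \<phi>l[measurable]: "\<phi> k \<in> borel_measurable lebesgue" for k
        by (intro measurable_completion) simp
      note [measurable] = gm
      have "(\<lambda>k. \<integral>x. \<phi> k x * g x \<partial>lebesgue) \<longlonglongrightarrow> (\<integral>x. indicator (U \<inter> \<Omega>) x * g x \<partial>lebesgue)"
      proof (rule integral_dominated_convergence[where w = "\<lambda>x. \<bar>g x\<bar>"])
        show "(\<lambda>x. indicator (U \<inter> \<Omega>) x * g x) \<in> borel_measurable lebesgue"
          by (intro borel_measurable_times borel_measurable_indicator sets.Int) auto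
        show "AE x in lebesgue. (\<lambda>k. \<phi> k x * g x) \<longlonglongrightarrow> indicator (U \<inter> \<Omega>) x * g x"
          using \<phi>(3) by (intro AE_I2 tendsto_intros)
        show "AE x in lebesgue. norm (\<phi> k x * g x) \<le> \<bar>g x\<bar>" for k
          using \<phi>(2) by (intro AE_I2) (simp add: abs_mult mult_left_le_one_le)
      qed (use int_g in auto)
      moreover have "test_function \<Omega> (\<phi> k)" for k
        using \<phi>(1)[of k] unfolding test_function_def by blast
      ultimately have "(\<integral>x. indicator (U \<inter> \<Omega>) x * g x \<partial>lebesgue) = 0"
        by (simp add: test LIMSEQ_const_iff)
      also have "(\<integral>x. indicator (U \<inter> \<Omega>) x * g x \<partial>lebesgue) = (\<integral>x. indicator U x * g x \<partial>lebesgue)"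
        by (intro Bochner_Integration.integral_cong) (auto simp: g_def split: split_indicator)
      also have "\<dots> = (\<integral>x. indicator U x * g' x \<partial>lebesgue)"
      proof (rule integral_cong_AE)
        show "(\<lambda>x. indicator U x * g x) \<in> borel_measurable lebesgue"
          by (intro borel_measurable_times borel_measurable_indicator) auto
        show "(\<lambda>x. indicator U x * g' x) \<in> borel_measurable lebesgue"
          by (intro measurable_completion) simp
        show "AE x in lebesgue. indicator U x * g x = indicator U x * g' x"
          using ae' by eventually_elim simp
      qed
      also have "\<dots> = (\<integral>x. indicator U x * g' x \<partial>lborel)" by (rule integral_completion) simp
      finally show "(\<integral>x. indicator U x * g' x \<partial>lborel) = 0" .
    qed
    then have "AE x in lebesgue. g' x = 0" by (rule AE_completion)
    with ae' have "AE x in lebesgue. x \<in> \<Omega> \<longrightarrow> G x \<bullet> b = 0"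
      by eventually_elim (auto simp: g_def split: split_indicator_asm)
    then show ?thesis using AE_restrict_space_iff[OF \<Omega>_leb] by auto
  qed
  then have "AE x in lebesgue_on \<Omega>. \<forall>b\<in>Basis. G x \<bullet> b = 0"
    by (simp add: AE_finite_all[OF finite_Basis])
  then show ?thesis by eventually_elim (simp add: euclidean_all_zero_iff)
qed

subsection \<open>Combination of the two inequalities\<close>

lemma borel_measurable_boundary_measure:
  "f \<in> borel_measurable borel \<Longrightarrow> f \<in> borel_measurable (boundary_measure \<Omega>)"
  unfolding boundary_measure_def
  by (intro measurable_restrict_space1) (simp cong: measurable_cong_sets)

lemma borel_measurable_lebesgue_on:
  fixes f :: "'a::euclidean_space \<Rightarrow> 'b::topological_space"
  shows "f \<in> borel_measurable borel \<Longrightarrow> f \<in> borel_measurable (lebesgue_on \<Omega>)"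
  by (intro measurable_restrict_space1 measurable_completion) simp

lemma nn_integral_lebesgue_on_borel:
  fixes f :: "'a::euclidean_space \<Rightarrow> ennreal"
  assumes [measurable]: "f \<in> borel_measurable borel" "\<Omega> \<in> sets borel"
  shows "(\<integral>\<^sup>+x. f x \<partial>lebesgue_on \<Omega>) = (\<integral>\<^sup>+x\<in>\<Omega>. f x \<partial>lborel)"
  by (subst nn_integral_restrict_space) (auto intro!: nn_integral_completion)

lemma finite_measure_lebesgue_on_bounded:
  fixes \<Omega> :: "'a::euclidean_space set"
  assumes "bounded \<Omega>" "\<Omega> \<in> sets borel"
  shows "finite_measure (lebesgue_on \<Omega>)"
  using emeasure_bounded_finite[OF \<open>bounded \<Omega>\<close>] assms
  by (intro finite_measureI) (simp add: emeasure_restrict_space)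

text \<open>This is the trace inequality for the constant function 1, whose right-hand side is a
  multiple of the measure of \<open>\<Omega>\<close>.\<close>

lemma finite_boundary_measure:
  fixes \<Omega> :: "'a::euclidean_space set"
  assumes "open \<Omega>" "bounded \<Omega>" "lipschitz_boundary \<Omega>"
  shows "finite_measure (boundary_measure \<Omega>)"
proof -
  obtain C where "C < top" and C: "\<And>\<phi>. C1_on UNIV \<phi> \<Longrightarrow>
    (\<integral>\<^sup>+x. ennreal ((\<phi> x)\<^sup>2) \<partial>boundary_measure \<Omega>) \<le>
      C * (\<integral>\<^sup>+x\<in>\<Omega>. ennreal ((\<phi> x)\<^sup>2 + (norm (grad \<phi> x))\<^sup>2) \<partial>lborel)"
    using trace_inequality[OF assms] by blast
  have "emeasure (boundary_measure \<Omega>) (space (boundary_measure \<Omega>)) \<le> C * emeasure lborel \<Omega>"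
    using C[OF C1_on_UNIV_const[of 1]] \<open>open \<Omega>\<close> by (simp add: grad_const)
  also have "\<dots> < top"
    using \<open>C < top\<close> emeasure_bounded_finite[OF \<open>bounded \<Omega>\<close>] by (simp add: ennreal_mult_less_top)
  finally show ?thesis by (intro finite_measureI) simp
qed

lemma sq_integrable_continuous:
  fixes f :: "'a::euclidean_space \<Rightarrow> 'b::euclidean_space"
  assumes "finite_measure M" "f \<in> borel_measurable M" "continuous_on UNIV f"
    and "bounded (space M)"
  shows "sq_integrable M f"
proof -
  interpret finite_measure M by fact
  have "bounded (f ` closure (space M))"
    by (intro compact_imp_bounded compact_continuous_image continuous_on_subset[OF assms(3)])
      (use assms(4) in auto)
  then obtain B where B: "\<And>x. x \<in> closure (space M) \<Longrightarrow> norm (f x) \<le> B"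
    by (auto simp: bounded_iff)
  have [measurable]: "f \<in> borel_measurable M" by fact
  have "integrable M (\<lambda>x. (norm (f x))\<^sup>2)"
  proof (rule integrable_const_bound)
    show "AE x in M. norm ((norm (f x))\<^sup>2) \<le> B\<^sup>2"
    proof (intro AE_I2)
      fix x assume "x \<in> space M"
      then have "norm (f x) \<le> B" using B closure_subset by blast
      then show "norm ((norm (f x))\<^sup>2) \<le> B\<^sup>2" by (simp add: power_mono)
    qed
  qed simp
  then show ?thesis unfolding sq_integrable_def using assms(2) by simp
qed

lemma sq_integrable_diff:
  assumes "sq_integrable M f" "sq_integrable M g"
  shows "sq_integrable M (\<lambda>x. f x - g x)"
  unfolding sq_integrable_def
proof
  have [measurable]: "f \<in> borel_measurable M" "g \<in> borel_measurable M"
    using assms by (auto simp: sq_integrable_def)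
  show "(\<lambda>x. f x - g x) \<in> borel_measurable M" by simp
  show "integrable M (\<lambda>x. (norm (f x - g x))\<^sup>2)"
  proof (rule Bochner_Integration.integrable_bound)
    show "integrable M (\<lambda>x. 2 * (norm (f x))\<^sup>2 + 2 * (norm (g x))\<^sup>2)"
      using assms by (simp add: sq_integrable_def)
    have "(norm (f x - g x))\<^sup>2 \<le> 2 * (norm (f x))\<^sup>2 + 2 * (norm (g x))\<^sup>2" for x
    proof -
      have "(norm (f x - g x))\<^sup>2 \<le> (norm (f x) + norm (g x))\<^sup>2"
        by (intro power_mono norm_triangle_ineq4) simp
      also have "\<dots> \<le> 2 * (norm (f x))\<^sup>2 + 2 * (norm (g x))\<^sup>2" by (rule square_sum2_le)
      finally show ?thesis .
    qed
    then show "AE x in M. norm ((norm (f x - g x))\<^sup>2) \<le> norm (2 * (norm (f x))\<^sup>2 + 2 * (norm (g x))\<^sup>2)"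
      by simp
  qed simp
qed

lemma sq_integrable_const: "finite_measure M \<Longrightarrow> sq_integrable M (\<lambda>x. c)"
  unfolding sq_integrable_def by (simp add: finite_measure.integrable_const)

lemma integral_norm_diff_square_le:
  assumes "sq_integrable M f" "sq_integrable M g" "sq_integrable M h"
  shows "(\<integral>x. (norm (f x - h x))\<^sup>2 \<partial>M) \<le>
    2 * (\<integral>x. (norm (f x - g x))\<^sup>2 \<partial>M) + 2 * (\<integral>x. (norm (g x - h x))\<^sup>2 \<partial>M)"
proof -
  have i: "integrable M (\<lambda>x. (norm (f x - h x))\<^sup>2)" "integrable M (\<lambda>x. (norm (f x - g x))\<^sup>2)"
    "integrable M (\<lambda>x. (norm (g x - h x))\<^sup>2)"
    using assms sq_integrable_diff unfolding sq_integrable_def by blast+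
  have "(\<integral>x. (norm (f x - h x))\<^sup>2 \<partial>M) \<le> (\<integral>x. 2 * (norm (f x - g x))\<^sup>2 + 2 * (norm (g x - h x))\<^sup>2 \<partial>M)"
  proof (rule integral_mono)
    fix x
    have "norm (f x - h x) \<le> norm (f x - g x) + norm (g x - h x)"
      using norm_triangle_ineq[of "f x - g x" "g x - h x"] by simp
    then have "(norm (f x - h x))\<^sup>2 \<le> (norm (f x - g x) + norm (g x - h x))\<^sup>2"
      by (intro power_mono) auto
    also have "\<dots> \<le> 2 * (norm (f x - g x))\<^sup>2 + 2 * (norm (g x - h x))\<^sup>2" by (rule square_sum2_le)
    finally show "(norm (f x - h x))\<^sup>2 \<le> 2 * (norm (f x - g x))\<^sup>2 + 2 * (norm (g x - h x))\<^sup>2" .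
  qed (use i in auto)
  also have "\<dots> = 2 * (\<integral>x. (norm (f x - g x))\<^sup>2 \<partial>M) + 2 * (\<integral>x. (norm (g x - h x))\<^sup>2 \<partial>M)"
    using i by simp
  finally show ?thesis .
qed

lemmas integral_diff_square_le = integral_norm_diff_square_le[where 'b = real, unfolded real_norm_def power2_abs]

text \<open>The factor of \<open>b\<^sup>2\<close> can be taken as close to 1 as desired, at the
  expense of the other factor. The cruder bound with two factors 2 would spoil the constant in the
  limit.\<close>

lemma square_le_young:
  fixes a b \<delta> :: real
  assumes "\<delta> > 0"
  shows "a\<^sup>2 \<le> (1 + \<delta>) * b\<^sup>2 + (1 + 1 / \<delta>) * (a - b)\<^sup>2"
proof -
  have "0 \<le> (\<delta> * b - (a - b))\<^sup>2 / \<delta>" using assms by simp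
  also have "\<dots> = \<delta> * b\<^sup>2 - 2 * b * (a - b) + (a - b)\<^sup>2 / \<delta>"
    using assms by (simp add: power2_eq_square field_simps)
  finally have "2 * b * (a - b) \<le> \<delta> * b\<^sup>2 + (a - b)\<^sup>2 / \<delta>" by simp
  moreover have "a\<^sup>2 = b\<^sup>2 + 2 * b * (a - b) + (a - b)\<^sup>2" by (simp add: power2_eq_square algebra_simps)
  ultimately have "a\<^sup>2 \<le> b\<^sup>2 + (\<delta> * b\<^sup>2 + (a - b)\<^sup>2 / \<delta>) + (a - b)\<^sup>2" by linarith
  then show ?thesis by (simp add: distrib_right)
qed

lemma measure_lebesgue_open_pos:
  fixes \<Omega> :: "'a::euclidean_space set"
  assumes "open \<Omega>" "bounded \<Omega>" "\<Omega> \<noteq> {}"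
  shows "measure lebesgue \<Omega> > 0" "emeasure lborel \<Omega> = ennreal (measure lebesgue \<Omega>)"
proof -
  have f: "emeasure lborel \<Omega> < \<infinity>" using emeasure_bounded_finite[OF assms(2)] .
  have "\<not> negligible \<Omega>" using assms open_not_negligible by blast
  then have "emeasure lborel \<Omega> \<noteq> 0" using assms(1) by (simp add: negligible_iff_emeasure0)
  moreover have e: "emeasure lebesgue \<Omega> = emeasure lborel \<Omega>" using assms(1) by simp
  ultimately show "measure lebesgue \<Omega> > 0"
    unfolding measure_def using f by (simp add: enn2real_positive_iff zero_less_iff_neq_zero)
  show "emeasure lborel \<Omega> = ennreal (measure lebesgue \<Omega>)"
    unfolding measure_def e using f by simp
qed

text \<open>Leaving \<open>x\<close> in the direction \<open>\<mu> - \<nu>\<close> goes into the set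
  according to \<open>\<nu>\<close> and out of it according to \<open>\<mu>\<close>.\<close>

lemma outer_normal_unique:
  assumes "is_outer_normal \<Omega> x \<nu>" "is_outer_normal \<Omega> x \<mu>"
  shows "\<nu> = \<mu>"
proof (rule ccontr)
  assume "\<nu> \<noteq> \<mu>"
  define d where "d = \<mu> - \<nu>"
  \<comment> \<open>For unit vectors the products of \<open>d\<close> with \<open>\<nu>\<close> and
    \<open>\<mu>\<close> are minus and plus half of \<open>(norm d)\<^sup>2\<close>. Relative to
    \<open>norm d\<close> their modulus is \<open>norm d / 2\<close>, which exceeds this
    \<open>\<epsilon>\<close>.\<close>
  define \<epsilon> where "\<epsilon> = norm d / 4"
  have d: "norm d > 0" using \<open>\<nu> \<noteq> \<mu>\<close> by (simp add: d_def)
  then have \<epsilon>: "\<epsilon> > 0" by (simp add: \<epsilon>_def)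
  have n: "\<nu> \<bullet> \<nu> = 1" "\<mu> \<bullet> \<mu> = 1" using assms by (auto simp: is_outer_normal_def dot_square_norm)
  obtain \<delta>1 where \<delta>1: "\<delta>1 > 0" "\<forall>y\<in>ball x \<delta>1. ((y - x) \<bullet> \<nu> < - \<epsilon> * norm (y - x) \<longrightarrow> y \<in> \<Omega>) \<and>
      ((y - x) \<bullet> \<nu> > \<epsilon> * norm (y - x) \<longrightarrow> y \<notin> \<Omega>)"
    using conjunct2[OF assms(1)[unfolded is_outer_normal_def]] \<epsilon> by meson
  obtain \<delta>2 where \<delta>2: "\<delta>2 > 0" "\<forall>y\<in>ball x \<delta>2. ((y - x) \<bullet> \<mu> < - \<epsilon> * norm (y - x) \<longrightarrow> y \<in> \<Omega>) \<and>
      ((y - x) \<bullet> \<mu> > \<epsilon> * norm (y - x) \<longrightarrow> y \<notin> \<Omega>)"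
    using conjunct2[OF assms(2)[unfolded is_outer_normal_def]] \<epsilon> by meson
  define s where "s = min \<delta>1 \<delta>2 / (2 * norm d)"
  have sd: "s * norm d = min \<delta>1 \<delta>2 / 2" using d by (simp add: s_def)
  have s: "s > 0" "s * norm d < \<delta>1" "s * norm d < \<delta>2"
    using d \<delta>1(1) \<delta>2(1) unfolding sd by (auto simp: s_def)
  define y where "y = x + s *\<^sub>R d"
  have yd: "dist x y = s * norm d" using s by (simp add: y_def dist_norm)
  have dd: "(norm d)\<^sup>2 = 2 - 2 * (\<nu> \<bullet> \<mu>)"
    unfolding power2_norm_eq_inner d_def inner_diff_left inner_diff_right n inner_commute[of \<mu> \<nu>] by linarith
  have e1: "d \<bullet> \<nu> = - ((norm d)\<^sup>2 / 2)" "d \<bullet> \<mu> = (norm d)\<^sup>2 / 2"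
    unfolding dd unfolding d_def inner_diff_left n inner_commute[of \<mu> \<nu>] by (simp_all add: field_simps)
  have "\<epsilon> * norm d < (norm d)\<^sup>2 / 2" using d by (simp add: \<epsilon>_def power2_eq_square)
  then have lt: "s * (\<epsilon> * norm d) < s * ((norm d)\<^sup>2 / 2)"
    using s(1) by (rule mult_strict_left_mono)
  have "norm (y - x) = s * norm d" using s(1) by (simp add: y_def)
  moreover have "(y - x) \<bullet> \<nu> = - (s * ((norm d)\<^sup>2 / 2))" "(y - x) \<bullet> \<mu> = s * ((norm d)\<^sup>2 / 2)"
    unfolding y_def by (simp_all add: e1)
  moreover have "\<epsilon> * (s * norm d) = s * (\<epsilon> * norm d)" by simp
  ultimately have "(y - x) \<bullet> \<nu> < - \<epsilon> * norm (y - x)" "(y - x) \<bullet> \<mu> > \<epsilon> * norm (y - x)"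
    using lt by (simp_all only: minus_mult_left[symmetric] neg_less_iff_less)
  moreover have "y \<in> ball x \<delta>1" "y \<in> ball x \<delta>2" using yd s by simp_all
  ultimately show False using bspec[OF \<delta>1(2)] bspec[OF \<delta>2(2)] by blast
qed

text \<open>The default value 0 of \<open>outer_normal\<close> satisfies the bound too, so the
  weight in the perimeter is bounded at every point.\<close>

lemma norm_outer_normal_le: "norm (outer_normal \<Omega> x) \<le> 1"
proof (cases "\<exists>\<nu>. is_outer_normal \<Omega> x \<nu>")
  case True
  then obtain \<nu> where \<nu>: "is_outer_normal \<Omega> x \<nu>" by blast
  then have "(THE \<nu>. is_outer_normal \<Omega> x \<nu>) = \<nu>"
    by (rule the_equality) (rule outer_normal_unique[OF _ \<nu>])
  then have "outer_normal \<Omega> x = \<nu>" unfolding outer_normal_def using True by (simp only: if_True)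
  then show ?thesis using \<nu> by (simp add: is_outer_normal_def)
qed (simp add: outer_normal_def)

text \<open>In place of the mean, \<open>c\<close> is the value of \<open>\<phi>\<close> at a point
  where the inner integral of the Poincare inequality exceeds its average by an arbitrarily small
  amount at most; this is the origin of \<open>\<eta>\<close>. The trace inequality for
  \<open>\<phi> - c\<close> then controls the boundary with the same \<open>c\<close>.\<close>

lemma poincare_trace_C1:
  fixes \<Omega> :: "'a::euclidean_space set"
  assumes dom: "open \<Omega>" "connected \<Omega>" "bounded \<Omega>" "\<Omega> \<noteq> {}" "lipschitz_boundary \<Omega>"
  obtains K where "K \<ge> 0" "\<And>\<phi> \<eta>. C1_on UNIV \<phi> \<Longrightarrow> \<eta> > 0 \<Longrightarrow>
    \<exists>c. (LINT x|lebesgue_on \<Omega>. (\<phi> x - c)\<^sup>2) \<le> K * (LINT x|lebesgue_on \<Omega>. (norm (grad \<phi> x))\<^sup>2) + \<eta> \<and>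
        (LINT x|boundary_measure \<Omega>. (\<phi> x - c)\<^sup>2) \<le> K * (LINT x|lebesgue_on \<Omega>. (norm (grad \<phi> x))\<^sup>2) + \<eta>"
proof -
  have [measurable]: "\<Omega> \<in> sets borel" using dom by simp
  obtain CP where "CP < top" and CP: "\<And>\<phi>. C1_on UNIV \<phi> \<Longrightarrow>
    (\<integral>\<^sup>+x\<in>\<Omega>. (\<integral>\<^sup>+y\<in>\<Omega>. ennreal ((\<phi> x - \<phi> y)\<^sup>2) \<partial>lborel) \<partial>lborel)
      \<le> CP * (\<integral>\<^sup>+x\<in>\<Omega>. ennreal ((norm (grad \<phi> x))\<^sup>2) \<partial>lborel)"
    using poincare_on_lipschitz_domain[OF dom] unfolding poincare_on_def by blast
  obtain CT where "CT < top" and CT: "\<And>\<phi>. C1_on UNIV \<phi> \<Longrightarrow>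
    (\<integral>\<^sup>+x. ennreal ((\<phi> x)\<^sup>2) \<partial>boundary_measure \<Omega>) \<le>
      CT * (\<integral>\<^sup>+x\<in>\<Omega>. ennreal ((\<phi> x)\<^sup>2 + (norm (grad \<phi> x))\<^sup>2) \<partial>lborel)"
    using trace_inequality[OF dom(1,3,5)] by blast
  define cp where "cp = enn2real CP"
  define ct where "ct = enn2real CT"
  have cp: "CP = ennreal cp" "cp \<ge> 0" and ct: "CT = ennreal ct" "ct \<ge> 0"
    using \<open>CP < top\<close> \<open>CT < top\<close> by (simp_all add: cp_def ct_def)
  define V where "V = measure lebesgue \<Omega>"
  have V: "V > 0" "emeasure lborel \<Omega> = ennreal V"
    using measure_lebesgue_open_pos[OF dom(1,3,4)] by (simp_all add: V_def)
  have finL: "finite_measure (lebesgue_on \<Omega>)" using dom by (simp add: finite_measure_lebesgue_on_bounded)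
  have finB: "finite_measure (boundary_measure \<Omega>)" using dom by (simp add: finite_boundary_measure)
  have spB: "bounded (space (boundary_measure \<Omega>))"
    using compact_frontier_bounded[OF dom(3)]
    by (simp add: boundary_measure_def space_restrict_space hausdorff_measure_def space_measure_of_conv compact_imp_bounded)
  define K where "K = cp / V + ct * (cp / V + 1)"
  have K: "K \<ge> 0" "cp / V \<le> K" "ct * (cp / V + 1) \<le> K" using cp ct V by (auto simp: K_def)
  show ?thesis
  proof (rule that[OF K(1)])
    fix \<phi> :: "'a \<Rightarrow> real" and \<eta> :: real assume \<phi>: "C1_on UNIV \<phi>" and \<eta>: "\<eta> > 0"
    note [measurable] = C1_on_UNIV_measurable[OF \<phi>]
    define D where "D = (LINT x|lebesgue_on \<Omega>. (norm (grad \<phi> x))\<^sup>2)"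
    have D: "D \<ge> 0" by (simp add: D_def)
    have intD: "integrable (lebesgue_on \<Omega>) (\<lambda>x. (norm (grad \<phi> x))\<^sup>2)"
      using sq_integrable_continuous[OF finL borel_measurable_lebesgue_on C1_on_UNIV_continuous_grad[OF \<phi>]]
        dom(3) by (simp add: sq_integrable_def space_restrict_space)
    have nD: "(\<integral>\<^sup>+x\<in>\<Omega>. ennreal ((norm (grad \<phi> x))\<^sup>2) \<partial>lborel) = ennreal D"
      unfolding D_def by (subst nn_integral_lebesgue_on_borel[symmetric]) (auto intro!: nn_integral_eq_integral intD)
    \<comment> \<open>A margin that is at most \<open>\<eta>\<close> both by itself and after
      multiplication by the trace constant.\<close>
    define \<eta>' where "\<eta>' = \<eta> / (ct + 1)"
    have \<eta>': "\<eta>' > 0" "\<eta>' \<le> \<eta>" "ct * \<eta>' \<le> \<eta>"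
      using \<eta> ct by (auto simp: \<eta>'_def field_simps)
    \<comment> \<open>Strictly above the bound for the average of the inner integral, so the inner
      integral cannot exceed it at all points of \<open>\<Omega>\<close>.\<close>
    define R where "R = cp * D / V + \<eta>'"
    have R: "R \<ge> 0" using cp D V \<eta>' by (simp add: R_def)
    have "\<exists>x0\<in>\<Omega>. (\<integral>\<^sup>+y\<in>\<Omega>. ennreal ((\<phi> x0 - \<phi> y)\<^sup>2) \<partial>lborel) \<le> ennreal R"
    proof (rule ccontr)
      assume "\<not> ?thesis"
      then have "\<And>x. x \<in> \<Omega> \<Longrightarrow> ennreal R \<le> (\<integral>\<^sup>+y\<in>\<Omega>. ennreal ((\<phi> x - \<phi> y)\<^sup>2) \<partial>lborel)"
        by (meson linear)
      then have "(\<integral>\<^sup>+x. ennreal R * indicator \<Omega> x \<partial>lborel) \<le>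
          (\<integral>\<^sup>+x\<in>\<Omega>. (\<integral>\<^sup>+y\<in>\<Omega>. ennreal ((\<phi> x - \<phi> y)\<^sup>2) \<partial>lborel) \<partial>lborel)"
        by (intro nn_integral_mono) (auto split: split_indicator)
      also have "\<dots> \<le> ennreal cp * ennreal D" using CP[OF \<phi>] unfolding nD cp(1) .
      finally have "ennreal (R * V) \<le> ennreal (cp * D)"
        using V R cp D by (simp add: nn_integral_cmult_indicator ennreal_mult)
      moreover have "cp * D < R * V" using V \<eta>' by (simp add: R_def distrib_right)
      ultimately show False using cp D by (simp add: ennreal_le_iff)
    qed
    then obtain x0 where x0: "(\<integral>\<^sup>+y\<in>\<Omega>. ennreal ((\<phi> x0 - \<phi> y)\<^sup>2) \<partial>lborel) \<le> ennreal R" by blast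
    define c where "c = \<phi> x0"
    define \<psi> where "\<psi> x = \<phi> x - c" for x
    have \<psi>: "C1_on UNIV \<psi>" unfolding \<psi>_def by (intro C1_on_UNIV_diff \<phi> C1_on_UNIV_const)
    note [measurable] = C1_on_UNIV_measurable[OF \<psi>]
    have g\<psi>: "grad \<psi> x = grad \<phi> x" for x unfolding \<psi>_def using \<phi> by (rule grad_diff_const)
    have intL: "integrable (lebesgue_on \<Omega>) (\<lambda>x. (\<psi> x)\<^sup>2)"
      using sq_integrable_continuous[OF finL borel_measurable_lebesgue_on C1_on_UNIV_continuous[OF \<psi>]]
        dom(3) by (simp add: sq_integrable_def space_restrict_space)
    have intB: "integrable (boundary_measure \<Omega>) (\<lambda>x. (\<psi> x)\<^sup>2)"
      using sq_integrable_continuous[OF finB borel_measurable_boundary_measure C1_on_UNIV_continuous[OF \<psi>]]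
        spB by (simp add: sq_integrable_def)
    define X where "X = (LINT x|lebesgue_on \<Omega>. (\<psi> x)\<^sup>2)"
    have X: "X \<ge> 0" by (simp add: X_def)
    have nX: "(\<integral>\<^sup>+x\<in>\<Omega>. ennreal ((\<psi> x)\<^sup>2) \<partial>lborel) = ennreal X"
      unfolding X_def by (subst nn_integral_lebesgue_on_borel[symmetric]) (auto intro!: nn_integral_eq_integral intL)
    have "ennreal X \<le> ennreal R"
      using x0 unfolding nX[symmetric] \<psi>_def c_def by (simp add: power2_commute)
    then have XR: "X \<le> R" using R by (simp add: ennreal_le_iff)
    have "ennreal (LINT x|boundary_measure \<Omega>. (\<psi> x)\<^sup>2) = (\<integral>\<^sup>+x. ennreal ((\<psi> x)\<^sup>2) \<partial>boundary_measure \<Omega>)"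
      by (rule nn_integral_eq_integral[symmetric, OF intB]) simp
    also have "\<dots> \<le> ennreal ct * (\<integral>\<^sup>+x\<in>\<Omega>. ennreal ((\<psi> x)\<^sup>2 + (norm (grad \<psi> x))\<^sup>2) \<partial>lborel)"
      using CT[OF \<psi>] unfolding ct(1) .
    also have "(\<integral>\<^sup>+x\<in>\<Omega>. ennreal ((\<psi> x)\<^sup>2 + (norm (grad \<psi> x))\<^sup>2) \<partial>lborel) =
        (\<integral>\<^sup>+x. ennreal ((\<psi> x)\<^sup>2) * indicator \<Omega> x + ennreal ((norm (grad \<phi> x))\<^sup>2) * indicator \<Omega> x \<partial>lborel)"
      by (intro nn_integral_cong) (simp add: g\<psi> ennreal_plus distrib_right)
    also have "\<dots> = ennreal X + ennreal D" using nX nD by (simp add: nn_integral_add)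
    also have "ennreal ct * \<dots> = ennreal (ct * (X + D))"
      using ct X D by (simp add: ennreal_mult ennreal_plus)
    finally have B: "(LINT x|boundary_measure \<Omega>. (\<psi> x)\<^sup>2) \<le> ct * (X + D)"
      using ct X D by (simp add: ennreal_le_iff)
    have "R \<le> K * D + \<eta>"
    proof -
      have "cp / V * D \<le> K * D" using K D by (intro mult_right_mono) auto
      then show ?thesis using \<eta>' by (simp add: R_def)
    qed
    moreover have "ct * (X + D) \<le> K * D + \<eta>"
    proof -
      have "ct * (X + D) \<le> ct * (R + D)" using XR ct by (intro mult_left_mono) auto
      also have "\<dots> = ct * (cp / V + 1) * D + ct * \<eta>'" by (simp add: R_def algebra_simps)
      also have "\<dots> \<le> K * D + \<eta>" using K D \<eta>' by (intro add_mono mult_right_mono) auto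
      finally show ?thesis .
    qed
    ultimately show "\<exists>c. (LINT x|lebesgue_on \<Omega>. (\<phi> x - c)\<^sup>2) \<le> K * (LINT x|lebesgue_on \<Omega>. (norm (grad \<phi> x))\<^sup>2) + \<eta> \<and>
        (LINT x|boundary_measure \<Omega>. (\<phi> x - c)\<^sup>2) \<le> K * (LINT x|lebesgue_on \<Omega>. (norm (grad \<phi> x))\<^sup>2) + \<eta>"
      using XR B unfolding D_def[symmetric] X_def \<psi>_def by (intro exI[of _ c]) auto
  qed
qed

section \<open>Passage from smooth functions to functions with a trace\<close>

lemma has_traceD:
  assumes "has_trace \<Omega> v g"
  shows "sq_integrable (lebesgue_on \<Omega>) v" "sq_integrable (boundary_measure \<Omega>) g"
    "sq_integrable (lebesgue_on \<Omega>) (weak_grad \<Omega> v)"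
proof -
  have v: "v \<in> H1 \<Omega>" using assms unfolding has_trace_def by (elim conjE)
  then show "sq_integrable (lebesgue_on \<Omega>) v" by (simp add: H1_def)
  show "sq_integrable (boundary_measure \<Omega>) g" using assms unfolding has_trace_def by (elim conjE)
  have "\<exists>G. has_weak_gradient \<Omega> v G" using v by (simp add: H1_def)
  then have "has_weak_gradient \<Omega> v (weak_grad \<Omega> v)" unfolding weak_grad_def by (rule someI_ex)
  then show "sq_integrable (lebesgue_on \<Omega>) (weak_grad \<Omega> v)"
    unfolding has_weak_gradient_def by (elim conjE)
qed

lemma has_trace_approx:
  assumes "has_trace \<Omega> v g"
  shows "\<exists>\<phi> :: nat \<Rightarrow> 'a::euclidean_space \<Rightarrow> real. (\<forall>k. C1_on UNIV (\<phi> k)) \<and>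
       (\<lambda>k. LINT x|lebesgue_on \<Omega>. (\<phi> k x - v x)\<^sup>2) \<longlonglongrightarrow> 0 \<and>
       (\<lambda>k. LINT x|lebesgue_on \<Omega>. (norm (grad (\<phi> k) x - weak_grad \<Omega> v x))\<^sup>2) \<longlonglongrightarrow> 0 \<and>
       (\<lambda>k. LINT x|boundary_measure \<Omega>. (\<phi> k x - g x)\<^sup>2) \<longlonglongrightarrow> 0"
  using assms unfolding has_trace_def by (elim conjE)

text \<open>The constant \<open>c\<close> may vary along the approximating sequence, so no limit is
  taken: one sufficiently good approximation is fixed, and its errors are absorbed in
  \<open>\<eta>\<close>.\<close>

lemma poincare_trace_H1:
  fixes \<Omega> :: "'a::euclidean_space set"
  assumes dom: "open \<Omega>" "connected \<Omega>" "bounded \<Omega>" "\<Omega> \<noteq> {}" "lipschitz_boundary \<Omega>"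
  obtains K where "K \<ge> 0" "\<And>v g \<eta>. has_trace \<Omega> v g \<Longrightarrow> \<eta> > 0 \<Longrightarrow>
    \<exists>c. (LINT x|lebesgue_on \<Omega>. (v x - c)\<^sup>2) \<le> K * (LINT x|lebesgue_on \<Omega>. (norm (weak_grad \<Omega> v x))\<^sup>2) + \<eta> \<and>
        (LINT x|boundary_measure \<Omega>. (g x - c)\<^sup>2) \<le> K * (LINT x|lebesgue_on \<Omega>. (norm (weak_grad \<Omega> v x))\<^sup>2) + \<eta>"
proof -
  let ?L = "lebesgue_on \<Omega>" and ?B = "boundary_measure \<Omega>"
  obtain K where K: "K \<ge> 0" and C1: "\<And>\<phi> \<eta>. C1_on UNIV \<phi> \<Longrightarrow> \<eta> > 0 \<Longrightarrow>
    \<exists>c. (LINT x|?L. (\<phi> x - c)\<^sup>2) \<le> K * (LINT x|?L. (norm (grad \<phi> x))\<^sup>2) + \<eta> \<and>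
        (LINT x|?B. (\<phi> x - c)\<^sup>2) \<le> K * (LINT x|?L. (norm (grad \<phi> x))\<^sup>2) + \<eta>"
    using poincare_trace_C1[OF dom] by blast
  have finL: "finite_measure ?L" using dom by (simp add: finite_measure_lebesgue_on_bounded)
  have finB: "finite_measure ?B" using dom by (simp add: finite_boundary_measure)
  have spL: "bounded (space ?L)" using dom(3) by (simp add: space_restrict_space)
  have spB: "bounded (space ?B)"
    using compact_frontier_bounded[OF dom(3)]
    by (simp add: boundary_measure_def space_restrict_space hausdorff_measure_def space_measure_of_conv compact_imp_bounded)
  show ?thesis
  proof (rule that[of "4 * K"])
    show "4 * K \<ge> 0" using K by simp
    fix v g and \<eta> :: real assume tr: "has_trace \<Omega> v g" and \<eta>: "\<eta> > 0"
    define G where "G = weak_grad \<Omega> v"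
    note v = has_traceD(1)[OF tr] and g = has_traceD(2)[OF tr] and G = has_traceD(3)[OF tr, folded G_def]
    obtain \<phi> where \<phi>: "\<forall>k. C1_on UNIV (\<phi> k)"
      and l1: "(\<lambda>k. LINT x|?L. (\<phi> k x - v x)\<^sup>2) \<longlonglongrightarrow> 0"
      and l2: "(\<lambda>k. LINT x|?L. (norm (grad (\<phi> k) x - G x))\<^sup>2) \<longlonglongrightarrow> 0"
      and l3: "(\<lambda>k. LINT x|?B. (\<phi> k x - g x)\<^sup>2) \<longlonglongrightarrow> 0"
      using has_trace_approx[OF tr] unfolding G_def[symmetric] by (elim exE conjE)
    \<comment> \<open>Passing from \<open>v\<close> to its approximation and back costs a factor 2
      each time, which puts \<open>4 * K\<close> in front of the Dirichlet term and leaves a total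
      error of \<open>(4 + 4 * K) * \<epsilon>\<close>.\<close>
    define \<epsilon> where "\<epsilon> = \<eta> / (4 + 4 * K)"
    have \<epsilon>: "\<epsilon> > 0" "(4 + 4 * K) * \<epsilon> = \<eta>" using \<eta> K by (auto simp: \<epsilon>_def add_pos_nonneg)
    have "eventually (\<lambda>k. (LINT x|?L. (\<phi> k x - v x)\<^sup>2) < \<epsilon> \<and>
        (LINT x|?L. (norm (grad (\<phi> k) x - G x))\<^sup>2) < \<epsilon> \<and> (LINT x|?B. (\<phi> k x - g x)\<^sup>2) < \<epsilon>) sequentially"
      using order_tendstoD(2)[OF l1 \<epsilon>(1)] order_tendstoD(2)[OF l2 \<epsilon>(1)] order_tendstoD(2)[OF l3 \<epsilon>(1)]
      by eventually_elim simp
    then obtain k where k: "(LINT x|?L. (\<phi> k x - v x)\<^sup>2) < \<epsilon>"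
      "(LINT x|?L. (norm (grad (\<phi> k) x - G x))\<^sup>2) < \<epsilon>" "(LINT x|?B. (\<phi> k x - g x)\<^sup>2) < \<epsilon>"
      unfolding eventually_sequentially by blast
    define f where "f = \<phi> k"
    have f: "C1_on UNIV f" using \<phi> by (simp add: f_def)
    note cm = C1_on_UNIV_measurable[OF f]
    have fL: "sq_integrable ?L f"
      using sq_integrable_continuous[OF finL borel_measurable_lebesgue_on[OF cm(1)] C1_on_UNIV_continuous[OF f] spL] .
    have fB: "sq_integrable ?B f"
      using sq_integrable_continuous[OF finB borel_measurable_boundary_measure[OF cm(1)] C1_on_UNIV_continuous[OF f] spB] .
    have fg: "sq_integrable ?L (grad f)"
      using sq_integrable_continuous[OF finL borel_measurable_lebesgue_on[OF cm(2)] C1_on_UNIV_continuous_grad[OF f] spL] .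
    define D where "D = (LINT x|?L. (norm (G x))\<^sup>2)"
    define A where "A = (LINT x|?L. (norm (grad f x))\<^sup>2)"
    have "A \<le> 2 * (LINT x|?L. (norm (grad f x - G x))\<^sup>2) + 2 * D"
      using integral_norm_diff_square_le[OF fg G sq_integrable_const[OF finL, of 0]] by (simp add: A_def D_def)
    then have A: "A \<le> 2 * \<epsilon> + 2 * D" using k(2) by (simp add: f_def)
    obtain c where cL: "(LINT x|?L. (f x - c)\<^sup>2) \<le> K * A + \<epsilon>" and cB: "(LINT x|?B. (f x - c)\<^sup>2) \<le> K * A + \<epsilon>"
      using C1[OF f \<epsilon>(1)] unfolding A_def by blast
    have KA: "2 * \<epsilon> + 2 * (K * A + \<epsilon>) \<le> 4 * K * D + \<eta>"
    proof -
      have "K * A \<le> K * (2 * \<epsilon> + 2 * D)" using A K by (intro mult_left_mono) auto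
      then have "2 * \<epsilon> + 2 * (K * A + \<epsilon>) \<le> 2 * \<epsilon> + 2 * (K * (2 * \<epsilon> + 2 * D) + \<epsilon>)" by simp
      also have "\<dots> = 4 * K * D + (4 + 4 * K) * \<epsilon>" by (simp add: algebra_simps)
      finally show ?thesis using \<epsilon>(2) by simp
    qed
    have "(LINT x|?L. (v x - c)\<^sup>2) \<le> 2 * (LINT x|?L. (v x - f x)\<^sup>2) + 2 * (LINT x|?L. (f x - c)\<^sup>2)"
      by (rule integral_diff_square_le[OF v fL sq_integrable_const[OF finL]])
    also have "\<dots> \<le> 2 * \<epsilon> + 2 * (K * A + \<epsilon>)"
      using k(1) cL by (simp add: f_def power2_commute[of "v _"])
    finally have 1: "(LINT x|?L. (v x - c)\<^sup>2) \<le> 4 * K * D + \<eta>" using KA by linarith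
    have "(LINT x|?B. (g x - c)\<^sup>2) \<le> 2 * (LINT x|?B. (g x - f x)\<^sup>2) + 2 * (LINT x|?B. (f x - c)\<^sup>2)"
      by (rule integral_diff_square_le[OF g fB sq_integrable_const[OF finB]])
    also have "\<dots> \<le> 2 * \<epsilon> + 2 * (K * A + \<epsilon>)"
      using k(3) cB by (simp add: f_def power2_commute[of "g _"])
    finally have 2: "(LINT x|?B. (g x - c)\<^sup>2) \<le> 4 * K * D + \<eta>" using KA by linarith
    show "\<exists>c. (LINT x|?L. (v x - c)\<^sup>2) \<le> 4 * K * (LINT x|?L. (norm (weak_grad \<Omega> v x))\<^sup>2) + \<eta> \<and>
        (LINT x|?B. (g x - c)\<^sup>2) \<le> 4 * K * (LINT x|?L. (norm (weak_grad \<Omega> v x))\<^sup>2) + \<eta>"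
      using 1 2 unfolding D_def G_def by blast
  qed
qed

text \<open>If the weight \<open>p\<close> is not integrable, its integral is \<open>0\<close> by convention and the
  inequality is trivial; this is why no measurability of \<open>p\<close> is assumed.\<close>

lemma perimeter_mass_le:
  fixes \<Omega> :: "'a::euclidean_space set" and p :: "'a \<Rightarrow> real"
  assumes dom: "open \<Omega>" "connected \<Omega>" "bounded \<Omega>" "\<Omega> \<noteq> {}" "lipschitz_boundary \<Omega>"
    and p: "\<And>x. 0 \<le> p x" "\<And>x. p x \<le> b" and \<delta>: "\<delta> > 0"
  shows "\<exists>\<kappa>\<ge>0. \<forall>v g. has_trace \<Omega> v g \<longrightarrow>
    (LINT x|boundary_measure \<Omega>. p x) * (LINT x|lebesgue_on \<Omega>. (v x)\<^sup>2) \<le>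
      (1 + \<delta>)\<^sup>2 * measure lebesgue \<Omega> * (LINT x|boundary_measure \<Omega>. (g x)\<^sup>2 * p x) +
      \<kappa> * (LINT x|lebesgue_on \<Omega>. (norm (weak_grad \<Omega> v x))\<^sup>2)"
proof -
  let ?L = "lebesgue_on \<Omega>" and ?B = "boundary_measure \<Omega>"
  define V where "V = measure lebesgue \<Omega>"
  have V: "V \<ge> 0" by (simp add: V_def)
  have b: "b \<ge> 0" using p order_trans by blast
  have nonneg: "0 \<le> (LINT x|?B. (g x)\<^sup>2 * p x)" for g using p by simp
  define P where "P = (LINT x|?B. p x)"
  have P: "P \<ge> 0" using p by (simp add: P_def)
  show ?thesis
  proof (cases "integrable ?B p")
    case False
    then have "P = 0" by (simp add: P_def not_integrable_integral_eq)
    then show ?thesis using nonneg V unfolding P_def[symmetric] V_def[symmetric]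
      by (intro exI[of _ 0]) simp
  next
    case True
    then have pm[measurable]: "p \<in> borel_measurable ?B" by auto
    obtain K where K: "K \<ge> 0" and c_ex: "\<And>v g \<eta>. has_trace \<Omega> v g \<Longrightarrow> \<eta> > 0 \<Longrightarrow>
      \<exists>c. (LINT x|?L. (v x - c)\<^sup>2) \<le> K * (LINT x|?L. (norm (weak_grad \<Omega> v x))\<^sup>2) + \<eta> \<and>
          (LINT x|?B. (g x - c)\<^sup>2) \<le> K * (LINT x|?L. (norm (weak_grad \<Omega> v x))\<^sup>2) + \<eta>"
      using poincare_trace_H1[OF dom] by blast
    interpret L: finite_measure ?L using dom by (simp add: finite_measure_lebesgue_on_bounded)
    interpret B: finite_measure ?B using dom by (simp add: finite_boundary_measure)
    have finL: "finite_measure ?L" and finB: "finite_measure ?B" by unfold_locales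
    define d where "d = 1 + 1 / \<delta>"
    have d: "d > 0" using \<delta> by (simp add: d_def add_pos_pos)
    \<comment> \<open>The sum of the errors: the boundary estimate contributes \<open>d * b\<close>,
      multiplied by \<open>(1 + \<delta>) * V\<close> when it is inserted, and the estimate on the
      domain contributes \<open>P * d\<close>.\<close>
    define \<kappa> where "\<kappa> = (1 + \<delta>) * V * d * b + P * d"
    have \<kappa>: "\<kappa> \<ge> 0" using \<delta> V d b P by (simp add: \<kappa>_def)
    have "P * (LINT x|?L. (v x)\<^sup>2) \<le> (1 + \<delta>)\<^sup>2 * V * (LINT x|?B. (g x)\<^sup>2 * p x) +
        (\<kappa> * K) * (LINT x|?L. (norm (weak_grad \<Omega> v x))\<^sup>2)"
      if tr: "has_trace \<Omega> v g" for v g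
    proof -
      define D where "D = (LINT x|?L. (norm (weak_grad \<Omega> v x))\<^sup>2)"
      define Q where "Q = (LINT x|?B. (g x)\<^sup>2 * p x)"
      note v = has_traceD(1)[OF tr] and g = has_traceD(2)[OF tr]
      have [measurable]: "g \<in> borel_measurable ?B" using g by (simp add: sq_integrable_def)
      have eps: "P * (LINT x|?L. (v x)\<^sup>2) \<le> (1 + \<delta>)\<^sup>2 * V * Q + \<kappa> * (K * D + \<eta>)"
        if \<eta>: "\<eta> > 0" for \<eta>
      proof -
        obtain c where X: "(LINT x|?L. (v x - c)\<^sup>2) \<le> K * D + \<eta>" and Y: "(LINT x|?B. (g x - c)\<^sup>2) \<le> K * D + \<eta>"
          using c_ex[OF tr \<eta>] unfolding D_def by blast
        have iv: "integrable ?L (\<lambda>x. (v x - c)\<^sup>2)" "integrable ?L (\<lambda>x. (v x)\<^sup>2)"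
          using sq_integrable_diff[OF v sq_integrable_const[OF finL, of c]] v by (simp_all add: sq_integrable_def)
        have ig: "integrable ?B (\<lambda>x. (g x - c)\<^sup>2)" "integrable ?B (\<lambda>x. (g x)\<^sup>2)"
          using sq_integrable_diff[OF g sq_integrable_const[OF finB, of c]] g by (simp_all add: sq_integrable_def)
        have igp: "integrable ?B (\<lambda>x. (g x)\<^sup>2 * p x)"
        proof (rule Bochner_Integration.integrable_bound)
          show "integrable ?B (\<lambda>x. (g x)\<^sup>2 * b)" using ig(2) by simp
          show "AE x in ?B. norm ((g x)\<^sup>2 * p x) \<le> norm ((g x)\<^sup>2 * b)"
            using p b by (intro AE_I2) (simp add: abs_mult mult_left_mono)
        qed simp
        \<comment> \<open>The constant \<open>c\<close> is the link between domain and boundary: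
          \<open>v\<close> is compared with \<open>c\<close> here, \<open>c\<close> with
          \<open>g\<close> below. Each comparison costs a factor \<open>1 + \<delta>\<close>, hence
          its square in the result.\<close>
        have "(LINT x|?L. (v x)\<^sup>2) \<le> (LINT x|?L. (1 + \<delta>) * c\<^sup>2 + d * (v x - c)\<^sup>2)"
          using iv \<delta> by (intro integral_mono) (auto simp: d_def square_le_young)
        also have "\<dots> = (1 + \<delta>) * c\<^sup>2 * V + d * (LINT x|?L. (v x - c)\<^sup>2)"
        proof -
          have "measure ?L (space ?L) = V"
            using dom(1) by (simp add: V_def measure_restrict_space space_restrict_space)
          then show ?thesis using iv by simp
        qed
        also have "\<dots> \<le> (1 + \<delta>) * c\<^sup>2 * V + d * (K * D + \<eta>)"
          using X d by (intro add_left_mono mult_left_mono) auto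
        finally have m: "(LINT x|?L. (v x)\<^sup>2) \<le> (1 + \<delta>) * c\<^sup>2 * V + d * (K * D + \<eta>)" .
        have "c\<^sup>2 * P = (LINT x|?B. c\<^sup>2 * p x)" by (simp add: P_def)
        also have "\<dots> \<le> (LINT x|?B. (1 + \<delta>) * ((g x)\<^sup>2 * p x) + d * b * (g x - c)\<^sup>2)"
        proof (rule integral_mono)
          fix x
          have "c\<^sup>2 * p x \<le> ((1 + \<delta>) * (g x)\<^sup>2 + d * (c - g x)\<^sup>2) * p x"
            using square_le_young[OF \<delta>, of c "g x"] p(1)[of x] by (intro mult_right_mono) (auto simp: d_def)
          also have "\<dots> = (1 + \<delta>) * ((g x)\<^sup>2 * p x) + d * (g x - c)\<^sup>2 * p x"
            by (simp add: distrib_right power2_commute[of c])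
          also have "d * (g x - c)\<^sup>2 * p x \<le> d * (g x - c)\<^sup>2 * b"
            using p(2) d by (intro mult_left_mono) auto
          finally show "c\<^sup>2 * p x \<le> (1 + \<delta>) * ((g x)\<^sup>2 * p x) + d * b * (g x - c)\<^sup>2"
            by (simp add: mult_ac)
        qed (use True igp ig in auto)
        also have "\<dots> = (1 + \<delta>) * Q + d * b * (LINT x|?B. (g x - c)\<^sup>2)"
          using igp ig by (simp add: Q_def)
        also have "\<dots> \<le> (1 + \<delta>) * Q + d * b * (K * D + \<eta>)"
          using Y d b by (intro add_left_mono mult_left_mono) auto
        finally have cP: "c\<^sup>2 * P \<le> (1 + \<delta>) * Q + d * b * (K * D + \<eta>)" .
        have "P * (LINT x|?L. (v x)\<^sup>2) \<le> P * ((1 + \<delta>) * c\<^sup>2 * V + d * (K * D + \<eta>))"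
          using m P by (rule mult_left_mono)
        also have "\<dots> = (1 + \<delta>) * V * (c\<^sup>2 * P) + P * d * (K * D + \<eta>)"
          by (simp add: algebra_simps)
        also have "\<dots> \<le> (1 + \<delta>) * V * ((1 + \<delta>) * Q + d * b * (K * D + \<eta>)) + P * d * (K * D + \<eta>)"
          using cP \<delta> V by (intro add_right_mono mult_left_mono) auto
        also have "\<dots> = (1 + \<delta>)\<^sup>2 * V * Q + \<kappa> * (K * D + \<eta>)"
          by (simp add: \<kappa>_def power2_eq_square algebra_simps)
        finally show ?thesis .
      qed
      \<comment> \<open>\<open>c\<close> depended on \<open>\<eta>\<close> but has been eliminated,
        so \<open>\<eta>\<close> can now tend to 0.\<close>
      have "P * (LINT x|?L. (v x)\<^sup>2) \<le> (1 + \<delta>)\<^sup>2 * V * Q + \<kappa> * K * D"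
      proof (rule field_le_epsilon)
        fix e :: real assume "e > 0"
        define \<eta> where "\<eta> = e / (\<kappa> + 1)"
        have \<eta>: "\<eta> > 0" "\<kappa> * \<eta> \<le> e" using \<open>e > 0\<close> \<kappa> by (auto simp: \<eta>_def field_simps)
        show "P * (LINT x|?L. (v x)\<^sup>2) \<le> (1 + \<delta>)\<^sup>2 * V * Q + \<kappa> * K * D + e"
          using eps[OF \<eta>(1)] \<eta>(2) by (simp add: distrib_left mult.assoc)
      qed
      then show ?thesis unfolding Q_def D_def .
    qed
    moreover have "\<kappa> * K \<ge> 0" using \<kappa> K by simp
    ultimately show ?thesis unfolding P_def V_def by blast
  qed
qed

section \<open>The two bounds for the eigenvalue and the limit\<close>

theorem mainTheorem2:
  fixes F :: "real^'n \<Rightarrow> real" and \<Omega> :: "(real^'n) set" and a b :: real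
  assumes dim: "CARD('n) \<ge> 2"
    and dom: "open \<Omega>" "connected \<Omega>" "bounded \<Omega>" "\<Omega> \<noteq> {}" "lipschitz_boundary \<Omega>"
    and F_nonneg: "\<And>\<xi>. F \<xi> \<ge> 0"
    and F_convex: "convex_on UNIV F"
    and F_hom: "\<And>t \<xi>. t > 0 \<Longrightarrow> F (t *\<^sub>R \<xi>) = t * F \<xi>"
    and F_C2: "C2_on (- {0}) F"
    and ab: "a > 0" "b > 0"
    and F_bounds: "\<And>\<xi>. a * norm \<xi> \<le> F \<xi> \<and> F \<xi> \<le> b * norm \<xi>"
    and F_hessian: "\<And>\<xi>. \<xi> \<noteq> 0 \<Longrightarrow> positive_definite (hessian (\<lambda>\<eta>. (F \<eta>)\<^sup>2) \<xi>)"
  shows "((\<lambda>\<beta>. robin_eigenvalue F \<beta> \<Omega> / \<beta>) \<longlongrightarrow>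
           anisotropic_perimeter F \<Omega> / measure lebesgue \<Omega>) (at_right 0)"
proof -
  let ?L = "lebesgue_on \<Omega>" and ?B = "boundary_measure \<Omega>"
  define V where "V = measure lebesgue \<Omega>"
  have V: "V > 0" using measure_lebesgue_open_pos[OF dom(1,3,4)] by (simp add: V_def)
  define p where "p x = F (outer_normal \<Omega> x)" for x
  have p: "0 \<le> p x" "p x \<le> b" for x
  proof -
    show "0 \<le> p x" by (simp add: p_def F_nonneg)
    have "F (outer_normal \<Omega> x) \<le> b * norm (outer_normal \<Omega> x)" using F_bounds by blast
    also have "\<dots> \<le> b * 1" using ab norm_outer_normal_le by (intro mult_left_mono) auto
    finally show "p x \<le> b" by (simp add: p_def)
  qed
  define P where "P = (LINT x|?B. p x)"
  have P_eq: "anisotropic_perimeter F \<Omega> = P" by (simp add: P_def p_def anisotropic_perimeter_def)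
  have finL: "finite_measure ?L" using dom by (simp add: finite_measure_lebesgue_on_bounded)
  have finB: "finite_measure ?B" using dom by (simp add: finite_boundary_measure)
  have cF: "continuous_on UNIV F" using F_convex by (intro convex_on_continuous) auto
  then have [measurable]: "F \<in> borel_measurable borel" by (rule borel_measurable_continuous_onI)
  define S where "S \<beta> = {robin_quotient F \<beta> \<Omega> v g | v g.
      v \<in> H1 \<Omega> \<and> \<not> (AE x in ?L. v x = 0) \<and> has_trace \<Omega> v g}" for \<beta>
  have ev_eq: "robin_eigenvalue F \<beta> \<Omega> = Inf (S \<beta>)" for \<beta> by (simp add: robin_eigenvalue_def S_def)
  have nonneg: "0 \<le> q" if "q \<in> S \<beta>" "\<beta> > 0" for q \<beta>
  proof -
    obtain v g where "q = robin_quotient F \<beta> \<Omega> v g" using \<open>q \<in> S \<beta>\<close> unfolding S_def by blast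
    then show ?thesis
      unfolding robin_quotient_def using F_nonneg \<open>\<beta> > 0\<close>
      by (auto intro!: divide_nonneg_nonneg add_nonneg_nonneg mult_nonneg_nonneg integral_nonneg)
  qed

  define one :: "real^'n \<Rightarrow> real" where "one = (\<lambda>x. 1)"
  have wg_one: "has_weak_gradient \<Omega> one (\<lambda>x. 0)"
    unfolding one_def using dom(1) by (rule has_weak_gradient_const)
  then have "has_weak_gradient \<Omega> one (weak_grad \<Omega> one)"
    unfolding weak_grad_def by (rule someI[of "has_weak_gradient \<Omega> one"])
  then have wg0: "AE x in ?L. weak_grad \<Omega> one x = 0"
    unfolding one_def using dom by (intro weak_gradient_const_eq_0) auto
  have one_H1: "one \<in> H1 \<Omega>"
  proof -
    have "sq_integrable ?L one" unfolding one_def using finL by (rule sq_integrable_const)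
    then show ?thesis using wg_one unfolding H1_def by blast
  qed
  have one_trace: "has_trace \<Omega> one one"
    unfolding has_trace_def
  proof (intro conjI one_H1 exI[of _ "\<lambda>k. one"] allI)
    show "sq_integrable ?B one" unfolding one_def using finB by (rule sq_integrable_const)
    show "C1_on UNIV one" unfolding one_def by (rule C1_on_UNIV_const)
    have "(LINT x|?L. (norm (grad one x - weak_grad \<Omega> one x))\<^sup>2) = 0"
    proof (rule integral_eq_zero_AE)
      show "AE x in ?L. (norm (grad one x - weak_grad \<Omega> one x))\<^sup>2 = 0"
        using wg0 by eventually_elim (simp add: one_def grad_const)
    qed
    then show "(\<lambda>k::nat. LINT x|?L. (norm (grad one x - weak_grad \<Omega> one x))\<^sup>2) \<longlonglongrightarrow> 0" by simp
  qed simp_all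
  have meas_L: "measure ?L (space ?L) = V"
    using dom(1) by (simp add: V_def measure_restrict_space space_restrict_space)
  have one_ne: "\<not> (AE x in ?L. one x = 0)"
  proof
    assume "AE x in ?L. one x = 0"
    then have "(LINT x|?L. one x) = 0" by (rule integral_eq_zero_AE)
    then show False using meas_L V by (simp add: one_def)
  qed
  have quot_one: "robin_quotient F \<beta> \<Omega> one one = \<beta> * P / V" for \<beta>
  proof -
    have F0: "F 0 = 0" using F_bounds[of 0] by simp
    have "(LINT x|?L. (F (weak_grad \<Omega> one x))\<^sup>2) = 0"
    proof (rule integral_eq_zero_AE)
      show "AE x in ?L. (F (weak_grad \<Omega> one x))\<^sup>2 = 0" using wg0 by eventually_elim (simp add: F0)
    qed
    then show ?thesis using meas_L by (simp add: robin_quotient_def one_def P_def p_def)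
  qed
  have one_mem: "robin_quotient F \<beta> \<Omega> one one \<in> S \<beta>" for \<beta>
    unfolding S_def using one_H1 one_ne one_trace by blast
  have upper: "robin_eigenvalue F \<beta> \<Omega> / \<beta> \<le> P / V" if "\<beta> > 0" for \<beta>
  proof -
    have "\<beta> * P / V \<in> S \<beta>" using one_mem[of \<beta>] by (simp only: quot_one)
    \<comment> \<open>On the reals \<open>Inf\<close> is meaningful only for nonempty sets that are
      bounded below. The upper bound relies on boundedness, the lower one on nonemptiness, which the
      constant function provides.\<close>
    moreover have "bdd_below (S \<beta>)" by (rule bdd_belowI[of _ 0]) (rule nonneg[OF _ that])
    ultimately have "Inf (S \<beta>) \<le> \<beta> * P / V" by (rule cInf_lower)
    then show ?thesis using that by (simp add: ev_eq field_simps)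
  qed

  have lower: "\<exists>\<beta>0>0. \<forall>\<beta>. 0 < \<beta> \<and> \<beta> < \<beta>0 \<longrightarrow> P / ((1 + \<delta>)\<^sup>2 * V) \<le> robin_eigenvalue F \<beta> \<Omega> / \<beta>"
    if \<delta>: "\<delta> > 0" for \<delta>
  proof -
    obtain \<kappa> where \<kappa>: "\<kappa> \<ge> 0" and mass: "\<forall>v g. has_trace \<Omega> v g \<longrightarrow>
      P * (LINT x|?L. (v x)\<^sup>2) \<le> (1 + \<delta>)\<^sup>2 * V * (LINT x|?B. (g x)\<^sup>2 * p x) +
        \<kappa> * (LINT x|?L. (norm (weak_grad \<Omega> v x))\<^sup>2)"
      using perimeter_mass_le[where p = p, OF dom p \<delta>] unfolding P_def V_def by (elim exE conjE)
    define W where "W = (1 + \<delta>)\<^sup>2 * V"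
    have W: "W > 0" using \<delta> V by (simp add: W_def)
    \<comment> \<open>Below this threshold \<open>\<beta> * \<kappa> \<le> W * a\<^sup>2\<close>, so
      \<open>W * E\<close> absorbs \<open>\<beta> * \<kappa> * D\<close> in view of
      \<open>a\<^sup>2 * D \<le> E\<close>. The summand 1 covers the case
      \<open>\<kappa> = 0\<close>.\<close>
    define \<beta>0 where "\<beta>0 = W * a\<^sup>2 / (\<kappa> + 1)"
    have "\<beta>0 > 0" using W ab \<kappa> by (simp add: \<beta>0_def)
    moreover have "P / W \<le> robin_eigenvalue F \<beta> \<Omega> / \<beta>" if \<beta>: "0 < \<beta>" "\<beta> < \<beta>0" for \<beta>
    proof -
      have \<beta>\<kappa>: "\<beta> * \<kappa> \<le> W * a\<^sup>2"
      proof -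
        have "\<beta> * \<kappa> \<le> \<beta> * (\<kappa> + 1)" using \<beta> by simp
        also have "\<dots> \<le> W * a\<^sup>2" using \<beta> \<kappa> by (simp add: \<beta>0_def field_simps)
        finally show ?thesis .
      qed
      have "\<beta> * P / W \<le> q" if q: "q \<in> S \<beta>" for q
      proof -
        obtain v g where q_eq: "q = robin_quotient F \<beta> \<Omega> v g" and ne: "\<not> (AE x in ?L. v x = 0)"
          and tr: "has_trace \<Omega> v g" using q unfolding S_def by blast
        define m where "m = (LINT x|?L. (v x)\<^sup>2)"
        define G where "G = weak_grad \<Omega> v"
        define D where "D = (LINT x|?L. (norm (G x))\<^sup>2)"
        define E where "E = (LINT x|?L. (F (G x))\<^sup>2)"
        define Q where "Q = (LINT x|?B. (g x)\<^sup>2 * p x)"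
        note v = has_traceD(1)[OF tr]
        have G: "sq_integrable ?L G" unfolding G_def by (rule has_traceD(3)[OF tr])
        then have Gm[measurable]: "G \<in> borel_measurable ?L" by (simp add: sq_integrable_def)
        have D: "D \<ge> 0" by (simp add: D_def)
        \<comment> \<open>\<open>v\<close> does not vanish almost everywhere, so the quotient is a
          true division and not the default value 0.\<close>
        have "m \<noteq> 0"
          using ne v unfolding m_def sq_integrable_def by (subst integral_nonneg_eq_0_iff_AE) auto
        moreover have "m \<ge> 0" by (simp add: m_def)
        ultimately have m: "m > 0" by simp
        \<comment> \<open>Without integrability \<open>E\<close> would be 0 by convention and could
          not dominate \<open>D\<close>; the upper bound on \<open>F\<close> excludes this.\<close>
        have intE: "integrable ?L (\<lambda>x. (F (G x))\<^sup>2)"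
        proof (rule Bochner_Integration.integrable_bound)
          show "integrable ?L (\<lambda>x. b\<^sup>2 * (norm (G x))\<^sup>2)" using G by (simp add: sq_integrable_def)
          have "(F \<xi>)\<^sup>2 \<le> b\<^sup>2 * (norm \<xi>)\<^sup>2" for \<xi>
            using F_bounds[of \<xi>] F_nonneg[of \<xi>] by (simp add: power_mono flip: power_mult_distrib)
          then show "AE x in ?L. norm ((F (G x))\<^sup>2) \<le> norm (b\<^sup>2 * (norm (G x))\<^sup>2)" by simp
        qed simp
        have "(LINT x|?L. a\<^sup>2 * (norm (G x))\<^sup>2) \<le> E"
          unfolding E_def
        proof (rule integral_mono[OF _ intE])
          show "integrable ?L (\<lambda>x. a\<^sup>2 * (norm (G x))\<^sup>2)" using G by (simp add: sq_integrable_def)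
          show "a\<^sup>2 * (norm (G x))\<^sup>2 \<le> (F (G x))\<^sup>2" for x
            using F_bounds[of "G x"] ab by (simp add: power_mono flip: power_mult_distrib)
        qed
        then have E: "a\<^sup>2 * D \<le> E" by (simp add: D_def)
        have mass': "P * m \<le> W * Q + \<kappa> * D"
          using mass[rule_format, OF tr] by (simp add: m_def W_def Q_def D_def G_def)
        have "\<beta> * (P * m) \<le> \<beta> * (W * Q) + (\<beta> * \<kappa>) * D"
          using mult_left_mono[OF mass', of \<beta>] \<beta> by (simp add: distrib_left mult.assoc)
        also have "\<dots> \<le> \<beta> * (W * Q) + (W * a\<^sup>2) * D"
          using \<beta>\<kappa> D by (intro add_left_mono mult_right_mono)
        also have "\<dots> \<le> \<beta> * (W * Q) + W * E"
          using mult_left_mono[OF E, of W] W by (simp add: mult.assoc)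
        also have "\<dots> = W * (E + \<beta> * Q)" by (simp add: algebra_simps)
        finally have "\<beta> * P / W \<le> (E + \<beta> * Q) / m"
          using W m by (simp add: divide_simps mult_ac)
        then show ?thesis
          by (simp add: q_eq robin_quotient_def E_def Q_def m_def G_def p_def)
      qed
      moreover have "S \<beta> \<noteq> {}" using one_mem by blast
      ultimately have "\<beta> * P / W \<le> Inf (S \<beta>)" by (intro cInf_greatest)
      then show ?thesis using \<beta> by (simp add: ev_eq field_simps)
    qed
    ultimately show ?thesis unfolding W_def by blast
  qed

  have "((\<lambda>\<beta>. robin_eigenvalue F \<beta> \<Omega> / \<beta>) \<longlongrightarrow> P / V) (at_right 0)"
  proof (rule order_tendstoI)
    fix y assume y: "y < P / V"
    \<comment> \<open>\<open>\<delta>\<close> is fixed first, by continuity of the lower bound at 0;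
      only then is \<open>\<beta>\<close> made small, since \<open>\<kappa>\<close> and with it
      \<open>\<beta>0\<close> depend on \<open>\<delta>\<close>.\<close>
    have "((\<lambda>\<delta>. P / ((1 + \<delta>)\<^sup>2 * V)) \<longlongrightarrow> P / ((1 + 0)\<^sup>2 * V)) (at_right 0)"
      using V by (intro tendsto_intros) auto
    then have "eventually (\<lambda>\<delta>. y < P / ((1 + \<delta>)\<^sup>2 * V)) (at_right 0)"
      using y by (intro order_tendstoD) auto
    then obtain \<delta> where \<delta>: "\<delta> > 0" "y < P / ((1 + \<delta>)\<^sup>2 * V)"
      unfolding eventually_at_right_field by (metis dense)
    obtain \<beta>0 where "\<beta>0 > 0" "\<And>\<beta>. 0 < \<beta> \<Longrightarrow> \<beta> < \<beta>0 \<Longrightarrow> P / ((1 + \<delta>)\<^sup>2 * V) \<le> robin_eigenvalue F \<beta> \<Omega> / \<beta>"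
      using lower[OF \<delta>(1)] by blast
    then show "eventually (\<lambda>\<beta>. y < robin_eigenvalue F \<beta> \<Omega> / \<beta>) (at_right 0)"
      unfolding eventually_at_right_field using \<delta>(2) by (intro exI[of _ \<beta>0]) (auto intro: less_le_trans)
  next
    fix y assume y: "P / V < y"
    show "eventually (\<lambda>\<beta>. robin_eigenvalue F \<beta> \<Omega> / \<beta> < y) (at_right 0)"
      using eventually_at_right_less[of "0::real"] by eventually_elim (use upper y in force)
  qed
  then show ?thesis unfolding P_eq V_def .
qed

end
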